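(* Let $M$ be a smooth manifold of dimension $n\ge 3$ and let $g_{ab}$ be a pseudo-Riemannian metric on $M$ that is conformal to a pure radiation metric with parallel rays spanned by the null vector field $K^a$. Then the Weyl tensor $C$ of $g$ satisfies $$C_{abcd}K^cX^d=0\quad\text{for all }X^d\text{ with }K_dX^d=0 .$$ Furthermore, there is a gradient field $\Upsilon^a$ (i.e. $\Upsilon_a=\nabla_a\Upsilon$ for a smooth function $\Upsilon$) such that the Weyl tensor $C$, the Cotton tensor $A$ and the Bach tensor $B$ of $g$ satisfy $$\left(A_{abc}+C_{cba}{}^{d}\,\Upsilon_d\right)X^a=0,$$ $$\left(B_{ab}-(n-4)\,C_{acbd}\Upsilon^c\Upsilon^d\right)X^aY^b=0$$ for all $X^a$ and $Y^b$ orthogonal to $K^a$.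
   Context: Abstract index notation is used; indices are raised and lowered with the metric, and $T_{[ab]}=\tfrac12(T_{ab}-T_{ba})$. For a pseudo-Riemannian metric $g_{ab}$ of arbitrary signature on an $n$-manifold with Levi-Civita connection $\nabla$: the curvature is defined by $(\nabla_a\nabla_b-\nabla_b\nabla_a)X^c=R_{ab}{}^{c}{}_{d}X^d$, the Ricci tensor by $R_{ab}=R_{ca}{}^{c}{}_{b}$, the scalar curvature by $R=R_a{}^a$. The Schouten tensor is $\mathsf P_{ab}=\tfrac{1}{n-2}\bigl(R_{ab}-\tfrac{R}{2(n-1)}g_{ab}\bigr)$, the Weyl tensor is $C_{abcd}=R_{abcd}-2(g_{c[a}\mathsf P_{b]d}+g_{d[b}\mathsf P_{a]c})$, the Cotton tensor is $A_{abc}=2\nabla_{[b}\mathsf P_{c]a}$, and the Bach tensor is $B_{ab}=\nabla^cA_{acb}+\mathsf P^{dc}C_{dacb}$. A metric is a pure radiation metric with parallel rays spanned by $K^a$ (also called an aligned pure radiation metric) if $K^a$ is a nowhere vanishing null vector field with $R_{ab}=\phi K_aK_b$ for some function $\phi$ and $\nabla_aK^b=f_aK^b$ for some one-form $f_a$ (all quantities being those of that metric). A metric $g$ is conformal to $\hat g$ if (locally) $\hat g_{ab}=e^{2\Upsilon}g_{ab}$ for a smooth function $\Upsilon$; the statement is local. Orthogonality to $K^a$ is the same for $g$ and $\hat g$. *)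

theory Defs
  imports "HOL-Analysis.Analysis"
begin

section \<open>Smooth functions on open subsets of coordinate space\<close>

definition partial :: "'n::finite \<Rightarrow> (real^'n \<Rightarrow> real) \<Rightarrow> real^'n \<Rightarrow> real" where
  "partial i f x = frechet_derivative f (at x) (axis i 1)"

primrec Ck_on :: "nat \<Rightarrow> (real^'n::finite) set \<Rightarrow> (real^'n \<Rightarrow> real) \<Rightarrow> bool" where
  "Ck_on 0 S f \<longleftrightarrow> continuous_on S f"
| "Ck_on (Suc k) S f \<longleftrightarrow> (\<forall>x\<in>S. f differentiable (at x)) \<and> (\<forall>i. Ck_on k S (partial i f))"

text \<open>This is the usual notion of a \<open>C\<^sup>\<infinity>\<close> function only for open \<open>S\<close>; all uses below are of that kind.\<close>

definition smooth_on :: "(real^'n::finite) set \<Rightarrow> (real^'n \<Rightarrow> real) \<Rightarrow> bool" where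
  "smooth_on S f \<longleftrightarrow> (\<forall>k. Ck_on k S f)"

lemma partial_eqI: "(f has_derivative D) (at x) \<Longrightarrow> partial i f x = D (axis i 1)"
  unfolding partial_def by (metis frechet_derivative_at)

lemma partial_cong_open:
  assumes "open S" "x \<in> S" "\<And>y. y \<in> S \<Longrightarrow> f y = g y"
  shows "partial i f x = partial i g x"
proof -
  have "(f has_derivative D) (at x) \<longleftrightarrow> (g has_derivative D) (at x)" for D
    using has_derivative_transform_within_open[of f D x UNIV S g]
      has_derivative_transform_within_open[of g D x UNIV S f] assms by auto
  then show ?thesis by (simp add: partial_def frechet_derivative_def)
qed

lemma partial_add:
  assumes "f differentiable (at x)" "g differentiable (at x)"
  shows "partial i (\<lambda>y. f y + g y) x = partial i f x + partial i g x"
  using has_derivative_add[OF assms[unfolded frechet_derivative_works]]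
  by (subst partial_eqI) (auto simp: partial_def)

lemma partial_mult:
  assumes "f differentiable (at x)" "g differentiable (at x)"
  shows "partial i (\<lambda>y. f y * g y) x = partial i f x * g x + f x * partial i g x"
  using partial_eqI[OF has_derivative_mult[OF assms[unfolded frechet_derivative_works]]]
  by (simp add: partial_def)

lemma partial_sum:
  assumes "\<And>e. e \<in> I \<Longrightarrow> f e differentiable (at x)"
  shows "partial i (\<lambda>y. \<Sum>e\<in>I. f e y) x = (\<Sum>e\<in>I. partial i (f e) x)"
proof -
  have "((\<lambda>y. \<Sum>e\<in>I. f e y) has_derivative (\<lambda>v. \<Sum>e\<in>I. frechet_derivative (f e) (at x) v)) (at x)"
    by (rule has_derivative_sum) (use assms frechet_derivative_works in blast)
  then show ?thesis by (subst partial_eqI) (auto simp: partial_def)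
qed

lemma partial_const [simp]: "partial i (\<lambda>_. k) x = 0"
  by (simp add: partial_def)

lemma has_real_derivative_partial_line:
  assumes "f differentiable (at (p + s *\<^sub>R axis i 1))"
  shows "((\<lambda>s. f (p + s *\<^sub>R axis i 1)) has_real_derivative partial i f (p + s *\<^sub>R axis i 1)) (at s)"
proof -
  have 1: "((\<lambda>s::real. p + s *\<^sub>R axis i 1) has_derivative (\<lambda>h. h *\<^sub>R axis i 1)) (at s)"
    by (auto intro!: derivative_eq_intros)
  have lin: "linear (frechet_derivative f (at (p + s *\<^sub>R axis i 1)))"
    using assms linear_frechet_derivative by blast
  have "((\<lambda>s. f (p + s *\<^sub>R axis i 1)) has_derivative
      (\<lambda>h. frechet_derivative f (at (p + s *\<^sub>R axis i 1)) (h *\<^sub>R axis i 1))) (at s)"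
    using has_derivative_compose[OF 1] assms frechet_derivative_works by blast
  then show ?thesis
    by (simp add: has_field_derivative_def partial_def linear_scale[OF lin] mult_commute_abs)
qed

lemma second_difference:
  fixes f :: "real^'n::finite \<Rightarrow> real"
  assumes f: "\<And>y. y \<in> cball x (2*h) \<Longrightarrow> f differentiable (at y)"
    and f': "\<And>y. y \<in> cball x (2*h) \<Longrightarrow> partial i f differentiable (at y)"
    and h: "h > 0"
  obtains y where "y \<in> cball x (2*h)"
    "f (x + h *\<^sub>R axis i 1 + h *\<^sub>R axis j 1) - f (x + h *\<^sub>R axis i 1) - f (x + h *\<^sub>R axis j 1) + f x
      = h * (h * partial j (partial i f) y)"
proof -
  let ?e = "\<lambda>i::'n. axis i (1::real)"
  have inb: "x + s *\<^sub>R ?e i + t *\<^sub>R ?e j \<in> cball x (2*h)" if "0 \<le> s" "s \<le> h" "0 \<le> t" "t \<le> h" for s t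
  proof -
    have "norm (s *\<^sub>R ?e i + t *\<^sub>R ?e j) \<le> s + t"
      using norm_triangle_ineq[of "s *\<^sub>R ?e i" "t *\<^sub>R ?e j"] that by (simp add: norm_axis_1)
    moreover have "dist x (x + s *\<^sub>R ?e i + t *\<^sub>R ?e j) = norm (s *\<^sub>R ?e i + t *\<^sub>R ?e j)"
    proof -
      have "x - (x + s *\<^sub>R ?e i + t *\<^sub>R ?e j) = - (s *\<^sub>R ?e i + t *\<^sub>R ?e j)" by simp
      then show ?thesis by (simp only: dist_norm norm_minus_cancel)
    qed
    ultimately show ?thesis using that by simp
  qed
  define u where "u s = f ((x + h *\<^sub>R ?e j) + s *\<^sub>R ?e i) - f (x + s *\<^sub>R ?e i)" for s
  have du: "(u has_real_derivative
      (partial i f ((x + h *\<^sub>R ?e j) + s *\<^sub>R ?e i) - partial i f (x + s *\<^sub>R ?e i))) (at s)"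
    if "0 \<le> s" "s \<le> h" for s
    unfolding u_def
  proof (intro DERIV_diff has_real_derivative_partial_line f)
    show "x + h *\<^sub>R ?e j + s *\<^sub>R ?e i \<in> cball x (2*h)"
      using inb[of s h] that h by (simp only: add.assoc add.commute[of "h *\<^sub>R ?e j"])
    show "x + s *\<^sub>R ?e i \<in> cball x (2*h)"
      using inb[of s 0] that h by simp
  qed
  obtain \<xi> where \<xi>: "0 < \<xi>" "\<xi> < h" "u h - u 0 =
      (h - 0) * (partial i f ((x + h *\<^sub>R ?e j) + \<xi> *\<^sub>R ?e i) - partial i f (x + \<xi> *\<^sub>R ?e i))"
    using MVT2[OF h du] by auto
  define w where "w t = partial i f ((x + \<xi> *\<^sub>R ?e i) + t *\<^sub>R ?e j)" for t
  have dw: "(w has_real_derivative partial j (partial i f) ((x + \<xi> *\<^sub>R ?e i) + t *\<^sub>R ?e j)) (at t)"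
    if "0 \<le> t" "t \<le> h" for t
    unfolding w_def
    using inb[of \<xi> t] that \<xi>(1,2) by (intro has_real_derivative_partial_line f') simp
  obtain \<eta> where \<eta>: "0 < \<eta>" "\<eta> < h" "w h - w 0 =
      (h - 0) * partial j (partial i f) ((x + \<xi> *\<^sub>R ?e i) + \<eta> *\<^sub>R ?e j)"
    using MVT2[OF h dw] by auto
  have "f (x + h *\<^sub>R ?e i + h *\<^sub>R ?e j) - f (x + h *\<^sub>R ?e i) - f (x + h *\<^sub>R ?e j) + f x = u h - u 0"
    by (simp add: u_def algebra_simps)
  also have "\<dots> = h * (w h - w 0)"
    using \<xi>(3) by (simp add: w_def algebra_simps)
  also have "\<dots> = h * (h * partial j (partial i f) ((x + \<xi> *\<^sub>R ?e i) + \<eta> *\<^sub>R ?e j))"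
    using \<eta>(3) by simp
  finally show thesis
    using inb[of \<xi> \<eta>] \<xi>(1,2) \<eta>(1,2) by (intro that) simp_all
qed

lemma partial_commute:
  fixes f :: "real^'n::finite \<Rightarrow> real"
  assumes S: "open S" "x \<in> S" and f: "smooth_on S f"
  shows "partial i (partial j f) x = partial j (partial i f) x"
proof (rule ccontr)
  assume ne: "partial i (partial j f) x \<noteq> partial j (partial i f) x"
  define r where "r = \<bar>partial i (partial j f) x - partial j (partial i f) x\<bar> / 2"
  have r: "r > 0" using ne by (simp add: r_def)
  have C2: "Ck_on (Suc (Suc 0)) S f" using f unfolding smooth_on_def by blast
  have d1: "\<And>y. y \<in> S \<Longrightarrow> f differentiable (at y)"
    and d2: "\<And>y k. y \<in> S \<Longrightarrow> partial k f differentiable (at y)"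
    and c: "\<And>k l. continuous_on S (partial k (partial l f))"
    using C2 by auto
  have ev: "\<exists>d>0. \<forall>y. dist y x < d \<longrightarrow> y \<in> S \<and> dist (partial k (partial l f) y) (partial k (partial l f) x) < r" for k l
  proof -
    have "isCont (partial k (partial l f)) x" using c S continuous_on_eq_continuous_at by blast
    then obtain d where d: "d > 0" "\<And>y. dist y x < d \<Longrightarrow> dist (partial k (partial l f) y) (partial k (partial l f) x) < r"
      using r unfolding continuous_at_eps_delta by blast
    obtain d' where d': "d' > 0" "ball x d' \<subseteq> S" using S openE by blast
    show ?thesis
      by (rule exI[of _ "min d d'"]) (use d d' in \<open>auto simp: subset_iff dist_commute\<close>)
  qed
  obtain d where d: "d > 0" "\<And>y. dist y x < d \<Longrightarrow> y \<in> S \<and> dist (partial i (partial j f) y) (partial i (partial j f) x) < r"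
    using ev[of i j] by blast
  obtain d' where d': "d' > 0" "\<And>y. dist y x < d' \<Longrightarrow> y \<in> S \<and> dist (partial j (partial i f) y) (partial j (partial i f) x) < r"
    using ev[of j i] by blast
  define h where "h = min d d' / 4"
  have h: "h > 0" "2 * h < d" "2 * h < d'" using d(1) d'(1) by (auto simp: h_def)
  have inS: "\<And>y. y \<in> cball x (2*h) \<Longrightarrow> y \<in> S" using d(2) h(2) by (metis dist_commute mem_cball order_le_less_trans)
  obtain y where y: "y \<in> cball x (2*h)"
    "f (x + h *\<^sub>R axis i 1 + h *\<^sub>R axis j 1) - f (x + h *\<^sub>R axis i 1) - f (x + h *\<^sub>R axis j 1) + f x
      = h * (h * partial j (partial i f) y)"
    by (rule second_difference[of x h f i j, OF d1[OF inS] d2[OF inS] h(1)])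
  obtain z where z: "z \<in> cball x (2*h)"
    "f (x + h *\<^sub>R axis j 1 + h *\<^sub>R axis i 1) - f (x + h *\<^sub>R axis j 1) - f (x + h *\<^sub>R axis i 1) + f x
      = h * (h * partial i (partial j f) z)"
    by (rule second_difference[of x h f j i, OF d1[OF inS] d2[OF inS] h(1)])
  have "x + h *\<^sub>R axis i 1 + h *\<^sub>R axis j 1 = x + h *\<^sub>R axis j 1 + h *\<^sub>R axis i 1" by (simp add: algebra_simps)
  from y(2)[unfolded this] z(2) have "h * (h * partial j (partial i f) y) = h * (h * partial i (partial j f) z)" by linarith
  then have yz: "partial j (partial i f) y = partial i (partial j f) z" using h by simp
  have "dist (partial i (partial j f) x) (partial j (partial i f) x)
      \<le> dist (partial i (partial j f) z) (partial i (partial j f) x)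
        + dist (partial j (partial i f) y) (partial j (partial i f) x)"
    unfolding yz by (rule dist_triangle3)
  also have "\<dots> < r + r"
    using d'(2)[of y] y(1) d(2)[of z] z(1) h by (intro add_strict_mono) (auto simp: dist_commute)
  finally show False by (simp add: r_def dist_real_def)
qed

lemma smooth_on_differentiable:
  assumes "smooth_on S f" "x \<in> S"
  shows "f differentiable (at x)"
proof -
  have "Ck_on (Suc 0) S f" using assms(1) unfolding smooth_on_def by blast
  then show ?thesis using assms(2) by simp
qed

lemma smooth_on_partial:
  assumes "smooth_on S f"
  shows "smooth_on S (partial i f)"
  unfolding smooth_on_def
proof
  fix k
  have "Ck_on (Suc k) S f" using assms unfolding smooth_on_def by blast
  then show "Ck_on k S (partial i f)" by simp
qed


section \<open>Tensor calculus of a metric in local coordinates\<close>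

text \<open>
  A metric on a coordinate domain is given by its component matrices \<open>G x\<close>.
  Abstract indices become component indices. In every covariant derivative
  the differentiation index comes first, and indices are listed in the order in which the
  mathematical notation lists them, upper and lower ones together.
\<close>

type_synonym 'n metric_comps = "real^'n \<Rightarrow> real^'n^'n"

definition antisym2 :: "('n \<Rightarrow> 'n \<Rightarrow> real) \<Rightarrow> 'n \<Rightarrow> 'n \<Rightarrow> real" where
  "antisym2 T a b = (T a b - T b a) / 2"

definition ginv :: "'n::finite metric_comps \<Rightarrow> real^'n \<Rightarrow> 'n \<Rightarrow> 'n \<Rightarrow> real" where
  "ginv G x a b = matrix_inv (G x) $ a $ b"

definition lower :: "'n::finite metric_comps \<Rightarrow> real^'n \<Rightarrow> real^'n \<Rightarrow> 'n \<Rightarrow> real" where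
  "lower G x X a = (\<Sum>b\<in>UNIV. G x $ a $ b * X $ b)"

text \<open>\<open>christoffel G x c a b\<close> is the symbol \<open>\<Gamma>\<^sup>c\<^sub>a\<^sub>b\<close> of the Levi-Civita connection.\<close>

definition christoffel :: "'n::finite metric_comps \<Rightarrow> real^'n \<Rightarrow> 'n \<Rightarrow> 'n \<Rightarrow> 'n \<Rightarrow> real" where
  "christoffel G x c a b =
     (\<Sum>d\<in>UNIV. ginv G x c d *
        (partial a (\<lambda>y. G y $ b $ d) x + partial b (\<lambda>y. G y $ a $ d) x
          - partial d (\<lambda>y. G y $ a $ b) x)) / 2"

text \<open>\<open>\<nabla>\<^sub>a X\<^sup>b\<close>\<close>

definition cov_vec ::
    "'n::finite metric_comps \<Rightarrow> (real^'n \<Rightarrow> real^'n) \<Rightarrow> real^'n \<Rightarrow> 'n \<Rightarrow> 'n \<Rightarrow> real" where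
  "cov_vec G X x a b =
     partial a (\<lambda>y. X y $ b) x + (\<Sum>e\<in>UNIV. christoffel G x b a e * X x $ e)"

text \<open>\<open>\<nabla>\<^sub>a T\<^sub>b\<^sup>c\<close>\<close>

definition cov_mixed ::
    "'n::finite metric_comps \<Rightarrow> (real^'n \<Rightarrow> 'n \<Rightarrow> 'n \<Rightarrow> real) \<Rightarrow> real^'n \<Rightarrow> 'n \<Rightarrow> 'n \<Rightarrow> 'n \<Rightarrow> real" where
  "cov_mixed G T x a b c =
     partial a (\<lambda>y. T y b c) x
     - (\<Sum>e\<in>UNIV. christoffel G x e a b * T x e c)
     + (\<Sum>e\<in>UNIV. christoffel G x c a e * T x b e)"

text \<open>\<open>\<nabla>\<^sub>a T\<^sub>b\<^sub>c\<close> and \<open>\<nabla>\<^sub>a T\<^sub>b\<^sub>c\<^sub>d\<close>\<close>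

definition cov2 ::
    "'n::finite metric_comps \<Rightarrow> (real^'n \<Rightarrow> 'n \<Rightarrow> 'n \<Rightarrow> real) \<Rightarrow> real^'n \<Rightarrow> 'n \<Rightarrow> 'n \<Rightarrow> 'n \<Rightarrow> real" where
  "cov2 G T x a b c =
     partial a (\<lambda>y. T y b c) x
     - (\<Sum>e\<in>UNIV. christoffel G x e a b * T x e c)
     - (\<Sum>e\<in>UNIV. christoffel G x e a c * T x b e)"

definition cov3 ::
    "'n::finite metric_comps \<Rightarrow> (real^'n \<Rightarrow> 'n \<Rightarrow> 'n \<Rightarrow> 'n \<Rightarrow> real) \<Rightarrow> real^'n \<Rightarrow> 'n \<Rightarrow> 'n \<Rightarrow> 'n \<Rightarrow> 'n \<Rightarrow> real" where
  "cov3 G T x a b c d =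
     partial a (\<lambda>y. T y b c d) x
     - (\<Sum>e\<in>UNIV. christoffel G x e a b * T x e c d)
     - (\<Sum>e\<in>UNIV. christoffel G x e a c * T x b e d)
     - (\<Sum>e\<in>UNIV. christoffel G x e a d * T x b c e)"

text \<open>\<open>\<nabla>\<^sub>a \<nabla>\<^sub>b X\<^sup>c\<close>\<close>

definition cov_cov_vec ::
    "'n::finite metric_comps \<Rightarrow> (real^'n \<Rightarrow> real^'n) \<Rightarrow> real^'n \<Rightarrow> 'n \<Rightarrow> 'n \<Rightarrow> 'n \<Rightarrow> real" where
  "cov_cov_vec G X = cov_mixed G (cov_vec G X)"

text \<open>
  The component \<open>R\<^sub>a\<^sub>b\<^sup>c\<^sub>d\<close> is read off from the defining identity
  \<open>(\<nabla>\<^sub>a\<nabla>\<^sub>b - \<nabla>\<^sub>b\<nabla>\<^sub>a) X\<^sup>c = R\<^sub>a\<^sub>b\<^sup>c\<^sub>d X\<^sup>d\<close> by taking for \<open>X\<close> the coordinate vector field with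
  constant components \<open>axis d 1\<close>. The identity for arbitrary smooth \<open>X\<close> is
  \<open>ricci_identity\<close> below.
\<close>

definition riemann ::
    "'n::finite metric_comps \<Rightarrow> real^'n \<Rightarrow> 'n \<Rightarrow> 'n \<Rightarrow> 'n \<Rightarrow> 'n \<Rightarrow> real" where
  "riemann G x a b c d =
     cov_cov_vec G (\<lambda>_. axis d 1) x a b c - cov_cov_vec G (\<lambda>_. axis d 1) x b a c"

lemma ginv_differentiable:
  fixes G :: "'n::finite metric_comps"
  assumes S: "open S" "x \<in> S" and inv: "\<And>y. y \<in> S \<Longrightarrow> invertible (G y)"
    and G: "\<And>i j. smooth_on S (\<lambda>y. G y $ i $ j)"
  shows "(\<lambda>y. ginv G y k l) differentiable (at x)"
proof -
  have dd: "(\<lambda>y. det (H y)) differentiable (at x)"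
    if "\<And>i j. (\<lambda>y. H y $ i $ j) differentiable (at x)" for H :: "'n metric_comps"
  proof -
    have "(\<lambda>y. \<Prod>i\<in>UNIV. H y $ i $ p i) differentiable (at x)" for p
      by (rule differentiableI, rule has_derivative_prod, rule frechet_derivative_works[THEN iffD1], rule that)
    then show ?thesis
      unfolding det_def by (intro differentiable_sum ballI differentiable_mult differentiable_const) simp_all
  qed
  define N where "N y = (\<chi> i j. if j = k then (axis l 1 :: real^'n) $ i else G y $ i $ j)" for y
  have eq: "det (N y) / det (G y) = ginv G y k l" if "y \<in> S" for y
  proof -
    have "\<exists>A. G y ** A = mat 1 \<and> A ** G y = mat 1"
      using inv[OF that] unfolding invertible_def .
    from someI_ex[OF this] have "G y ** matrix_inv (G y) = mat 1"
      by (simp add: matrix_inv_def)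
    then have "G y *v (matrix_inv (G y) *v axis l 1) = axis l 1"
      by (simp add: matrix_vector_mul_assoc)
    then have "matrix_inv (G y) *v axis l 1 =
        (\<chi> k. det (\<chi> i j. if j = k then (axis l 1 :: real^'n) $ i else G y $ i $ j) / det (G y))"
      using inv[OF that] cramer invertible_det_nz by blast
    then show ?thesis
      by (simp add: vec_eq_iff N_def ginv_def matrix_vector_mult_def axis_def if_distrib sum.delta cong: if_cong)
  qed
  have "(\<lambda>y. N y $ i $ j) differentiable (at x)" for i j
    using smooth_on_differentiable[OF G S(2)] by (cases "j = k") (simp_all add: N_def)
  then have "(\<lambda>y. det (N y) / det (G y)) differentiable (at x)"
    using smooth_on_differentiable[OF G S(2)] inv[OF S(2)]
    by (intro differentiable_divide dd) (auto simp: invertible_det_nz)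
  then obtain D where "((\<lambda>y. det (N y) / det (G y)) has_derivative D) (at x)"
    unfolding differentiable_def by blast
  then have "((\<lambda>y. ginv G y k l) has_derivative D) (at x)"
    using S eq by (rule has_derivative_transform_within_open)
  then show ?thesis unfolding differentiable_def by blast
qed

lemma christoffel_differentiable:
  fixes G :: "'n::finite metric_comps"
  assumes "open S" "x \<in> S" "\<And>y. y \<in> S \<Longrightarrow> invertible (G y)" "\<And>i j. smooth_on S (\<lambda>y. G y $ i $ j)"
  shows "(\<lambda>y. christoffel G y c a b) differentiable (at x)"
  unfolding christoffel_def
  by (intro differentiable_divide differentiable_sum ballI differentiable_mult differentiable_diff differentiable_add
      differentiable_const ginv_differentiable[OF assms]
      smooth_on_differentiable[OF smooth_on_partial[OF assms(4)] assms(2)]) auto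

lemma christoffel_sym:
  fixes G :: "'n::finite metric_comps"
  assumes "open S" "x \<in> S" "\<And>y. y \<in> S \<Longrightarrow> transpose (G y) = G y"
  shows "christoffel G x c a b = christoffel G x c b a"
proof -
  have eq: "G y $ a $ b = G y $ b $ a" if "y \<in> S" for y
    using arg_cong[OF assms(3)[OF that], of "\<lambda>A. A $ b $ a"] by (simp add: transpose_def)
  have "partial d (\<lambda>y. G y $ a $ b) x = partial d (\<lambda>y. G y $ b $ a) x" for d
    by (rule partial_cong_open[OF assms(1,2) eq])
  then show ?thesis by (simp add: christoffel_def algebra_simps)
qed

lemma cov_cov_vec_expand:
  fixes G :: "'n::finite metric_comps"
  assumes \<Gamma>: "\<And>a b c. (\<lambda>y. christoffel G y c a b) differentiable (at x)"
    and X: "\<And>c. (\<lambda>y. X y $ c) differentiable (at x)"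
    and X': "\<And>b c. partial b (\<lambda>y. X y $ c) differentiable (at x)"
  shows "cov_cov_vec G X x a b c =
     partial a (partial b (\<lambda>y. X y $ c)) x
     + (\<Sum>e\<in>UNIV. partial a (\<lambda>y. christoffel G y c b e) x * X x $ e)
     + (\<Sum>e\<in>UNIV. christoffel G x c b e * partial a (\<lambda>y. X y $ e) x)
     + (\<Sum>e\<in>UNIV. christoffel G x c a e * partial b (\<lambda>y. X y $ e) x)
     + (\<Sum>d\<in>UNIV. (\<Sum>e\<in>UNIV. christoffel G x c a e * christoffel G x e b d) * X x $ d)
     - (\<Sum>e\<in>UNIV. christoffel G x e a b * cov_vec G X x e c)"
proof -
  have 1: "partial a (\<lambda>y. cov_vec G X y b c) x =
     partial a (partial b (\<lambda>y. X y $ c)) x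
     + (\<Sum>e\<in>UNIV. partial a (\<lambda>y. christoffel G y c b e) x * X x $ e
                 + christoffel G x c b e * partial a (\<lambda>y. X y $ e) x)"
  proof -
    have "(\<lambda>y. \<Sum>e\<in>UNIV. christoffel G y c b e * X y $ e) differentiable (at x)"
      by (intro differentiable_sum ballI differentiable_mult \<Gamma> X finite)
    then show ?thesis
      unfolding cov_vec_def by (simp add: partial_add partial_sum partial_mult \<Gamma> X X')
  qed
  have 2: "(\<Sum>e\<in>UNIV. christoffel G x c a e * (\<Sum>f\<in>UNIV. christoffel G x e b f * X x $ f))
     = (\<Sum>d\<in>UNIV. (\<Sum>e\<in>UNIV. christoffel G x c a e * christoffel G x e b d) * X x $ d)"
    unfolding sum_distrib_left sum_distrib_right mult.assoc by (rule sum.swap)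
  show ?thesis
    unfolding cov_cov_vec_def cov_mixed_def 1 2[symmetric]
    by (simp add: cov_vec_def sum.distrib algebra_simps)
qed

proposition ricci_identity:
  fixes G :: "'n::finite metric_comps"
  assumes S: "open S" "x \<in> S"
    and G: "\<And>i j. smooth_on S (\<lambda>y. G y $ i $ j)"
      "\<And>y. y \<in> S \<Longrightarrow> transpose (G y) = G y" "\<And>y. y \<in> S \<Longrightarrow> invertible (G y)"
    and X: "\<And>k. smooth_on S (\<lambda>y. X y $ k)"
  shows "cov_cov_vec G X x a b c - cov_cov_vec G X x b a c =
           (\<Sum>d\<in>UNIV. riemann G x a b c d * X x $ d)"
proof -
  have \<Gamma>: "(\<lambda>y. christoffel G y c a b) differentiable (at x)" for a b c
    by (rule christoffel_differentiable[OF S G(3) G(1)])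
  have sym: "christoffel G x e b a = christoffel G x e a b" for e
    by (rule christoffel_sym[OF S G(2)])
  have dX: "(\<lambda>y. X y $ c) differentiable (at x)" "partial b (\<lambda>y. X y $ c) differentiable (at x)" for b c
    using X S smooth_on_differentiable smooth_on_partial by blast+
  have z: "partial b (\<lambda>y. k) = (\<lambda>_. 0)" for b :: 'n and k
    by auto
  have R: "riemann G x a b c d =
      partial a (\<lambda>y. christoffel G y c b d) x - partial b (\<lambda>y. christoffel G y c a d) x
      + (\<Sum>e\<in>UNIV. christoffel G x c a e * christoffel G x e b d)
      - (\<Sum>e\<in>UNIV. christoffel G x c b e * christoffel G x e a d)" for d
    unfolding riemann_def
    by (subst (1 2) cov_cov_vec_expand)
       (simp_all add: \<Gamma> z sym axis_def if_distrib sum.delta cong: if_cong)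
  have E: "cov_cov_vec G X x a b c =
     partial a (partial b (\<lambda>y. X y $ c)) x
     + (\<Sum>e\<in>UNIV. partial a (\<lambda>y. christoffel G y c b e) x * X x $ e)
     + (\<Sum>e\<in>UNIV. christoffel G x c b e * partial a (\<lambda>y. X y $ e) x)
     + (\<Sum>e\<in>UNIV. christoffel G x c a e * partial b (\<lambda>y. X y $ e) x)
     + (\<Sum>d\<in>UNIV. (\<Sum>e\<in>UNIV. christoffel G x c a e * christoffel G x e b d) * X x $ d)
     - (\<Sum>e\<in>UNIV. christoffel G x e a b * cov_vec G X x e c)" for a b
    by (rule cov_cov_vec_expand[OF \<Gamma> dX])
  show ?thesis
    unfolding R E
    by (simp add: partial_commute[OF S X, of a b] sym algebra_simps sum.distrib sum_subtractf)
qed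

text \<open>\<open>R\<^sub>a\<^sub>b\<^sub>c\<^sub>d\<close>, the third index of \<^const>\<open>riemann\<close> being lowered.\<close>

definition riemann_low ::
    "'n::finite metric_comps \<Rightarrow> real^'n \<Rightarrow> 'n \<Rightarrow> 'n \<Rightarrow> 'n \<Rightarrow> 'n \<Rightarrow> real" where
  "riemann_low G x a b c d = (\<Sum>e\<in>UNIV. G x $ c $ e * riemann G x a b e d)"

definition ricci :: "'n::finite metric_comps \<Rightarrow> real^'n \<Rightarrow> 'n \<Rightarrow> 'n \<Rightarrow> real" where
  "ricci G x a b = (\<Sum>c\<in>UNIV. riemann G x c a c b)"

definition scal :: "'n::finite metric_comps \<Rightarrow> real^'n \<Rightarrow> real" where
  "scal G x = (\<Sum>a\<in>UNIV. \<Sum>b\<in>UNIV. ginv G x a b * ricci G x a b)"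

definition schouten :: "'n::finite metric_comps \<Rightarrow> real^'n \<Rightarrow> 'n \<Rightarrow> 'n \<Rightarrow> real" where
  "schouten G x a b =
     1 / (real CARD('n) - 2) *
       (ricci G x a b - scal G x / (2 * (real CARD('n) - 1)) * G x $ a $ b)"

definition weyl ::
    "'n::finite metric_comps \<Rightarrow> real^'n \<Rightarrow> 'n \<Rightarrow> 'n \<Rightarrow> 'n \<Rightarrow> 'n \<Rightarrow> real" where
  "weyl G x a b c d =
     riemann_low G x a b c d
     - 2 * (antisym2 (\<lambda>a b. G x $ c $ a * schouten G x b d) a b
            + antisym2 (\<lambda>b a. G x $ d $ b * schouten G x a c) b a)"

definition cotton ::
    "'n::finite metric_comps \<Rightarrow> real^'n \<Rightarrow> 'n \<Rightarrow> 'n \<Rightarrow> 'n \<Rightarrow> real" where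
  "cotton G x a b c = 2 * antisym2 (\<lambda>b c. cov2 G (schouten G) x b c a) b c"

text \<open>\<open>P\<^sup>a\<^sup>b\<close>\<close>

definition schouten_up :: "'n::finite metric_comps \<Rightarrow> real^'n \<Rightarrow> 'n \<Rightarrow> 'n \<Rightarrow> real" where
  "schouten_up G x a b =
     (\<Sum>e\<in>UNIV. \<Sum>f\<in>UNIV. ginv G x a e * ginv G x b f * schouten G x e f)"

definition bach :: "'n::finite metric_comps \<Rightarrow> real^'n \<Rightarrow> 'n \<Rightarrow> 'n \<Rightarrow> real" where
  "bach G x a b =
     (\<Sum>c\<in>UNIV. \<Sum>e\<in>UNIV. ginv G x c e * cov3 G (cotton G) x e a c b)
     + (\<Sum>d\<in>UNIV. \<Sum>c\<in>UNIV. schouten_up G x d c * weyl G x d a c b)"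

text \<open>\<open>grad G u x a\<close> is the component \<open>g\<^sup>a\<^sup>b \<nabla>\<^sub>b u\<close>.\<close>

definition grad :: "'n::finite metric_comps \<Rightarrow> (real^'n \<Rightarrow> real) \<Rightarrow> real^'n \<Rightarrow> 'n \<Rightarrow> real" where
  "grad G u x a = (\<Sum>b\<in>UNIV. ginv G x a b * partial b u x)"


section \<open>Smooth manifolds and fields on them\<close>

text \<open>
  A chart is a pair of its domain and its coordinate map; the dimension of the manifold is
  \<open>CARD('n)\<close>. A field on a manifold is given by its components in each chart, as functions of the
  coordinates, subject to the usual transformation laws. Its values outside the image of the
  chart carry no meaning.
\<close>

type_synonym ('m, 'n) chart = "'m set \<times> ('m \<Rightarrow> real^'n)"
type_synonym ('m, 'n) vec_field = "('m, 'n) chart \<Rightarrow> real^'n \<Rightarrow> real^'n"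
type_synonym ('m, 'n) metric_field = "('m, 'n) chart \<Rightarrow> 'n metric_comps"

definition chart_inv :: "('m, 'n) chart \<Rightarrow> real^'n \<Rightarrow> 'm" where
  "chart_inv c = inv_into (fst c) (snd c)"

definition chart_image :: "('m, 'n) chart \<Rightarrow> (real^'n) set" where
  "chart_image c = snd c ` fst c"

definition overlap :: "('m, 'n) chart \<Rightarrow> ('m, 'n) chart \<Rightarrow> (real^'n) set" where
  "overlap c d = snd c ` (fst c \<inter> fst d)"

definition transition :: "('m, 'n) chart \<Rightarrow> ('m, 'n) chart \<Rightarrow> real^'n \<Rightarrow> real^'n" where
  "transition c d x = snd d (chart_inv c x)"

definition smooth_manifold :: "'m topology \<Rightarrow> ('m, 'n::finite) chart set \<Rightarrow> bool" where
  "smooth_manifold M A \<longleftrightarrow>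
     Hausdorff_space M \<and> second_countable M \<and>
     (\<Union>c\<in>A. fst c) = topspace M \<and>
     (\<forall>c\<in>A. openin M (fst c) \<and> open (chart_image c) \<and>
        homeomorphic_map (subtopology M (fst c)) (top_of_set (chart_image c)) (snd c)) \<and>
     (\<forall>c\<in>A. \<forall>d\<in>A. \<forall>k. smooth_on (overlap c d) (\<lambda>x. transition c d x $ k))"

definition smooth_function_on ::
    "('m, 'n::finite) chart set \<Rightarrow> 'm set \<Rightarrow> ('m \<Rightarrow> real) \<Rightarrow> bool" where
  "smooth_function_on A V u \<longleftrightarrow> (\<forall>c\<in>A. smooth_on (snd c ` (fst c \<inter> V)) (u \<circ> chart_inv c))"

text \<open>\<open>jacobian c d x k i\<close> is the derivative of the \<open>k\<close>-th coordinate of \<open>d\<close> with respect to the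
  \<open>i\<close>-th coordinate of \<open>c\<close>.\<close>

definition jacobian ::
    "('m, 'n::finite) chart \<Rightarrow> ('m, 'n) chart \<Rightarrow> real^'n \<Rightarrow> 'n \<Rightarrow> 'n \<Rightarrow> real" where
  "jacobian c d x k i = partial i (\<lambda>y. transition c d y $ k) x"

definition smooth_vector_field :: "('m, 'n::finite) chart set \<Rightarrow> ('m, 'n) vec_field \<Rightarrow> bool" where
  "smooth_vector_field A X \<longleftrightarrow>
     (\<forall>c\<in>A. \<forall>k. smooth_on (chart_image c) (\<lambda>x. X c x $ k)) \<and>
     (\<forall>c\<in>A. \<forall>d\<in>A. \<forall>x\<in>overlap c d. \<forall>k.
        X d (transition c d x) $ k = (\<Sum>i\<in>UNIV. jacobian c d x k i * X c x $ i))"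

text \<open>The components of a one-form are kept in the same type as those of a vector field, but
  transform covariantly.\<close>

definition covector_field :: "('m, 'n::finite) chart set \<Rightarrow> ('m, 'n) vec_field \<Rightarrow> bool" where
  "covector_field A f \<longleftrightarrow>
     (\<forall>c\<in>A. \<forall>d\<in>A. \<forall>x\<in>overlap c d. \<forall>i.
        f c x $ i = (\<Sum>k\<in>UNIV. jacobian c d x k i * f d (transition c d x) $ k))"

definition pseudo_riemannian_metric ::
    "('m, 'n::finite) chart set \<Rightarrow> ('m, 'n) metric_field \<Rightarrow> bool" where
  "pseudo_riemannian_metric A g \<longleftrightarrow>
     (\<forall>c\<in>A. \<forall>i j. smooth_on (chart_image c) (\<lambda>x. g c x $ i $ j)) \<and>
     (\<forall>c\<in>A. \<forall>x\<in>chart_image c. transpose (g c x) = g c x \<and> invertible (g c x)) \<and>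
     (\<forall>c\<in>A. \<forall>d\<in>A. \<forall>x\<in>overlap c d. \<forall>i j.
        g c x $ i $ j =
          (\<Sum>k\<in>UNIV. \<Sum>l\<in>UNIV.
             jacobian c d x k i * jacobian c d x l j * g d (transition c d x) $ k $ l))"

text \<open>Since \<open>K\<close> vanishes nowhere, the smoothness of \<open>\<phi>\<close> and \<open>f\<close> is automatic and not required.\<close>

definition pure_radiation_parallel_rays ::
    "('m, 'n::finite) chart set \<Rightarrow> ('m, 'n) metric_field \<Rightarrow> ('m, 'n) vec_field \<Rightarrow> bool" where
  "pure_radiation_parallel_rays A g K \<longleftrightarrow>
     pseudo_riemannian_metric A g \<and> smooth_vector_field A K \<and>
     (\<forall>c\<in>A. \<forall>x\<in>chart_image c.
        K c x \<noteq> 0 \<and> (\<Sum>a\<in>UNIV. lower (g c) x (K c x) a * K c x $ a) = 0) \<and>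
     (\<exists>\<phi>::'m \<Rightarrow> real. \<forall>c\<in>A. \<forall>x\<in>chart_image c. \<forall>a b.
        ricci (g c) x a b =
          \<phi> (chart_inv c x) * lower (g c) x (K c x) a * lower (g c) x (K c x) b) \<and>
     (\<exists>f. covector_field A f \<and>
        (\<forall>c\<in>A. \<forall>x\<in>chart_image c. \<forall>a b.
           cov_vec (g c) (K c) x a b = f c x $ a * K c x $ b))"

definition conformal ::
    "'m topology \<Rightarrow> ('m, 'n::finite) chart set \<Rightarrow> ('m, 'n) metric_field \<Rightarrow> ('m, 'n) metric_field \<Rightarrow> bool"
where
  "conformal M A g h \<longleftrightarrow>
     (\<forall>p\<in>topspace M. \<exists>V u. openin M V \<and> p \<in> V \<and> smooth_function_on A V u \<and>
        (\<forall>c\<in>A. \<forall>x\<in>snd c ` (fst c \<inter> V). \<forall>i j.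
           h c x $ i $ j = exp (2 * u (chart_inv c x)) * g c x $ i $ j))"

end

theory Submission
  imports Defs
begin

text \<open>
  Write \<open>h\<close> for the pure radiation metric, \<open>g = e\<^bsup>2v\<^esup> h\<close> for the given one, and \<open>v\<^sub>a = \<nabla>\<^sub>a v\<close>; a prime marks
  the tensors of \<open>h\<close>, whose metric also raises the indices. In terms of \<open>\<Upsilon>\<close> with \<open>h = e\<^bsup>2\<Upsilon>\<^esup> g\<close> one
  has \<open>v = - \<Upsilon>\<close>. Under the rescaling the curvature tensors change by the laws

    \<^item> \<open>C\<^sub>a\<^sub>b\<^sub>c\<^sub>d = e\<^bsup>2v\<^esup> C'\<^sub>a\<^sub>b\<^sub>c\<^sub>d\<close> (\<open>weyl_conf\<close>),
    \<^item> \<open>A\<^sub>a\<^sub>b\<^sub>c = A'\<^sub>a\<^sub>b\<^sub>c + C'\<^sub>c\<^sub>b\<^sub>a\<^sub>d v\<^sup>d\<close> (\<open>cotton_conf\<close>),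
    \<^item> \<open>B\<^sub>a\<^sub>b = e\<^bsup>-2v\<^esup> (B'\<^sub>a\<^sub>b + (n - 4) (v\<^sup>c (A'\<^sub>a\<^sub>c\<^sub>b + A'\<^sub>b\<^sub>c\<^sub>a) + C'\<^sub>a\<^sub>c\<^sub>b\<^sub>d v\<^sup>c v\<^sup>d))\<close> (\<open>bach_conf\<close>).

  Since \<open>v\<^sub>a = - \<Upsilon>\<^sub>a\<close>, the two combinations in the theorem are \<open>A'\<^sub>a\<^sub>b\<^sub>c\<close> and, up to the factor \<open>e\<^bsup>-2v\<^esup>\<close>,
  \<open>B'\<^sub>a\<^sub>b + (n - 4) v\<^sup>c (A'\<^sub>a\<^sub>c\<^sub>b + A'\<^sub>b\<^sub>c\<^sub>a)\<close>. So it remains to see that \<open>C'\<^sub>a\<^sub>b\<^sub>c\<^sub>d K\<^sup>c X\<^sup>d\<close>, \<open>A'\<^sub>a\<^sub>b\<^sub>c X\<^sup>a\<close>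
  and \<open>B'\<^sub>a\<^sub>b X\<^sup>a\<close> vanish for the pure radiation metric itself whenever \<open>X\<close> is orthogonal to \<open>K\<close>.

  For that metric the scalar curvature is zero, so \<open>P'\<^sub>a\<^sub>b = \<psi> K\<^sub>a K\<^sub>b\<close>. Commuting two derivatives of the
  recurrent field \<open>K\<close> gives \<open>R'\<^sub>a\<^sub>b\<^sub>c\<^sub>d K\<^sup>d = F\<^sub>a\<^sub>b K\<^sub>c\<close>, which together with the form of \<open>P'\<close> yields the
  claim on \<open>C'\<close> (\<open>weyl_K\<close>). Recurrence also makes \<open>\<nabla>\<^sub>b P'\<^sub>c\<^sub>a\<close> a multiple of \<open>K\<^sub>c K\<^sub>a\<close>, so \<open>A'\<^sub>a\<^sub>b\<^sub>c\<close> carries a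
  factor \<open>K\<^sub>a\<close> (\<open>cotton_K\<close>). A further derivative keeps that factor, and the other term
  \<open>\<psi> K\<^sup>d K\<^sup>c C'\<^sub>d\<^sub>a\<^sub>c\<^sub>b\<close> of \<open>B'\<^sub>a\<^sub>b\<close> is covered by the claim on \<open>C'\<close> (\<open>bach_orthogonal\<close>).

  The law for the Bach tensor is where the second Bianchi identity enters: its contractions say that
  the Cotton tensor is trace-free and that the divergence of the Weyl tensor is \<open>n - 3\<close> times the
  Cotton tensor. All of this is local. The function \<open>\<Upsilon>\<close> exists globally because at each point
  the two metrics determine its value.
\<close>

section \<open>Closure properties of smooth functions\<close>

lemma Ck_on_SucD: "open S \<Longrightarrow> Ck_on (Suc k) S f \<Longrightarrow> Ck_on k S f"
proof (induction k arbitrary: f)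
  case 0
  then show ?case
    by (auto intro!: differentiable_imp_continuous_on simp: differentiable_on_def differentiable_at_withinI)
qed simp

lemma Ck_on_cong:
  assumes "open S" "\<And>y. y \<in> S \<Longrightarrow> f y = g y"
  shows "Ck_on k S f \<longleftrightarrow> Ck_on k S g"
  using assms(2)
proof (induction k arbitrary: f g)
  case 0
  then show ?case by (simp cong: continuous_on_cong)
next
  case (Suc k)
  have "f differentiable (at x) \<longleftrightarrow> g differentiable (at x)" if "x \<in> S" for x
    unfolding differentiable_def
    using has_derivative_transform_within_open[of f _ x UNIV S g]
      has_derivative_transform_within_open[of g _ x UNIV S f] that Suc.prems assms(1) by metis
  moreover have "Ck_on k S (partial i f) \<longleftrightarrow> Ck_on k S (partial i g)" for i
    by (rule Suc.IH) (rule partial_cong_open[OF assms(1) _ Suc.prems])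
  ultimately show ?case by simp
qed

lemma Ck_on_locally:
  assumes "\<And>x. x \<in> S \<Longrightarrow> \<exists>U. open U \<and> x \<in> U \<and> Ck_on k U f"
  shows "Ck_on k S f"
  using assms
proof (induction k arbitrary: f)
  case 0
  then show ?case
    by (metis Ck_on.simps(1) continuous_at_imp_continuous_on continuous_on_eq_continuous_at)
next
  case (Suc k)
  have "Ck_on k S (partial i f)" for i
    by (rule Suc.IH) (use Suc.prems in fastforce)
  with Suc.prems show ?case by fastforce
qed

lemma Ck_on_add:
  "open S \<Longrightarrow> Ck_on k S f \<Longrightarrow> Ck_on k S g \<Longrightarrow> Ck_on k S (\<lambda>y. f y + g y)"
proof (induction k arbitrary: f g)
  case (Suc k)
  have "Ck_on k S (\<lambda>y. partial i f y + partial i g y)" for i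
    using Suc by simp
  then have "Ck_on k S (partial i (\<lambda>y. f y + g y))" for i
    by (rule Ck_on_cong[THEN iffD1, OF Suc.prems(1), rotated]) (use Suc.prems in \<open>simp add: partial_add\<close>)
  with Suc.prems show ?case by simp
qed (simp add: continuous_on_add)

lemma Ck_on_mult:
  "open S \<Longrightarrow> Ck_on k S f \<Longrightarrow> Ck_on k S g \<Longrightarrow> Ck_on k S (\<lambda>y. f y * g y)"
proof (induction k arbitrary: f g)
  case (Suc k)
  note f = Ck_on_SucD[OF Suc.prems(1,2)] and g = Ck_on_SucD[OF Suc.prems(1,3)]
  have "Ck_on k S (\<lambda>y. partial i f y * g y + f y * partial i g y)" for i
    using Suc.IH[OF Suc.prems(1) _ g] Suc.IH[OF Suc.prems(1) f] Suc.prems by (simp add: Ck_on_add)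
  then have "Ck_on k S (partial i (\<lambda>y. f y * g y))" for i
    by (rule Ck_on_cong[THEN iffD1, OF Suc.prems(1), rotated]) (use Suc.prems in \<open>simp add: partial_mult\<close>)
  with Suc.prems show ?case by simp
qed (simp add: continuous_on_mult)

lemma Ck_on_const: "Ck_on k S (\<lambda>_. r)"
proof (induction k arbitrary: r)
  case (Suc k)
  have "partial i (\<lambda>_. r) = (\<lambda>_. 0)" for i :: 'a by auto
  with Suc show ?case by simp
qed simp

lemma Ck_on_sum:
  "open S \<Longrightarrow> (\<And>e. e \<in> I \<Longrightarrow> Ck_on k S (f e)) \<Longrightarrow> Ck_on k S (\<lambda>y. \<Sum>e\<in>I. f e y)"
  by (induction I rule: infinite_finite_induct) (auto intro: Ck_on_add Ck_on_const)

lemma smooth_on_const [simp]: "smooth_on S (\<lambda>_. r)"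
  by (simp add: smooth_on_def Ck_on_const)

lemma smooth_on_add: "open S \<Longrightarrow> smooth_on S f \<Longrightarrow> smooth_on S g \<Longrightarrow> smooth_on S (\<lambda>y. f y + g y)"
  by (simp add: smooth_on_def Ck_on_add)

lemma smooth_on_mult: "open S \<Longrightarrow> smooth_on S f \<Longrightarrow> smooth_on S g \<Longrightarrow> smooth_on S (\<lambda>y. f y * g y)"
  by (simp add: smooth_on_def Ck_on_mult)

lemma smooth_on_minus: "open S \<Longrightarrow> smooth_on S f \<Longrightarrow> smooth_on S (\<lambda>y. - f y)"
  using smooth_on_mult[of S "\<lambda>_. -1" f] by simp

lemma smooth_on_diff: "open S \<Longrightarrow> smooth_on S f \<Longrightarrow> smooth_on S g \<Longrightarrow> smooth_on S (\<lambda>y. f y - g y)"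
  using smooth_on_add[of S f "\<lambda>y. - g y"] smooth_on_minus[of S g] by simp

lemma smooth_on_divide_const: "open S \<Longrightarrow> smooth_on S f \<Longrightarrow> smooth_on S (\<lambda>y. f y / r)"
  using smooth_on_mult[of S f "\<lambda>_. inverse r"] by (simp add: divide_inverse)

lemma smooth_on_sum:
  "open S \<Longrightarrow> (\<And>e. e \<in> I \<Longrightarrow> smooth_on S (f e)) \<Longrightarrow> smooth_on S (\<lambda>y. \<Sum>e\<in>I. f e y)"
  by (simp add: smooth_on_def Ck_on_sum)

lemma smooth_on_cong:
  "open S \<Longrightarrow> (\<And>y. y \<in> S \<Longrightarrow> f y = g y) \<Longrightarrow> smooth_on S f \<longleftrightarrow> smooth_on S g"
  using Ck_on_cong[of S f g] by (simp add: smooth_on_def)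

lemma smooth_on_locally:
  assumes "\<And>x. x \<in> S \<Longrightarrow> \<exists>U. open U \<and> x \<in> U \<and> smooth_on U f"
  shows "smooth_on S f"
  using assms Ck_on_locally[of S _ f] unfolding smooth_on_def by metis


lemma partial_diff:
  assumes "f differentiable (at x)" "g differentiable (at x)"
  shows "partial i (\<lambda>y. f y - g y) x = partial i f x - partial i g x"
  using has_derivative_diff[OF assms[unfolded frechet_derivative_works]]
  by (subst partial_eqI) (auto simp: partial_def)

lemma partial_minus:
  assumes "f differentiable (at x)"
  shows "partial i (\<lambda>y. - f y) x = - partial i f x"
  using has_derivative_minus[OF assms[unfolded frechet_derivative_works]]
  by (subst partial_eqI) (auto simp: partial_def)

lemma partial_divide_const:
  assumes "f differentiable (at x)"
  shows "partial i (\<lambda>y. f y / r) x = partial i f x / r"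
  using partial_mult[OF assms, of "\<lambda>_. inverse r"] by (simp add: divide_inverse)

lemma partial_exp:
  assumes "f differentiable (at x)"
  shows "partial i (\<lambda>y. exp (f y)) x = exp (f x) * partial i f x"
  using partial_eqI[OF has_derivative_exp[OF assms[unfolded frechet_derivative_works]]]
  by (simp add: partial_def)

section \<open>Curvature of a metric in a coordinate domain\<close>

definition cov1 ::
    "'n::finite metric_comps \<Rightarrow> (real^'n \<Rightarrow> 'n \<Rightarrow> real) \<Rightarrow> real^'n \<Rightarrow> 'n \<Rightarrow> 'n \<Rightarrow> real" where
  "cov1 G T x a b = partial a (\<lambda>y. T y b) x - (\<Sum>e\<in>UNIV. christoffel G x e a b * T x e)"

definition cov4 ::
    "'n::finite metric_comps \<Rightarrow> (real^'n \<Rightarrow> 'n \<Rightarrow> 'n \<Rightarrow> 'n \<Rightarrow> 'n \<Rightarrow> real) \<Rightarrow> real^'n \<Rightarrow> 'n \<Rightarrow> 'n \<Rightarrow> 'n \<Rightarrow> 'n \<Rightarrow> 'n \<Rightarrow> real" where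
  "cov4 G T x a b c d f =
     partial a (\<lambda>y. T y b c d f) x
     - (\<Sum>e\<in>UNIV. christoffel G x e a b * T x e c d f)
     - (\<Sum>e\<in>UNIV. christoffel G x e a c * T x b e d f)
     - (\<Sum>e\<in>UNIV. christoffel G x e a d * T x b c e f)
     - (\<Sum>e\<in>UNIV. christoffel G x e a f * T x b c d e)"

text \<open>Traces and divergences are written with this contraction below, so that its linearity
  and the rules \<open>contract_G\<close> and \<open>contract_product\<close> replace the handling of double sums.\<close>

definition contract :: "'n::finite metric_comps \<Rightarrow> real^'n \<Rightarrow> ('n \<Rightarrow> 'n \<Rightarrow> real) \<Rightarrow> real" where
  "contract G x T = (\<Sum>a\<in>UNIV. \<Sum>b\<in>UNIV. ginv G x a b * T a b)"

definition raise :: "'n::finite metric_comps \<Rightarrow> real^'n \<Rightarrow> ('n \<Rightarrow> real) \<Rightarrow> 'n \<Rightarrow> real" where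
  "raise G x w a = (\<Sum>b\<in>UNIV. ginv G x a b * w b)"

text \<open>For a fixed direction \<open>a\<close> the symbols \<open>\<Gamma>\<^sup>c\<^sub>a\<^sub>d\<close> form a matrix in \<open>c\<close> and \<open>d\<close>. With products of such
  matrices as atoms, the second Bianchi identity becomes a computation in an associative
  algebra.\<close>

definition matprod :: "('n::finite \<Rightarrow> 'n \<Rightarrow> real) \<Rightarrow> ('n \<Rightarrow> 'n \<Rightarrow> real) \<Rightarrow> 'n \<Rightarrow> 'n \<Rightarrow> real" where
  "matprod P Q c d = (\<Sum>f\<in>UNIV. P c f * Q f d)"

lemma matprod_assoc: "matprod (matprod P Q) T c d = matprod P (matprod Q T) c d"
  unfolding matprod_def sum_distrib_left sum_distrib_right mult.assoc by (rule sum.swap)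

lemma matprod_add_left: "matprod (\<lambda>i j. P i j + P' i j) Q c d = matprod P Q c d + matprod P' Q c d"
  and matprod_add_right: "matprod Q (\<lambda>i j. P i j + P' i j) c d = matprod Q P c d + matprod Q P' c d"
  and matprod_diff_left: "matprod (\<lambda>i j. P i j - P' i j) Q c d = matprod P Q c d - matprod P' Q c d"
  and matprod_diff_right: "matprod Q (\<lambda>i j. P i j - P' i j) c d = matprod Q P c d - matprod Q P' c d"
  by (simp_all add: matprod_def algebra_simps sum.distrib sum_subtractf)

lemma sum_delta_mult [simp]:
  fixes f :: "'n::finite \<Rightarrow> real"
  shows "(\<Sum>e\<in>UNIV. (if e = a then 1 else 0) * f e) = f a"
    and "(\<Sum>e\<in>UNIV. (if a = e then 1 else 0) * f e) = f a"
    and "(\<Sum>e\<in>UNIV. f e * (if e = a then 1 else 0)) = f a"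
    and "(\<Sum>e\<in>UNIV. f e * (if a = e then 1 else 0)) = f a"
  by (simp_all add: if_distrib if_distribR sum.delta sum.delta' cong: if_cong)

lemma contract_add: "contract G x (\<lambda>a b. T a b + U a b) = contract G x T + contract G x U"
  and contract_diff: "contract G x (\<lambda>a b. T a b - U a b) = contract G x T - contract G x U"
  and contract_uminus: "contract G x (\<lambda>a b. - T a b) = - contract G x T"
  and contract_mult: "contract G x (\<lambda>a b. r * T a b) = r * contract G x T"
  and contract_mult_right: "contract G x (\<lambda>a b. T a b * r) = contract G x T * r"
  by (simp_all add: contract_def algebra_simps sum.distrib sum_subtractf sum_distrib_left sum_negf)

lemma contract_sum: "contract G x (\<lambda>a b. \<Sum>e\<in>I. T e a b) = (\<Sum>e\<in>I. contract G x (T e))"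
proof -
  have "contract G x (\<lambda>a b. \<Sum>e\<in>I. T e a b) = (\<Sum>a\<in>UNIV. \<Sum>e\<in>I. \<Sum>b\<in>UNIV. ginv G x a b * T e a b)"
    unfolding contract_def sum_distrib_left by (intro sum.cong refl sum.swap)
  then show ?thesis
    unfolding contract_def by (simp add: sum.swap[of _ I])
qed

lemma contract_contract:
  "contract G x (\<lambda>a b. contract G x (\<lambda>c d. T a b c d)) = contract G x (\<lambda>c d. contract G x (\<lambda>a b. T a b c d))"
proof -
  have "contract G x (\<lambda>a b. contract G x (\<lambda>c d. T a b c d))
      = contract G x (\<lambda>a b. \<Sum>c\<in>UNIV. \<Sum>d\<in>UNIV. ginv G x c d * T a b c d)"
    unfolding contract_def[of G x "\<lambda>c d. T _ _ c d"] ..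
  also have "\<dots> = (\<Sum>c\<in>UNIV. \<Sum>d\<in>UNIV. ginv G x c d * contract G x (\<lambda>a b. T a b c d))"
    by (simp only: contract_sum contract_mult)
  finally show ?thesis
    by (simp only: contract_def[of G x "\<lambda>c d. contract G x (\<lambda>a b. T a b c d)"])
qed

lemma contract_product: "contract G x (\<lambda>a b. w a * z b) = (\<Sum>b\<in>UNIV. w b * raise G x z b)"
  by (simp add: contract_def raise_def sum_distrib_left mult_ac)

locale metric_chart =
  fixes S :: "(real^'n::finite) set" and G :: "'n metric_comps"
  assumes open_S: "open S"
    and smooth_G: "\<And>i j. smooth_on S (\<lambda>y. G y $ i $ j)"
    and transpose_G: "\<And>y. y \<in> S \<Longrightarrow> transpose (G y) = G y"
    and invertible_G: "\<And>y. y \<in> S \<Longrightarrow> invertible (G y)"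
begin

abbreviation \<Gamma> :: "real^'n \<Rightarrow> 'n \<Rightarrow> 'n \<Rightarrow> 'n \<Rightarrow> real" where "\<Gamma> \<equiv> christoffel G"

lemmas smooth_rules = smooth_on_const smooth_on_partial smooth_on_add[OF open_S] smooth_on_mult[OF open_S]
  smooth_on_minus[OF open_S] smooth_on_diff[OF open_S] smooth_on_divide_const[OF open_S] smooth_on_sum[OF open_S]

lemma G_commute: "x \<in> S \<Longrightarrow> G x $ a $ b = G x $ b $ a"
  using transpose_G[of x] by (metis transpose_def vec_lambda_beta)

lemma differentiable_G: "x \<in> S \<Longrightarrow> (\<lambda>y. G y $ a $ b) differentiable (at x)"
  by (rule smooth_on_differentiable[OF smooth_G])

lemma matrix_inv_G: "x \<in> S \<Longrightarrow> G x ** matrix_inv (G x) = mat 1 \<and> matrix_inv (G x) ** G x = mat 1"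
  using someI_ex[OF invertible_G[unfolded invertible_def]] by (simp add: matrix_inv_def)

lemma ginv_G: "x \<in> S \<Longrightarrow> (\<Sum>b\<in>UNIV. ginv G x a b * G x $ b $ c) = (if a = c then 1 else 0)"
  using arg_cong[OF matrix_inv_G[THEN conjunct2], of x "\<lambda>A. A $ a $ c"]
  by (simp add: matrix_matrix_mult_def ginv_def mat_def)

lemma G_ginv: "x \<in> S \<Longrightarrow> (\<Sum>b\<in>UNIV. G x $ a $ b * ginv G x b c) = (if a = c then 1 else 0)"
  using arg_cong[OF matrix_inv_G[THEN conjunct1], of x "\<lambda>A. A $ a $ c"]
  by (simp add: matrix_matrix_mult_def ginv_def mat_def)

lemma ginv_unique:
  assumes "x \<in> S" "\<And>b. (\<Sum>c\<in>UNIV. G x $ b $ c * w c) = z b"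
  shows "w a = (\<Sum>b\<in>UNIV. ginv G x a b * z b)"
proof -
  have "(\<Sum>b\<in>UNIV. ginv G x a b * z b) = (\<Sum>c\<in>UNIV. (\<Sum>b\<in>UNIV. ginv G x a b * G x $ b $ c) * w c)"
    unfolding assms(2)[symmetric] sum_distrib_left sum_distrib_right mult.assoc by (rule sum.swap)
  then show ?thesis by (simp add: ginv_G assms(1))
qed

lemma G_raise: "x \<in> S \<Longrightarrow> (\<Sum>b\<in>UNIV. G x $ a $ b * raise G x w b) = w a"
proof -
  assume x: "x \<in> S"
  have "(\<Sum>b\<in>UNIV. G x $ a $ b * raise G x w b) = (\<Sum>c\<in>UNIV. (\<Sum>b\<in>UNIV. G x $ a $ b * ginv G x b c) * w c)"
    unfolding raise_def sum_distrib_left sum_distrib_right mult.assoc by (rule sum.swap)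
  then show ?thesis by (simp add: G_ginv x)
qed

lemma ginv_commute:
  assumes x: "x \<in> S"
  shows "ginv G x a b = ginv G x b a"
proof -
  have "ginv G x b a = (\<Sum>c\<in>UNIV. ginv G x a c * (if c = b then 1 else 0))"
  proof (rule ginv_unique[OF x, where w = "\<lambda>c. ginv G x b c"])
    show "(\<Sum>c\<in>UNIV. G x $ d $ c * ginv G x b c) = (if d = b then 1 else 0)" for d
      using ginv_G[OF x, of b d] G_commute[OF x, of d] by (simp add: mult.commute eq_commute)
  qed
  then show ?thesis by simp
qed

lemma contract_transpose: "x \<in> S \<Longrightarrow> contract G x (\<lambda>a b. T b a) = contract G x T"
  unfolding contract_def by (subst sum.swap) (simp add: ginv_commute)

lemma contract_product_left: "x \<in> S \<Longrightarrow> contract G x (\<lambda>a b. w a * z b) = (\<Sum>b\<in>UNIV. raise G x w b * z b)"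
  using contract_transpose[of x "\<lambda>a b. z a * w b"] contract_product[of G x z w] by (simp add: mult.commute)

lemma contract_G:
  assumes x: "x \<in> S"
  shows "contract G x (\<lambda>a b. G x $ c $ a * T b) = T c"
    and "contract G x (\<lambda>a b. G x $ c $ b * T a) = T c"
    and "contract G x (\<lambda>a b. G x $ a $ c * T b) = T c"
    and "contract G x (\<lambda>a b. G x $ b $ c * T a) = T c"
proof -
  show 1: "contract G x (\<lambda>a b. G x $ c $ a * T b) = T c"
    by (simp add: contract_product G_raise x)
  then show 2: "contract G x (\<lambda>a b. G x $ c $ b * T a) = T c"
    using contract_transpose[OF x, of "\<lambda>a b. G x $ c $ a * T b"] by simp
  show "contract G x (\<lambda>a b. G x $ a $ c * T b) = T c" "contract G x (\<lambda>a b. G x $ b $ c * T a) = T c"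
    using 1 2 by (simp_all add: G_commute[OF x, of _ c])
qed

lemma contract_G_G: "x \<in> S \<Longrightarrow> contract G x (\<lambda>a b. G x $ a $ b) = real CARD('n)"
  "x \<in> S \<Longrightarrow> contract G x (\<lambda>a b. G x $ b $ a) = real CARD('n)"
proof -
  assume x: "x \<in> S"
  show "contract G x (\<lambda>a b. G x $ a $ b) = real CARD('n)"
    using ginv_G[OF x] unfolding contract_def by (subst G_commute[OF x]) simp
  then show "contract G x (\<lambda>a b. G x $ b $ a) = real CARD('n)"
    by (simp add: G_commute[OF x])
qed

text \<open>Differentiating \<open>G\<close> times its inverse expresses the derivatives of the inverse through the inverse itself.
  This raises the order of differentiability of the inverse by one at a time.\<close>

lemma partial_ginv:
  assumes x: "x \<in> S"
  shows "partial i (\<lambda>y. ginv G y a b) x =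
    - (\<Sum>c\<in>UNIV. ginv G x a c * (\<Sum>d\<in>UNIV. partial i (\<lambda>y. G y $ c $ d) x * ginv G x d b))"
proof -
  note d = ginv_differentiable[OF open_S x invertible_G smooth_G]
  have "(\<Sum>d\<in>UNIV. partial i (\<lambda>y. G y $ c $ d) x * ginv G x d b)
     + (\<Sum>d\<in>UNIV. G x $ c $ d * partial i (\<lambda>y. ginv G y d b) x) = 0" for c
  proof -
    have "partial i (\<lambda>y. \<Sum>d\<in>UNIV. G y $ c $ d * ginv G y d b) x = partial i (\<lambda>y. if c = b then 1 else 0) x"
      by (rule partial_cong_open[OF open_S x G_ginv])
    then show ?thesis
      by (simp add: partial_sum partial_mult d differentiable_G x sum.distrib differentiable_mult)
  qed
  then have "(\<Sum>d\<in>UNIV. G x $ c $ d * partial i (\<lambda>y. ginv G y d b) x)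
      = - (\<Sum>d\<in>UNIV. partial i (\<lambda>y. G y $ c $ d) x * ginv G x d b)" for c
    by (simp add: eq_neg_iff_add_eq_0 add.commute)
  from ginv_unique[OF x this] show ?thesis
    by (simp add: sum_negf)
qed

lemma smooth_ginv: "smooth_on S (\<lambda>y. ginv G y a b)"
proof -
  have "Ck_on k S (\<lambda>y. ginv G y a b)" for k a b
  proof (induction k arbitrary: a b)
    case 0
    have "\<forall>x\<in>S. isCont (\<lambda>y. ginv G y a b) x"
      using ginv_differentiable[OF open_S _ invertible_G smooth_G] differentiable_imp_continuous_within by blast
    then show ?case by (simp add: continuous_at_imp_continuous_on)
  next
    case (Suc k)
    have G: "Ck_on k S (partial i (\<lambda>y. G y $ c $ d))" for i c d
      using smooth_on_partial[OF smooth_G] unfolding smooth_on_def by blast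
    have "Ck_on k S (\<lambda>x. (-1) * (\<Sum>c\<in>UNIV. ginv G x a c * (\<Sum>d\<in>UNIV. partial i (\<lambda>y. G y $ c $ d) x * ginv G x d b)))" for i
      by (intro Ck_on_sum Ck_on_mult Ck_on_const Suc G open_S)
    then have "Ck_on k S (partial i (\<lambda>y. ginv G y a b))" for i
      by (rule Ck_on_cong[THEN iffD1, OF open_S, rotated]) (simp add: partial_ginv)
    then show ?case
      using ginv_differentiable[OF open_S _ invertible_G smooth_G] by simp
  qed
  then show ?thesis by (simp add: smooth_on_def)
qed

lemma smooth_christoffel: "smooth_on S (\<lambda>y. \<Gamma> y c a b)"
  unfolding christoffel_def by (intro smooth_rules smooth_ginv smooth_G)

lemma differentiable_ginv: "x \<in> S \<Longrightarrow> (\<lambda>y. ginv G y a b) differentiable (at x)"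
  and differentiable_christoffel: "x \<in> S \<Longrightarrow> (\<lambda>y. \<Gamma> y c a b) differentiable (at x)"
  using smooth_on_differentiable smooth_ginv smooth_christoffel by blast+

lemma christoffel_commute: "x \<in> S \<Longrightarrow> \<Gamma> x c a b = \<Gamma> x c b a"
  by (rule christoffel_sym[OF open_S _ transpose_G])

text \<open>Lowering the upper index of the Christoffel symbol undoes the inverse metric in its
  definition; adding two of the results leaves a single derivative of the metric. This is
  the metric compatibility of the connection.\<close>

lemma christoffel_low:
  assumes x: "x \<in> S"
  shows "(\<Sum>e\<in>UNIV. G x $ c $ e * \<Gamma> x e a b) =
     (partial a (\<lambda>y. G y $ b $ c) x + partial b (\<lambda>y. G y $ a $ c) x - partial c (\<lambda>y. G y $ a $ b) x) / 2"
  using G_raise[OF x, of c "\<lambda>d. partial a (\<lambda>y. G y $ b $ d) x + partial b (\<lambda>y. G y $ a $ d) x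
          - partial d (\<lambda>y. G y $ a $ b) x"]
  by (simp add: christoffel_def raise_def sum_divide_distrib[symmetric])

lemma partial_G:
  assumes x: "x \<in> S"
  shows "partial a (\<lambda>y. G y $ b $ c) x =
    (\<Sum>e\<in>UNIV. G x $ c $ e * \<Gamma> x e a b) + (\<Sum>e\<in>UNIV. G x $ b $ e * \<Gamma> x e a c)"
proof -
  have "partial i (\<lambda>y. G y $ j $ k) x = partial i (\<lambda>y. G y $ k $ j) x" for i j k
    by (rule partial_cong_open[OF open_S x G_commute])
  from this[of b c a] this[of a b c] show ?thesis by (simp add: christoffel_low x) argo
qed

lemma riemann_eq:
  assumes x: "x \<in> S"
  shows "riemann G x a b c d =
      partial a (\<lambda>y. \<Gamma> y c b d) x - partial b (\<lambda>y. \<Gamma> y c a d) x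
      + (\<Sum>e\<in>UNIV. \<Gamma> x c a e * \<Gamma> x e b d) - (\<Sum>e\<in>UNIV. \<Gamma> x c b e * \<Gamma> x e a d)"
proof -
  have z: "partial b (\<lambda>y. k) = (\<lambda>_. 0)" for b :: 'n and k
    by auto
  show ?thesis
    unfolding riemann_def
    by (subst (1 2) cov_cov_vec_expand)
       (simp_all add: differentiable_christoffel x z christoffel_commute[OF x, of _ b a] axis_def if_distrib sum.delta cong: if_cong)
qed

lemma smooth_riemann: "smooth_on S (\<lambda>y. riemann G y a b c d)"
proof -
  have "smooth_on S (\<lambda>x. partial a (\<lambda>y. \<Gamma> y c b d) x - partial b (\<lambda>y. \<Gamma> y c a d) x
      + (\<Sum>e\<in>UNIV. \<Gamma> x c a e * \<Gamma> x e b d) - (\<Sum>e\<in>UNIV. \<Gamma> x c b e * \<Gamma> x e a d))"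
    by (intro smooth_rules smooth_christoffel)
  then show ?thesis
    by (rule smooth_on_cong[THEN iffD1, OF open_S, rotated]) (simp add: riemann_eq)
qed

lemma smooth_curvature:
  "smooth_on S (\<lambda>y. riemann_low G y a b c d)" "smooth_on S (\<lambda>y. ricci G y a b)" "smooth_on S (scal G)"
  "smooth_on S (\<lambda>y. schouten G y a b)" "smooth_on S (\<lambda>y. weyl G y a b c d)" "smooth_on S (\<lambda>y. cotton G y a b c)"
proof -
  show [simp]: "smooth_on S (\<lambda>y. riemann_low G y a b c d)" for a b c d
    unfolding riemann_low_def by (intro smooth_rules smooth_riemann smooth_G)
  show [simp]: "smooth_on S (\<lambda>y. ricci G y a b)" for a b
    unfolding ricci_def by (intro smooth_rules smooth_riemann)
  show [simp]: "smooth_on S (scal G)"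
    unfolding scal_def[abs_def] by (intro smooth_rules smooth_ginv) simp
  show [simp]: "smooth_on S (\<lambda>y. schouten G y a b)" for a b
    unfolding schouten_def by (intro smooth_rules smooth_G) simp_all
  show "smooth_on S (\<lambda>y. weyl G y a b c d)"
    unfolding weyl_def antisym2_def by (intro smooth_rules smooth_G) simp_all
  show "smooth_on S (\<lambda>y. cotton G y a b c)"
    unfolding cotton_def antisym2_def cov2_def
    by (intro smooth_rules smooth_christoffel) simp_all
qed

lemma differentiable_curvature:
  assumes "x \<in> S"
  shows "(\<lambda>y. riemann G y a b c d) differentiable (at x)" "(\<lambda>y. riemann_low G y a b c d) differentiable (at x)"
    "(\<lambda>y. ricci G y a b) differentiable (at x)" "scal G differentiable (at x)"
    "(\<lambda>y. schouten G y a b) differentiable (at x)" "(\<lambda>y. weyl G y a b c d) differentiable (at x)"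
    "(\<lambda>y. cotton G y a b c) differentiable (at x)"
  by (rule smooth_on_differentiable[OF _ assms], rule smooth_curvature smooth_riemann)+

end

context metric_chart begin

section \<open>Symmetries of the curvature and Bianchi identities\<close>

lemma partial_riemann:
  assumes x: "x \<in> S"
  shows "partial e (\<lambda>y. riemann G y a b c d) x =
     partial e (partial a (\<lambda>y. \<Gamma> y c b d)) x - partial e (partial b (\<lambda>y. \<Gamma> y c a d)) x
     + (matprod (\<lambda>i j. partial e (\<lambda>y. \<Gamma> y i a j) x) (\<lambda>i j. \<Gamma> x i b j) c d
        + matprod (\<lambda>i j. \<Gamma> x i a j) (\<lambda>i j. partial e (\<lambda>y. \<Gamma> y i b j) x) c d)
     - (matprod (\<lambda>i j. partial e (\<lambda>y. \<Gamma> y i b j) x) (\<lambda>i j. \<Gamma> x i a j) c d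
        + matprod (\<lambda>i j. \<Gamma> x i b j) (\<lambda>i j. partial e (\<lambda>y. \<Gamma> y i a j) x) c d)"
proof -
  have D: "partial a (\<lambda>y. \<Gamma> y c b d) differentiable (at x)" for a b c d
    using x open_S smooth_christoffel smooth_on_differentiable smooth_on_partial by blast
  have "partial e (\<lambda>y. riemann G y a b c d) x = partial e (\<lambda>y.
      partial a (\<lambda>y. \<Gamma> y c b d) y - partial b (\<lambda>y. \<Gamma> y c a d) y
      + (\<Sum>e\<in>UNIV. \<Gamma> y c a e * \<Gamma> y e b d) - (\<Sum>e\<in>UNIV. \<Gamma> y c b e * \<Gamma> y e a d)) x"
    by (rule partial_cong_open[OF open_S x riemann_eq])
  also have "\<dots> = partial e (partial a (\<lambda>y. \<Gamma> y c b d)) x - partial e (partial b (\<lambda>y. \<Gamma> y c a d)) x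
      + (\<Sum>f\<in>UNIV. partial e (\<lambda>y. \<Gamma> y c a f) x * \<Gamma> x f b d + \<Gamma> x c a f * partial e (\<lambda>y. \<Gamma> y f b d) x)
      - (\<Sum>f\<in>UNIV. partial e (\<lambda>y. \<Gamma> y c b f) x * \<Gamma> x f a d + \<Gamma> x c b f * partial e (\<lambda>y. \<Gamma> y f a d) x)"
    by (simp add: partial_add partial_diff partial_sum partial_mult D differentiable_christoffel x
        differentiable_add differentiable_diff differentiable_sum differentiable_mult)
  finally show ?thesis
    by (simp add: matprod_def sum.distrib)
qed

text \<open>The identity holds for the curvature \<open>dA + A \<and> A\<close> of any matrix-valued one-form \<open>A\<close>: in the cyclic
  sum second partial derivatives of \<open>A\<close> cancel because they commute, the terms with one derivative
  cancel in pairs, and the cubic terms cancel by the Jacobi identity.\<close>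

lemma bianchi2_mixed:
  fixes a b c d e :: 'n
  assumes x: "x \<in> S"
  defines "DR \<equiv> \<lambda>e a b. partial e (\<lambda>y. riemann G y a b c d) x
       + (\<Sum>f\<in>UNIV. \<Gamma> x c e f * riemann G x a b f d) - (\<Sum>f\<in>UNIV. \<Gamma> x f e d * riemann G x a b c f)"
  shows "DR e a b + DR a b e + DR b e a = 0"
proof -
  define A where "A a = (\<lambda>i j. \<Gamma> x i a j)" for a
  define dA where "dA e a = (\<lambda>i j. partial e (\<lambda>y. \<Gamma> y i a j) x)" for e a
  have R: "riemann G x a b c d = dA a b c d - dA b a c d + matprod (A a) (A b) c d - matprod (A b) (A a) c d" for a b c d
    by (simp add: riemann_eq[OF x] dA_def A_def matprod_def)
  have com: "partial e (partial a (\<lambda>y. \<Gamma> y c b d)) x = partial a (partial e (\<lambda>y. \<Gamma> y c b d)) x" for a e b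
    by (rule partial_commute[OF open_S x smooth_christoffel])
  have 1: "(\<Sum>f\<in>UNIV. \<Gamma> x c e f * riemann G x a b f d)
      = matprod (A e) (\<lambda>c d. dA a b c d - dA b a c d + matprod (A a) (A b) c d - matprod (A b) (A a) c d) c d" for e a b
    unfolding R[symmetric] by (simp add: matprod_def A_def)
  have 2: "(\<Sum>f\<in>UNIV. \<Gamma> x f e d * riemann G x a b c f)
      = matprod (\<lambda>c d. dA a b c d - dA b a c d + matprod (A a) (A b) c d - matprod (A b) (A a) c d) (A e) c d" for e a b
    unfolding R[symmetric] by (simp add: matprod_def A_def mult.commute)
  have 3: "DR e a b =
     partial e (partial a (\<lambda>y. \<Gamma> y c b d)) x - partial e (partial b (\<lambda>y. \<Gamma> y c a d)) x
     + (matprod (dA e a) (A b) c d + matprod (A a) (dA e b) c d) - (matprod (dA e b) (A a) c d + matprod (A b) (dA e a) c d)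
     + (matprod (A e) (dA a b) c d - matprod (A e) (dA b a) c d
        + matprod (A e) (matprod (A a) (A b)) c d - matprod (A e) (matprod (A b) (A a)) c d)
     - (matprod (dA a b) (A e) c d - matprod (dA b a) (A e) c d
        + matprod (A a) (matprod (A b) (A e)) c d - matprod (A b) (matprod (A a) (A e)) c d)" for e a b
    unfolding DR_def 1 2 partial_riemann[OF x] A_def[symmetric] dA_def[symmetric]
    by (simp add: matprod_add_left matprod_add_right matprod_diff_left matprod_diff_right matprod_assoc)
  show ?thesis
    unfolding 3 com[of a e] com[of b e] com[of b a] by simp
qed

lemma riemann_skew: "riemann G x a b c d = - riemann G x b a c d"
  by (simp add: riemann_def)

lemma bianchi1: "x \<in> S \<Longrightarrow> riemann G x a b c d + riemann G x b d c a + riemann G x d a c b = 0"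
proof -
  assume x: "x \<in> S"
  have "partial e (\<lambda>y. \<Gamma> y c i j) x = partial e (\<lambda>y. \<Gamma> y c j i) x" for e i j
    by (rule partial_cong_open[OF open_S x christoffel_commute])
  from this[of _ a b] this[of _ a d] this[of _ b d] show ?thesis
    by (simp add: riemann_eq[OF x] christoffel_commute[OF x, of _ b a] christoffel_commute[OF x, of _ d a] christoffel_commute[OF x, of _ d b])
qed

lemma riemann_low_skew12: "riemann_low G x a b c d = - riemann_low G x b a c d"
  unfolding riemann_low_def by (subst riemann_skew) (simp add: sum_negf)

lemma riemann_low_bianchi1:
  "x \<in> S \<Longrightarrow> riemann_low G x a b c d + riemann_low G x b d c a + riemann_low G x d a c b = 0"
  unfolding riemann_low_def
  by (simp add: sum.distrib[symmetric] distrib_left[symmetric] bianchi1)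

text \<open>The symmetrization in the last two indices is the commutator of two partial derivatives of
  the metric, once the latter are written with the lowered Christoffel symbols \<open>L\<close>. The
  terms \<open>Q\<close> quadratic in the symbols cancel by their symmetry.\<close>

lemma riemann_low_skew34:
  assumes x: "x \<in> S"
  shows "riemann_low G x a b c d = - riemann_low G x a b d c"
proof -
  define L where "L = (\<lambda>b c d y. \<Sum>e\<in>UNIV. G y $ c $ e * \<Gamma> y e b d)"
  define Q where "Q a c b d = (\<Sum>e\<in>UNIV. \<Sum>f\<in>UNIV. G x $ e $ f * \<Gamma> x f a c * \<Gamma> x e b d)" for a c b d
  have Q: "Q a c b d = Q b d a c" for a b c d
    unfolding Q_def by (subst sum.swap) (simp add: G_commute[OF x] mult_ac)
  have dG: "partial a (\<lambda>y. G y $ c $ d) y = L a c d y + L a d c y" if "y \<in> S" for a c d y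
    using partial_G[OF that, of a c d] by (simp add: L_def add.commute)
  have sL: "smooth_on S (L b c d)" for b c d
    unfolding L_def by (intro smooth_rules smooth_G smooth_christoffel)
  have dL: "partial a (L b c d) x = (\<Sum>e\<in>UNIV. partial a (\<lambda>y. G y $ c $ e) x * \<Gamma> x e b d)
      + (\<Sum>e\<in>UNIV. G x $ c $ e * partial a (\<lambda>y. \<Gamma> y e b d) x)" for a b c d
    unfolding L_def by (simp add: partial_sum partial_mult differentiable_G differentiable_christoffel x
        sum.distrib differentiable_mult)
  have 1: "(\<Sum>e\<in>UNIV. partial a (\<lambda>y. G y $ c $ e) x * \<Gamma> x e b d)
      = (\<Sum>e\<in>UNIV. L a c e x * \<Gamma> x e b d) + Q a c b d" for a b c d
    unfolding dG[OF x] Q_def by (simp add: L_def distrib_right sum.distrib sum_distrib_right)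
  have 2: "(\<Sum>e\<in>UNIV. G x $ c $ e * (\<Sum>f\<in>UNIV. \<Gamma> x e a f * \<Gamma> x f b d)) = (\<Sum>e\<in>UNIV. L a c e x * \<Gamma> x e b d)" for a b c d
    unfolding L_def sum_distrib_left sum_distrib_right mult.assoc by (rule sum.swap)
  have R: "riemann_low G x a b c d = partial a (L b c d) x - partial b (L a c d) x - Q a c b d + Q b c a d" for c d
    unfolding dL 1 riemann_low_def riemann_eq[OF x]
    by (simp add: algebra_simps sum.distrib sum_subtractf 2[unfolded mult.commute[of "G x $ _ $ _"]] 2)
  have dd: "partial a (partial b (\<lambda>y. G y $ c $ d)) x = partial a (L b c d) x + partial a (L b d c) x" for a b
  proof -
    have "partial a (partial b (\<lambda>y. G y $ c $ d)) x = partial a (\<lambda>y. L b c d y + L b d c y) x"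
      by (rule partial_cong_open[OF open_S x dG])
    then show ?thesis
      using smooth_on_differentiable[OF sL x] by (simp add: partial_add)
  qed
  with partial_commute[OF open_S x smooth_G[where i = c and j = d], of a b] show ?thesis
    unfolding R using dd[of a b] dd[of b a] Q[of a c b d] Q[of b c a d] by linarith
qed

text \<open>The usual octahedron argument: four instances of the first Bianchi identity.\<close>

lemma riemann_low_pair:
  assumes x: "x \<in> S"
  shows "riemann_low G x a b c d = riemann_low G x c d a b"
  using riemann_low_bianchi1[OF x, of a b c d] riemann_low_bianchi1[OF x, of a b d c]
    riemann_low_bianchi1[OF x, of c d a b] riemann_low_bianchi1[OF x, of c d b a]
    riemann_low_skew34[OF x] riemann_low_skew12[of x] by smt

lemma contract_riemann_low:
  assumes x: "x \<in> S"
  shows "contract G x (\<lambda>a c. riemann_low G x a b c d) = ricci G x b d"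
proof -
  have "contract G x (\<lambda>a c. riemann_low G x a b c d) = (\<Sum>e\<in>UNIV. contract G x (\<lambda>a c. G x $ c $ e * riemann G x a b e d))"
    by (simp add: riemann_low_def contract_sum)
  then show ?thesis
    by (simp add: contract_G[OF x] ricci_def)
qed

lemma contract_ricci: "contract G x (ricci G x) = scal G x"
  by (simp add: contract_def scal_def)

lemma ricci_commute: "x \<in> S \<Longrightarrow> ricci G x a b = ricci G x b a"
  using contract_riemann_low[of x a b] contract_riemann_low[of x b a]
    contract_transpose[of x "\<lambda>c e. riemann_low G x e a c b"] by (simp add: riemann_low_pair[of x _ a])

text \<open>Lowering an index commutes with the covariant derivative, which reduces the identity to
  \<open>bianchi2_mixed\<close>; the connection terms acting on the three cyclic indices cancel because the
  Christoffel symbols are symmetric.\<close>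

lemma bianchi2:
  fixes a b c d e :: 'n
  assumes x: "x \<in> S"
  shows "cov4 G (riemann_low G) x e a b c d + cov4 G (riemann_low G) x a b e c d + cov4 G (riemann_low G) x b e a c d = 0"
proof -
  define DR where "DR e a b c = partial e (\<lambda>y. riemann G y a b c d) x
       + (\<Sum>f\<in>UNIV. \<Gamma> x c e f * riemann G x a b f d) - (\<Sum>f\<in>UNIV. \<Gamma> x f e d * riemann G x a b c f)" for e a b c
  have DR: "DR e a b c + DR a b e c + DR b e a c = 0" for c
    unfolding DR_def by (rule bianchi2_mixed[OF x])
  have K: "cov4 G (riemann_low G) x e a b c d = (\<Sum>f\<in>UNIV. G x $ c $ f * DR e a b f)
      - (\<Sum>f\<in>UNIV. \<Gamma> x f e a * riemann_low G x f b c d) - (\<Sum>f\<in>UNIV. \<Gamma> x f e b * riemann_low G x a f c d)" for e a b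
  proof -
    have 1: "partial e (\<lambda>y. riemann_low G y a b c d) x =
        (\<Sum>f\<in>UNIV. partial e (\<lambda>y. G y $ c $ f) x * riemann G x a b f d)
        + (\<Sum>f\<in>UNIV. G x $ c $ f * partial e (\<lambda>y. riemann G y a b f d) x)"
      unfolding riemann_low_def
      by (simp add: partial_sum partial_mult differentiable_G differentiable_curvature x differentiable_mult sum.distrib)
    have 2: "(\<Sum>f\<in>UNIV. partial e (\<lambda>y. G y $ c $ f) x * riemann G x a b f d) =
       (\<Sum>g\<in>UNIV. \<Gamma> x g e c * riemann_low G x a b g d)
       + (\<Sum>g\<in>UNIV. G x $ c $ g * (\<Sum>f\<in>UNIV. \<Gamma> x g e f * riemann G x a b f d))"
      unfolding partial_G[OF x] riemann_low_def distrib_right sum.distrib sum_distrib_left sum_distrib_right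
      by (subst (1 3) sum.swap) (simp add: mult_ac G_commute[OF x])
    have 3: "(\<Sum>f\<in>UNIV. \<Gamma> x f e d * riemann_low G x a b c f)
       = (\<Sum>g\<in>UNIV. G x $ c $ g * (\<Sum>f\<in>UNIV. \<Gamma> x f e d * riemann G x a b g f))"
      unfolding riemann_low_def sum_distrib_left by (subst sum.swap) (simp add: mult_ac)
    show ?thesis
      unfolding cov4_def 1 2 3 DR_def by (simp add: algebra_simps sum.distrib sum_subtractf)
  qed
  have "(\<Sum>f\<in>UNIV. G x $ c $ f * DR e a b f) + (\<Sum>f\<in>UNIV. G x $ c $ f * DR a b e f)
      + (\<Sum>f\<in>UNIV. G x $ c $ f * DR b e a f) = 0"
    by (simp add: sum.distrib[symmetric] distrib_left[symmetric] DR)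
  then show ?thesis
    unfolding K by (simp add: christoffel_commute[OF x, of _ a e] christoffel_commute[OF x, of _ b e]
      christoffel_commute[OF x, of _ b a] riemann_low_skew12[of x _ e] riemann_low_skew12[of x b a] riemann_low_skew12[of x _ a] riemann_low_skew12[of x _ b] sum_negf)
qed

end

section \<open>Divergences of the Ricci, Schouten and Weyl tensors\<close>

text \<open>The Kulkarni-Nomizu product of the metric with \<open>T\<close>. It is both the difference between the Riemann
  and the Weyl tensor, for \<open>T\<close> the Schouten tensor, and the shape of the change of the Riemann
  tensor under a conformal rescaling.\<close>

definition kulkarni :: "'n::finite metric_comps \<Rightarrow> real^'n \<Rightarrow> ('n \<Rightarrow> 'n \<Rightarrow> real) \<Rightarrow> 'n \<Rightarrow> 'n \<Rightarrow> 'n \<Rightarrow> 'n \<Rightarrow> real" where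
  "kulkarni G x T a b c d =
     G x $ c $ a * T b d - G x $ c $ b * T a d + G x $ d $ b * T a c - G x $ d $ a * T b c"

lemma sum_swap_outer_inner:
  "(\<Sum>a\<in>A. \<Sum>c\<in>C. \<Sum>f\<in>B. F a c f) = (\<Sum>f\<in>B. \<Sum>c\<in>C. \<Sum>a\<in>A. F a c f)"
proof -
  have "(\<Sum>a\<in>A. \<Sum>c\<in>C. \<Sum>f\<in>B. F a c f) = (\<Sum>a\<in>A. \<Sum>f\<in>B. \<Sum>c\<in>C. F a c f)"
    by (intro sum.cong refl sum.swap)
  also have "\<dots> = (\<Sum>f\<in>B. \<Sum>a\<in>A. \<Sum>c\<in>C. F a c f)"
    by (rule sum.swap)
  also have "\<dots> = (\<Sum>f\<in>B. \<Sum>c\<in>C. \<Sum>a\<in>A. F a c f)"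
    by (intro sum.cong refl sum.swap)
  finally show ?thesis .
qed

context metric_chart begin

text \<open>The inverse metric is covariantly constant, so covariant derivatives can be moved through
  \<open>contract\<close>, see \<open>partial_contract\<close> and \<open>cov2_contract\<close>.\<close>

lemma partial_ginv_christoffel:
  assumes x: "x \<in> S"
  shows "partial e (\<lambda>y. ginv G y a b) x =
    - (\<Sum>f\<in>UNIV. \<Gamma> x a e f * ginv G x f b) - (\<Sum>f\<in>UNIV. \<Gamma> x b e f * ginv G x a f)"
proof -
  have 1: "(\<Sum>d\<in>UNIV. (\<Sum>f\<in>UNIV. G x $ d $ f * \<Gamma> x f e c) * ginv G x d b) = \<Gamma> x b e c" for c
  proof -
    have "(\<Sum>d\<in>UNIV. (\<Sum>f\<in>UNIV. G x $ d $ f * \<Gamma> x f e c) * ginv G x d b)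
      = (\<Sum>f\<in>UNIV. \<Gamma> x f e c * (\<Sum>d\<in>UNIV. G x $ f $ d * ginv G x d b))"
      unfolding sum_distrib_left sum_distrib_right
      by (subst sum.swap) (intro sum.cong refl, simp add: G_commute[OF x] mult_ac)
    then show ?thesis by (simp add: G_ginv[OF x])
  qed
  have 2: "(\<Sum>c\<in>UNIV. ginv G x a c * (\<Sum>d\<in>UNIV. (\<Sum>f\<in>UNIV. G x $ c $ f * \<Gamma> x f e d) * ginv G x d b))
      = (\<Sum>d\<in>UNIV. \<Gamma> x a e d * ginv G x d b)"
  proof -
    have "(\<Sum>c\<in>UNIV. ginv G x a c * (\<Sum>d\<in>UNIV. (\<Sum>f\<in>UNIV. G x $ c $ f * \<Gamma> x f e d) * ginv G x d b))
      = (\<Sum>d\<in>UNIV. (\<Sum>c\<in>UNIV. \<Sum>f\<in>UNIV. ginv G x a c * (G x $ c $ f * \<Gamma> x f e d)) * ginv G x d b)"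
      unfolding sum_distrib_left sum_distrib_right
      by (subst sum.swap) (simp add: mult_ac)
    also have "\<dots> = (\<Sum>d\<in>UNIV. \<Gamma> x a e d * ginv G x d b)"
    proof (intro sum.cong refl arg_cong2[where f = times])
      fix d
      have "(\<Sum>c\<in>UNIV. \<Sum>f\<in>UNIV. ginv G x a c * (G x $ c $ f * \<Gamma> x f e d))
        = (\<Sum>f\<in>UNIV. (\<Sum>c\<in>UNIV. ginv G x a c * G x $ c $ f) * \<Gamma> x f e d)"
        unfolding sum_distrib_right by (subst sum.swap) (simp add: mult_ac)
      then show "(\<Sum>c\<in>UNIV. \<Sum>f\<in>UNIV. ginv G x a c * (G x $ c $ f * \<Gamma> x f e d)) = \<Gamma> x a e d"
        by (simp add: ginv_G[OF x])
    qed
    finally show ?thesis .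
  qed
  show ?thesis
    unfolding partial_ginv[OF x] partial_G[OF x] distrib_right distrib_left sum.distrib 1 2
    by (simp add: mult.commute)
qed

text \<open>Lowering an index commutes with the covariant derivative by \<open>partial_G\<close>.\<close>

lemma cov1_lower:
  assumes x: "x \<in> S" and X: "\<And>c. (\<lambda>y. X y $ c) differentiable (at x)"
  shows "cov1 G (\<lambda>y. lower G y (X y)) x a b = (\<Sum>c\<in>UNIV. G x $ b $ c * cov_vec G X x a c)"
proof -
  have 1: "(\<Sum>c\<in>UNIV. (\<Sum>e\<in>UNIV. G x $ c $ e * \<Gamma> x e a b) * X x $ c)
    = (\<Sum>e\<in>UNIV. \<Gamma> x e a b * lower G x (X x) e)"
    unfolding lower_def sum_distrib_left sum_distrib_right
    by (rule trans[OF sum.swap]) (intro sum.cong refl, simp add: G_commute[OF x] mult_ac)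
  have 2: "(\<Sum>c\<in>UNIV. (\<Sum>e\<in>UNIV. G x $ b $ e * \<Gamma> x e a c) * X x $ c)
    = (\<Sum>c\<in>UNIV. G x $ b $ c * (\<Sum>e\<in>UNIV. \<Gamma> x c a e * X x $ e))"
    unfolding sum_distrib_left sum_distrib_right
    by (rule trans[OF sum.swap]) (intro sum.cong refl, simp add: mult_ac)
  have "partial a (\<lambda>y. lower G y (X y) b) x
     = (\<Sum>c\<in>UNIV. partial a (\<lambda>y. G y $ b $ c) x * X x $ c) + (\<Sum>c\<in>UNIV. G x $ b $ c * partial a (\<lambda>y. X y $ c) x)"
    unfolding lower_def
    by (simp add: partial_sum partial_mult differentiable_G X x differentiable_mult sum.distrib)
  then show ?thesis
    unfolding partial_G[OF x] distrib_right sum.distrib 1 2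
    by (simp add: cov1_def cov_vec_def distrib_left sum.distrib)
qed

lemma partial_contract:
  assumes x: "x \<in> S" and T: "\<And>a b. (\<lambda>y. T y a b) differentiable (at x)"
  shows "partial e (\<lambda>y. contract G y (T y)) x = contract G x (cov2 G T x e)"
proof -
  have 1: "(\<Sum>a\<in>UNIV. \<Sum>c\<in>UNIV. (\<Sum>f\<in>UNIV. \<Gamma> x a e f * ginv G x f c) * T x a c)
      = (\<Sum>a\<in>UNIV. \<Sum>c\<in>UNIV. ginv G x a c * (\<Sum>f\<in>UNIV. \<Gamma> x f e a * T x f c))"
    unfolding sum_distrib_left sum_distrib_right
    by (subst sum_swap_outer_inner) (simp add: mult_ac)
  have 2: "(\<Sum>a\<in>UNIV. \<Sum>c\<in>UNIV. (\<Sum>f\<in>UNIV. \<Gamma> x c e f * ginv G x a f) * T x a c)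
      = (\<Sum>a\<in>UNIV. \<Sum>c\<in>UNIV. ginv G x a c * (\<Sum>f\<in>UNIV. \<Gamma> x f e c * T x a f))"
    unfolding sum_distrib_left sum_distrib_right
    by (rule sum.cong[OF refl], rule trans[OF sum.swap]) (simp add: mult_ac)
  have "partial e (\<lambda>y. contract G y (T y)) x
     = (\<Sum>a\<in>UNIV. \<Sum>c\<in>UNIV. partial e (\<lambda>y. ginv G y a c) x * T x a c + ginv G x a c * partial e (\<lambda>y. T y a c) x)"
    unfolding contract_def
    by (simp add: partial_sum partial_mult differentiable_ginv x T differentiable_mult differentiable_sum)
  also have "\<dots> = contract G x (cov2 G T x e)"
    unfolding contract_def cov2_def partial_ginv_christoffel[OF x] right_diff_distrib left_diff_distrib minus_mult_left[symmetric]
    by (simp only: sum.distrib sum_subtractf sum_negf 1 2)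
  finally show ?thesis .
qed

lemma cov2_contract:
  assumes x: "x \<in> S" and U: "\<And>a b c d. (\<lambda>y. U y a b c d) differentiable (at x)"
  shows "cov2 G (\<lambda>y b d. contract G y (\<lambda>a c. U y a b c d)) x e b d = contract G x (\<lambda>a c. cov4 G U x e a b c d)"
proof -
  have "cov4 G U x e a b c d = cov2 G (\<lambda>y a c. U y a b c d) x e a c
      - (\<Sum>f\<in>UNIV. \<Gamma> x f e b * U x a f c d) - (\<Sum>f\<in>UNIV. \<Gamma> x f e d * U x a b c f)" for a c
    by (simp add: cov4_def cov2_def)
  then have 1: "contract G x (\<lambda>a c. cov4 G U x e a b c d) = contract G x (cov2 G (\<lambda>y a c. U y a b c d) x e)
      - (\<Sum>f\<in>UNIV. \<Gamma> x f e b * contract G x (\<lambda>a c. U x a f c d))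
      - (\<Sum>f\<in>UNIV. \<Gamma> x f e d * contract G x (\<lambda>a c. U x a b c f))"
    by (simp add: contract_diff contract_sum contract_mult)
  have "partial e (\<lambda>y. contract G y (\<lambda>a c. U y a b c d)) x = contract G x (cov2 G (\<lambda>y a c. U y a b c d) x e)"
    by (rule partial_contract[OF x U])
  then show ?thesis
    unfolding 1 by (simp add: cov2_def)
qed

lemma cov2_cong:
  assumes "\<And>y a b. y \<in> S \<Longrightarrow> T y a b = U y a b" "x \<in> S"
  shows "cov2 G T x e a b = cov2 G U x e a b"
  unfolding cov2_def by (simp add: assms partial_cong_open[OF open_S assms(2,1)])

lemma cov3_cong:
  assumes "\<And>y a b c. y \<in> S \<Longrightarrow> T y a b c = U y a b c" "x \<in> S"
  shows "cov3 G T x e a b c = cov3 G U x e a b c"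
  unfolding cov3_def by (simp add: assms partial_cong_open[OF open_S assms(2,1)])

lemma cov4_cong:
  assumes "\<And>y a b c d. y \<in> S \<Longrightarrow> T y a b c d = U y a b c d" "x \<in> S"
  shows "cov4 G T x e a b c d = cov4 G U x e a b c d"
  unfolding cov4_def by (simp add: assms partial_cong_open[OF open_S assms(2,1)])

lemma cov4_permute_indices: "cov4 G (\<lambda>y a b c d. T y b a d c) x e a b c d = cov4 G T x e b a d c"
  "cov4 G (\<lambda>y a b c d. T y d c b a) x e a b c d = cov4 G T x e d c b a"
  by (simp_all add: cov4_def)

lemma cov4_riemann_low_skew12:
  assumes x: "x \<in> S"
  shows "cov4 G (riemann_low G) x e a b c d = - cov4 G (riemann_low G) x e b a c d"
proof -
  have "partial e (\<lambda>y. riemann_low G y a b c d) x = partial e (\<lambda>y. - riemann_low G y b a c d) x"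
    by (rule partial_cong_open[OF open_S x riemann_low_skew12])
  then show ?thesis
    by (simp add: cov4_def partial_minus differentiable_curvature x riemann_low_skew12[of x a] riemann_low_skew12[of x _ b] sum_negf)
qed

text \<open>One contraction of the second Bianchi identity: two of its three terms become derivatives of the
  Ricci tensor.\<close>

lemma div_riemann:
  assumes x: "x \<in> S"
  shows "contract G x (\<lambda>f c. cov4 G (riemann_low G) x f a b c d) = cov2 G (ricci G) x a b d - cov2 G (ricci G) x b a d"
proof -
  have ric: "cov2 G (ricci G) x e b d = contract G x (\<lambda>a c. cov4 G (riemann_low G) x e a b c d)" for e b d
    using cov2_cong[of "\<lambda>y b d. contract G y (\<lambda>a c. riemann_low G y a b c d)" "ricci G" x e b d] x
    by (simp add: contract_riemann_low cov2_contract differentiable_curvature)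
  have "contract G x (\<lambda>f c. cov4 G (riemann_low G) x b f a c d + cov4 G (riemann_low G) x f a b c d
     + (- cov4 G (riemann_low G) x a f b c d)) = contract G x (\<lambda>f c. 0)"
    by (simp add: bianchi2[OF x] cov4_riemann_low_skew12[OF x, of a b, symmetric])
  then show ?thesis
    by (simp only: contract_add contract_uminus ric) (simp add: contract_def)
qed

lemma cov2_ricci_commute:
  assumes x: "x \<in> S"
  shows "cov2 G (ricci G) x e a b = cov2 G (ricci G) x e b a"
proof -
  have "partial e (\<lambda>y. ricci G y a b) x = partial e (\<lambda>y. ricci G y b a) x"
    by (rule partial_cong_open[OF open_S x ricci_commute])
  then show ?thesis by (simp add: cov2_def ricci_commute[OF x, of _ b] ricci_commute[OF x, of a])
qed

text \<open>A second contraction. After the two contractions are exchanged, the left-hand side of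
  \<open>div_riemann\<close> is itself the divergence of the Ricci tensor, which accounts for the
  factor one half.\<close>

lemma div_ricci:
  assumes x: "x \<in> S"
  shows "contract G x (\<lambda>f c. cov2 G (ricci G) x f c a) = partial a (scal G) x / 2"
proof -
  have flip: "riemann_low G y a b c d = riemann_low G y b a d c" if "y \<in> S" for y a b c d
    using riemann_low_skew12[of y a b c d] riemann_low_skew34[OF that, of b a c d] by simp
  have 1: "contract G x (\<lambda>b d. cov4 G (riemann_low G) x f a b c d) = cov2 G (ricci G) x f a c" for f c
  proof -
    have "cov4 G (riemann_low G) x f a b c d = cov4 G (riemann_low G) x f b a d c" for b d
      using cov4_cong[of "riemann_low G" "\<lambda>y a b c d. riemann_low G y b a d c" x f a b c d] x
        flip cov4_permute_indices(1)[of "riemann_low G" x f a b c d] by simp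
    then show ?thesis
      using cov2_cong[of "\<lambda>y b d. contract G y (\<lambda>a c. riemann_low G y a b c d)" "ricci G" x f a c] x
      by (simp add: contract_riemann_low cov2_contract differentiable_curvature)
  qed
  have "partial a (scal G) x = contract G x (cov2 G (ricci G) x a)"
    using partial_contract[OF x, of "ricci G" a] by (simp add: contract_ricci differentiable_curvature x)
  moreover have "contract G x (\<lambda>b d. contract G x (\<lambda>f c. cov4 G (riemann_low G) x f a b c d))
     = contract G x (\<lambda>f c. contract G x (\<lambda>b d. cov4 G (riemann_low G) x f a b c d))"
    by (rule contract_contract)
  ultimately show ?thesis
    by (simp add: div_riemann[OF x] 1 contract_diff cov2_ricci_commute[OF x, of _ _ a])
qed

lemma schouten_commute: "x \<in> S \<Longrightarrow> schouten G x a b = schouten G x b a"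
  by (simp add: schouten_def ricci_commute[of x a b] G_commute[of x a b])

lemma ricci_schouten:
  assumes "CARD('n) \<ge> 3"
  shows "ricci G x a b = (real CARD('n) - 2) * schouten G x a b + scal G x / (2 * (real CARD('n) - 1)) * G x $ a $ b"
proof -
  have "real CARD('n) - 2 \<noteq> 0" using assms by linarith
  then show ?thesis by (simp add: schouten_def)
qed

lemma contract_schouten:
  assumes n: "CARD('n) \<ge> 3" and x: "x \<in> S"
  shows "contract G x (schouten G x) = scal G x / (2 * (real CARD('n) - 1))"
proof -
  define p where "p = contract G x (schouten G x)"
  define J where "J = scal G x / (2 * (real CARD('n) - 1))"
  have "ricci G x = (\<lambda>a b. (real CARD('n) - 2) * schouten G x a b + J * G x $ a $ b)"
    by (intro ext) (simp only: ricci_schouten[OF n] J_def)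
  with contract_ricci[of x] have "scal G x = (real CARD('n) - 2) * p + J * real CARD('n)"
    by (simp add: p_def contract_add contract_mult contract_G_G[OF x])
  moreover have "scal G x = 2 * (real CARD('n) - 1) * J"
    using n by (simp add: J_def)
  ultimately have "(real CARD('n) - 2) * (p - J) = 0"
    by (simp add: algebra_simps)
  moreover have "real CARD('n) - 2 \<noteq> 0" using n by linarith
  ultimately show ?thesis by (simp add: p_def J_def)
qed

lemma cov2_scale_G:
  assumes x: "x \<in> S" and s: "s differentiable (at x)"
  shows "cov2 G (\<lambda>y a b. s y * G y $ a $ b) x e a b = partial e s x * G x $ a $ b"
  by (simp add: cov2_def partial_mult s differentiable_G x partial_G[OF x] algebra_simps
      sum_distrib_left G_commute[OF x])

lemma cov2_lincomb:
  assumes "\<And>a b. (\<lambda>y. T y a b) differentiable (at x)" "\<And>a b. (\<lambda>y. U y a b) differentiable (at x)"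
  shows "cov2 G (\<lambda>y a b. r * T y a b + U y a b) x e a b = r * cov2 G T x e a b + cov2 G U x e a b"
  by (simp add: cov2_def partial_add partial_mult assms differentiable_mult algebra_simps sum.distrib sum_distrib_left)

lemma cov2_ricci_schouten:
  assumes n: "CARD('n) \<ge> 3" and x: "x \<in> S"
  shows "cov2 G (ricci G) x e a b = (real CARD('n) - 2) * cov2 G (schouten G) x e a b
     + partial e (scal G) x / (2 * (real CARD('n) - 1)) * G x $ a $ b"
proof -
  define J where "J y = scal G y / (2 * (real CARD('n) - 1))" for y
  have dJ: "J differentiable (at x)"
    unfolding J_def[abs_def] using differentiable_curvature(4)[OF x] by (simp add: divide_inverse differentiable_mult)
  have "cov2 G (ricci G) x e a b = cov2 G (\<lambda>y a b. (real CARD('n) - 2) * schouten G y a b + J y * G y $ a $ b) x e a b"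
    by (rule cov2_cong[OF _ x]) (simp only: ricci_schouten[OF n] J_def)
  also have "\<dots> = (real CARD('n) - 2) * cov2 G (schouten G) x e a b + partial e J x * G x $ a $ b"
    by (simp add: cov2_lincomb differentiable_curvature x differentiable_mult[OF dJ] differentiable_G
        cov2_scale_G[OF x dJ])
  also have "partial e J x = partial e (scal G) x / (2 * (real CARD('n) - 1))"
    unfolding J_def[abs_def] by (rule partial_divide_const[OF differentiable_curvature(4)[OF x]])
  finally show ?thesis .
qed

text \<open>Inserting \<open>R\<^sub>a\<^sub>b = (n - 2) P\<^sub>a\<^sub>b + J g\<^sub>a\<^sub>b\<close> with \<open>J = R / (2 (n - 1))\<close> into \<open>div_ricci\<close> gives \<open>(n - 2)\<close> times the
  assertion \<open>\<nabla>\<^sup>c P\<^sub>c\<^sub>a = \<nabla>\<^sub>a J\<close>.\<close>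

lemma div_schouten:
  assumes n: "CARD('n) \<ge> 3" and x: "x \<in> S"
  shows "contract G x (\<lambda>f c. cov2 G (schouten G) x f c a) = partial a (scal G) x / (2 * (real CARD('n) - 1))"
proof -
  define dJ where "dJ a = partial a (scal G) x / (2 * (real CARD('n) - 1))" for a
  define D where "D = contract G x (\<lambda>f c. cov2 G (schouten G) x f c a)"
  have "partial a (scal G) x / 2 = (real CARD('n) - 2) * D + dJ a"
    unfolding div_ricci[OF x, symmetric] cov2_ricci_schouten[OF n x] dJ_def[symmetric] D_def
    using contract_G(4)[OF x, of a dJ] by (simp add: contract_add contract_mult mult.commute)
  moreover have "partial a (scal G) x / 2 = (real CARD('n) - 1) * dJ a"
    using n by (simp add: dJ_def field_simps)
  ultimately have "(real CARD('n) - 2) * (D - dJ a) = 0" by (simp add: algebra_simps)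
  moreover have "real CARD('n) - 2 \<noteq> 0" using n by linarith
  ultimately show ?thesis by (simp add: D_def dJ_def)
qed

lemma cotton_eq: "cotton G x a b c = cov2 G (schouten G) x b c a - cov2 G (schouten G) x c b a"
  by (simp add: cotton_def antisym2_def)

lemma cotton_skew: "cotton G x a b c = - cotton G x a c b"
  by (simp add: cotton_eq)

lemma cov2_schouten_commute:
  assumes x: "x \<in> S"
  shows "cov2 G (schouten G) x e a b = cov2 G (schouten G) x e b a"
proof -
  have "partial e (\<lambda>y. schouten G y a b) x = partial e (\<lambda>y. schouten G y b a) x"
    by (rule partial_cong_open[OF open_S x schouten_commute])
  then show ?thesis by (simp add: cov2_def schouten_commute[OF x, of _ b] schouten_commute[OF x, of a])
qed

lemma cotton_cyclic: "x \<in> S \<Longrightarrow> cotton G x a b c + cotton G x b c a + cotton G x c a b = 0"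
  using cov2_schouten_commute[of x] by (simp add: cotton_eq)

text \<open>Here \<open>\<nabla>\<^sup>c P\<^sub>c\<^sub>a = \<nabla>\<^sub>a J\<close> meets \<open>J = P\<^sub>c\<^sup>c\<close>.\<close>

lemma cotton_trace:
  assumes n: "CARD('n) \<ge> 3" and x: "x \<in> S"
  shows "contract G x (\<lambda>e c. cotton G x e c b) = 0"
proof -
  have "partial b (scal G) x / (2 * (real CARD('n) - 1)) = partial b (\<lambda>y. contract G y (schouten G y)) x"
  proof -
    have "partial b (\<lambda>y. contract G y (schouten G y)) x = partial b (\<lambda>y. scal G y / (2 * (real CARD('n) - 1))) x"
      by (rule partial_cong_open[OF open_S x contract_schouten[OF n]])
    then show ?thesis by (simp only: partial_divide_const[OF differentiable_curvature(4)[OF x]])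
  qed
  also have "\<dots> = contract G x (cov2 G (schouten G) x b)"
    by (rule partial_contract[OF x]) (rule differentiable_curvature[OF x])
  finally have "contract G x (\<lambda>e c. cov2 G (schouten G) x b c e) = partial b (scal G) x / (2 * (real CARD('n) - 1))"
    using cov2_schouten_commute[OF x, of b] by simp
  moreover have "contract G x (\<lambda>e c. cov2 G (schouten G) x c b e) = contract G x (\<lambda>e c. cov2 G (schouten G) x e c b)"
    using contract_transpose[OF x, of "\<lambda>e c. cov2 G (schouten G) x e b c"] by (simp add: cov2_schouten_commute[OF x, of _ b _])
  ultimately show ?thesis
    by (simp add: cotton_eq contract_diff div_schouten[OF n x])
qed

lemma weyl_eq: "weyl G x a b c d = riemann_low G x a b c d - kulkarni G x (schouten G x) a b c d"
  by (simp add: weyl_def kulkarni_def antisym2_def field_simps)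

lemma weyl_skew12: "weyl G x a b c d = - weyl G x b a c d"
  using riemann_low_skew12[of x a b c d] by (simp add: weyl_eq kulkarni_def)

lemma weyl_skew34: "x \<in> S \<Longrightarrow> weyl G x a b c d = - weyl G x a b d c"
  using riemann_low_skew34[of x a b c d] by (simp add: weyl_eq kulkarni_def)

lemma weyl_pair: "x \<in> S \<Longrightarrow> weyl G x a b c d = weyl G x c d a b"
  using riemann_low_pair[of x a b c d] schouten_commute[of x] G_commute[of x] by (simp add: weyl_eq kulkarni_def)

lemma contract_kulkarni:
  assumes x: "x \<in> S"
  shows "contract G x (\<lambda>a c. kulkarni G x T a b c d) = (real CARD('n) - 2) * T b d + contract G x T * G x $ d $ b"
proof -
  have "contract G x (\<lambda>a c. kulkarni G x T a b c d) =
      contract G x (\<lambda>a c. G x $ c $ a * T b d) - contract G x (\<lambda>a c. G x $ c $ b * T a d)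
      + contract G x (\<lambda>a c. G x $ d $ b * T a c) - contract G x (\<lambda>a c. G x $ d $ a * T b c)"
    unfolding kulkarni_def by (simp only: contract_add contract_diff)
  then show ?thesis
    by (simp only: contract_mult contract_mult_right contract_G[OF x] contract_G_G[OF x]) (simp add: algebra_simps)
qed

lemma weyl_trace:
  assumes n: "CARD('n) \<ge> 3" and x: "x \<in> S"
  shows "contract G x (\<lambda>a c. weyl G x a b c d) = 0"
  unfolding weyl_eq contract_diff contract_kulkarni[OF x] contract_riemann_low[OF x] ricci_schouten[OF n] contract_schouten[OF n x]
  using G_commute[OF x, of d b] by simp

lemma cov4_kulkarni:
  assumes x: "x \<in> S" and T: "\<And>a b. (\<lambda>y. T y a b) differentiable (at x)"
  shows "cov4 G (\<lambda>y. kulkarni G y (T y)) x e a b c d = kulkarni G x (cov2 G T x e) a b c d"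
proof -
  have 1: "cov4 G (\<lambda>y a b c d. G y $ c $ a * T y b d) x e a b c d = G x $ c $ a * cov2 G T x e b d" for a b c d
    by (simp add: cov4_def cov2_def partial_mult T differentiable_G x partial_G[OF x] algebra_simps
      sum_distrib_left G_commute[OF x])
  have "cov4 G (\<lambda>y. kulkarni G y (T y)) x e a b c d =
      cov4 G (\<lambda>y a b c d. G y $ c $ a * T y b d) x e a b c d
    - cov4 G (\<lambda>y a b c d. G y $ c $ a * T y b d) x e b a c d
    + cov4 G (\<lambda>y a b c d. G y $ c $ a * T y b d) x e b a d c
    - cov4 G (\<lambda>y a b c d. G y $ c $ a * T y b d) x e a b d c"
    by (simp add: cov4_def kulkarni_def partial_add partial_diff T differentiable_G x differentiable_mult differentiable_add differentiable_diff algebra_simps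
      sum.distrib sum_subtractf)
  then show ?thesis unfolding 1 kulkarni_def by simp
qed

text \<open>The divergence of the Riemann tensor contributes \<open>n - 2\<close> Cotton tensors and that of the
  product of the metric with the Schouten tensor removes one; the terms with \<open>\<nabla>\<^sub>a J\<close> cancel by
  \<open>div_schouten\<close>.\<close>

lemma div_weyl:
  assumes n: "CARD('n) \<ge> 3" and x: "x \<in> S"
  shows "contract G x (\<lambda>f c. cov4 G (weyl G) x f a b c d) = (real CARD('n) - 3) * cotton G x d a b"
proof -
  have dk: "(\<lambda>y. kulkarni G y (schouten G y) a b c d) differentiable (at x)" for a b c d
    unfolding kulkarni_def
    by (simp add: differentiable_add differentiable_diff differentiable_mult differentiable_G differentiable_curvature x)
  have 1: "cov4 G (weyl G) x f a b c d = cov4 G (riemann_low G) x f a b c d - kulkarni G x (cov2 G (schouten G) x f) a b c d" for f c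
    unfolding cov4_kulkarni[OF x differentiable_curvature(5)[OF x], symmetric]
    by (simp add: cov4_def weyl_eq partial_diff dk differentiable_curvature x algebra_simps sum_subtractf)
  have 2: "contract G x (\<lambda>f c. cov2 G (schouten G) x f a c) = partial a (scal G) x / (2 * (real CARD('n) - 1))" for a
    using div_schouten[OF n x, of a] by (simp add: cov2_schouten_commute[OF x, of _ _ a])
  have "contract G x (\<lambda>f c. kulkarni G x (cov2 G (schouten G) x f) a b c d)
     = cov2 G (schouten G) x a b d - cov2 G (schouten G) x b a d
      + G x $ d $ b * (partial a (scal G) x / (2 * (real CARD('n) - 1)))
      - G x $ d $ a * (partial b (scal G) x / (2 * (real CARD('n) - 1)))"
    by (simp only: kulkarni_def contract_add contract_diff contract_mult contract_G[OF x] 2)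
  then show ?thesis
    by (simp add: 1 contract_diff div_riemann[OF x] cov2_ricci_schouten[OF n x] cotton_eq G_commute[OF x, of d] algebra_simps)
qed

end

section \<open>Conformal change of the Weyl tensor\<close>

text \<open>The tensors of \<open>G\<close> are expressed through those of \<open>H\<close>, because in the application it is \<open>H\<close> whose
  curvature is known.\<close>

locale conformal_metrics = H: metric_chart S H + G: metric_chart S G
  for S :: "(real^'n::finite) set" and H G :: "'n metric_comps" +
  fixes v :: "real^'n \<Rightarrow> real"
  assumes smooth_v: "smooth_on S v"
    and G_eq: "\<And>x i j. x \<in> S \<Longrightarrow> G x $ i $ j = exp (2 * v x) * H x $ i $ j"
begin

definition dv :: "real^'n \<Rightarrow> 'n \<Rightarrow> real" where "dv x a = partial a v x"
definition dvu :: "real^'n \<Rightarrow> 'n \<Rightarrow> real" where "dvu x = raise H x (dv x)"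
definition hess :: "real^'n \<Rightarrow> 'n \<Rightarrow> 'n \<Rightarrow> real" where "hess = cov1 H dv"
definition sqnorm :: "real^'n \<Rightarrow> real" where "sqnorm x = (\<Sum>d\<in>UNIV. dvu x d * dv x d)"
text \<open>The change \<open>- \<nabla>\<^sub>a v\<^sub>b + v\<^sub>a v\<^sub>b - v\<^sub>c v\<^sup>c g\<^sub>a\<^sub>b / 2\<close> of the Schouten tensor under rescaling, see
  \<open>schouten_conf\<close>.\<close>

definition schouten_shift :: "real^'n \<Rightarrow> 'n \<Rightarrow> 'n \<Rightarrow> real" where
  "schouten_shift x a b = - hess x a b + dv x a * dv x b - sqnorm x / 2 * H x $ a $ b"

lemma smooth_dv: "smooth_on S (\<lambda>y. dv y a)" "smooth_on S (\<lambda>y. dvu y a)"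
  "smooth_on S (\<lambda>y. hess y a b)" "smooth_on S sqnorm" "smooth_on S (\<lambda>y. schouten_shift y a b)"
proof -
  show [simp]: "smooth_on S (\<lambda>y. dv y a)" for a
    unfolding dv_def by (rule smooth_on_partial[OF smooth_v])
  show [simp]: "smooth_on S (\<lambda>y. dvu y a)" for a
    unfolding dvu_def raise_def by (intro H.smooth_rules H.smooth_ginv) simp
  show [simp]: "smooth_on S (\<lambda>y. hess y a b)" for a b
    unfolding hess_def cov1_def by (intro H.smooth_rules H.smooth_christoffel) simp_all
  show [simp]: "smooth_on S sqnorm"
    unfolding sqnorm_def[abs_def] by (intro H.smooth_rules) simp_all
  show "smooth_on S (\<lambda>y. schouten_shift y a b)"
    unfolding schouten_shift_def by (intro H.smooth_rules H.smooth_G) simp_all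
qed

lemma differentiable_dv:
  assumes "x \<in> S"
  shows "v differentiable (at x)" "(\<lambda>y. dv y a) differentiable (at x)" "(\<lambda>y. dvu y a) differentiable (at x)"
    "(\<lambda>y. hess y a b) differentiable (at x)" "sqnorm differentiable (at x)"
    "(\<lambda>y. schouten_shift y a b) differentiable (at x)"
  by (rule smooth_on_differentiable[OF _ assms], rule smooth_v smooth_dv)+

lemma H_dvu: "x \<in> S \<Longrightarrow> (\<Sum>b\<in>UNIV. H x $ a $ b * dvu x b) = dv x a"
  unfolding dvu_def by (rule H.G_raise)

lemma partial_dv_commute: "x \<in> S \<Longrightarrow> partial a (\<lambda>y. dv y b) x = partial b (\<lambda>y. dv y a) x"
  unfolding dv_def by (rule partial_commute[OF H.open_S _ smooth_v])

lemma hess_commute: "x \<in> S \<Longrightarrow> hess x a b = hess x b a"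
  by (simp add: hess_def cov1_def partial_dv_commute[of x a b] H.christoffel_commute[of x _ a b])

lemma partial_G_conf:
  assumes x: "x \<in> S"
  shows "partial a (\<lambda>y. G y $ b $ c) x = exp (2 * v x) * (2 * dv x a * H x $ b $ c + partial a (\<lambda>y. H y $ b $ c) x)"
proof -
  have d: "(\<lambda>y. 2 * v y) differentiable (at x)"
    using differentiable_dv(1)[OF x] by (simp add: differentiable_mult)
  have de: "(\<lambda>y. exp (2 * v y)) differentiable (at x)"
    using has_derivative_exp[OF d[unfolded frechet_derivative_works]] unfolding differentiable_def by blast
  have "partial a (\<lambda>y. G y $ b $ c) x = partial a (\<lambda>y. exp (2 * v y) * H y $ b $ c) x"
    by (rule partial_cong_open[OF H.open_S x G_eq])
  also have "\<dots> = exp (2 * v x) * (2 * dv x a * H x $ b $ c + partial a (\<lambda>y. H y $ b $ c) x)"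
    by (simp add: partial_exp[OF d] partial_mult de differentiable_dv(1)[OF x] H.differentiable_G x dv_def)
       (simp add: algebra_simps)
  finally show ?thesis .
qed

lemma ginv_conf:
  assumes x: "x \<in> S"
  shows "ginv G x a b = exp (- 2 * v x) * ginv H x a b"
proof -
  have "exp (- 2 * v x) * ginv H x a b = (\<Sum>c\<in>UNIV. ginv G x a c * (if c = b then 1 else 0))"
  proof (rule G.ginv_unique[OF x, where w = "\<lambda>a. exp (- 2 * v x) * ginv H x a b"])
    fix c
    have "exp (2 * v x) * exp (- 2 * v x) = 1" by (simp add: exp_add[symmetric])
    then have "(\<Sum>d\<in>UNIV. G x $ c $ d * (exp (- 2 * v x) * ginv H x d b)) = (\<Sum>d\<in>UNIV. H x $ c $ d * ginv H x d b)"
      by (intro sum.cong refl) (simp add: G_eq[OF x] mult_ac)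
    then show "(\<Sum>d\<in>UNIV. G x $ c $ d * (exp (- 2 * v x) * ginv H x d b)) = (if c = b then 1 else 0)"
      by (simp add: H.G_ginv[OF x])
  qed
  then show ?thesis by simp
qed

lemma contract_conf: "x \<in> S \<Longrightarrow> contract G x T = exp (- 2 * v x) * contract H x T"
  by (simp add: contract_def ginv_conf sum_distrib_left mult_ac)

lemma christoffel_conf:
  assumes x: "x \<in> S"
  shows "christoffel G x c a b = christoffel H x c a b
     + (if c = a then 1 else 0) * dv x b + (if c = b then 1 else 0) * dv x a - H x $ a $ b * dvu x c"
proof -
  have e: "exp (- 2 * v x) * exp (2 * v x) = 1" by (simp add: exp_add[symmetric])
  have "christoffel G x c a b = (\<Sum>d\<in>UNIV. (exp (- 2 * v x) * exp (2 * v x)) * (ginv H x c d *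
        (partial a (\<lambda>y. H y $ b $ d) x + partial b (\<lambda>y. H y $ a $ d) x - partial d (\<lambda>y. H y $ a $ b) x)
       + 2 * (ginv H x c d * H x $ d $ b) * dv x a + 2 * (ginv H x c d * H x $ d $ a) * dv x b
       - 2 * H x $ a $ b * (ginv H x c d * dv x d))) / 2"
    unfolding christoffel_def ginv_conf[OF x] partial_G_conf[OF x]
    by (intro arg_cong2[where f = divide] sum.cong refl) (simp add: algebra_simps H.G_commute[OF x])
  also have "\<dots> = christoffel H x c a b
     + (\<Sum>d\<in>UNIV. ginv H x c d * H x $ d $ b) * dv x a + (\<Sum>d\<in>UNIV. ginv H x c d * H x $ d $ a) * dv x b
     - H x $ a $ b * dvu x c"
    unfolding e christoffel_def dvu_def raise_def
    by (simp add: sum.distrib sum_subtractf sum_distrib_left sum_distrib_right field_simps)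
  finally show ?thesis by (simp add: H.ginv_G[OF x])
qed

text \<open>Every connection term of a covariant derivative is a sum of this form, so the laws
  \<open>cov2_conf\<close> and \<open>cov3_conf\<close> follow from it by rewriting.\<close>

lemma christoffel_conf_sum:
  assumes x: "x \<in> S"
  shows "(\<Sum>e\<in>UNIV. christoffel G x e a b * F e) = (\<Sum>e\<in>UNIV. christoffel H x e a b * F e)
     + dv x b * F a + dv x a * F b - H x $ a $ b * (\<Sum>e\<in>UNIV. dvu x e * F e)"
proof -
  have "(\<Sum>e\<in>UNIV. christoffel G x e a b * F e) = (\<Sum>e\<in>UNIV. christoffel H x e a b * F e
     + dv x b * ((if e = a then 1 else 0) * F e) + dv x a * ((if e = b then 1 else 0) * F e) - H x $ a $ b * (dvu x e * F e))"
    unfolding christoffel_conf[OF x] by (intro sum.cong refl) (simp add: algebra_simps)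
  then show ?thesis
    by (simp only: sum.distrib sum_subtractf sum_distrib_left[symmetric] sum_delta_mult)
qed

lemma cov2_conf:
  assumes x: "x \<in> S"
  shows "cov2 G T x a b c = cov2 H T x a b c - 2 * dv x a * T x b c - dv x b * T x a c - dv x c * T x b a
    + H x $ a $ b * (\<Sum>e\<in>UNIV. dvu x e * T x e c) + H x $ a $ c * (\<Sum>e\<in>UNIV. dvu x e * T x b e)"
  unfolding cov2_def christoffel_conf_sum[OF x] by simp

lemma cov3_conf:
  assumes x: "x \<in> S"
  shows "cov3 G T x a b c d = cov3 H T x a b c d - 3 * dv x a * T x b c d
    - dv x b * T x a c d - dv x c * T x b a d - dv x d * T x b c a
    + H x $ a $ b * (\<Sum>e\<in>UNIV. dvu x e * T x e c d) + H x $ a $ c * (\<Sum>e\<in>UNIV. dvu x e * T x b e d)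
    + H x $ a $ d * (\<Sum>e\<in>UNIV. dvu x e * T x b c e)"
  unfolding cov3_def christoffel_conf_sum[OF x] by simp

text \<open>Raising an index commutes with the covariant derivative: lower both sides and use
  \<open>cov1_lower\<close>.\<close>

lemma cov_dvu:
  assumes x: "x \<in> S"
  shows "partial a (\<lambda>y. dvu y c) x + (\<Sum>e\<in>UNIV. christoffel H x c a e * dvu x e) = raise H x (hess x a) c"
  unfolding raise_def
proof (rule H.ginv_unique[OF x])
  fix b
  have "lower H y (\<chi> c. dvu y c) b = dv y b" if "y \<in> S" for y b
    using H_dvu[OF that] by (simp add: lower_def)
  moreover from this have "partial a (\<lambda>y. lower H y (\<chi> c. dvu y c) b) x = partial a (\<lambda>y. dv y b) x"
    by (rule partial_cong_open[OF H.open_S x])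
  ultimately show "(\<Sum>c\<in>UNIV. H x $ b $ c * (partial a (\<lambda>y. dvu y c) x + (\<Sum>e\<in>UNIV. christoffel H x c a e * dvu x e))) = hess x a b"
    using H.cov1_lower[OF x, of "\<lambda>y. \<chi> c. dvu y c" a b]
    by (simp add: differentiable_dv x cov_vec_def hess_def cov1_def)
qed

lemma partial_christoffel_conf:
  assumes x: "x \<in> S"
  shows "partial a (\<lambda>y. christoffel G y c b d) x = partial a (\<lambda>y. christoffel H y c b d) x
     + (if c = b then 1 else 0) * partial a (\<lambda>y. dv y d) x + (if c = d then 1 else 0) * partial a (\<lambda>y. dv y b) x
     - partial a (\<lambda>y. H y $ b $ d) x * dvu x c - H x $ b $ d * partial a (\<lambda>y. dvu y c) x"
proof -
  have "partial a (\<lambda>y. christoffel G y c b d) x = partial a (\<lambda>y. christoffel H y c b d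
     + (if c = b then 1 else 0) * dv y d + (if c = d then 1 else 0) * dv y b - H y $ b $ d * dvu y c) x"
    by (rule partial_cong_open[OF H.open_S x christoffel_conf])
  also have "\<dots> = partial a (\<lambda>y. christoffel H y c b d) x
     + (if c = b then 1 else 0) * partial a (\<lambda>y. dv y d) x + (if c = d then 1 else 0) * partial a (\<lambda>y. dv y b) x
     - partial a (\<lambda>y. H y $ b $ d) x * dvu x c - H x $ b $ d * partial a (\<lambda>y. dvu y c) x"
    by (simp only: partial_add partial_diff partial_mult partial_const H.differentiable_G H.differentiable_christoffel
        differentiable_dv x differentiable_mult differentiable_add differentiable_diff differentiable_const)
  finally show ?thesis .
qed

text \<open>The Christoffel symbols are replaced by those of \<open>H\<close> plus the difference tensor of
  \<open>christoffel_conf\<close>. All terms still containing a Christoffel symbol of \<open>H\<close> cancel or combine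
  with a partial derivative to a covariant derivative of \<open>v\<^sub>a\<close>, of \<open>v\<^sup>a\<close> or of the metric. The tensor \<open>Su\<close> is
  \<open>schouten_shift\<close> with its second index raised.\<close>

lemma riemann_conf:
  assumes x: "x \<in> S"
  defines "Su \<equiv> \<lambda>a c. - raise H x (hess x a) c + dv x a * dvu x c - sqnorm x / 2 * (if c = a then 1 else 0)"
  shows "riemann G x a b c d = riemann H x a b c d
     + (if c = a then 1 else 0) * schouten_shift x b d - (if c = b then 1 else 0) * schouten_shift x a d
     + H x $ b $ d * Su a c - H x $ a $ d * Su b c"
proof -
  define \<Gamma> where "\<Gamma> = christoffel H x"
  define \<delta> where "\<delta> a b = (if a = b then 1 else 0 :: real)" for a b :: 'n
  define L where "L a b d = (\<Sum>e\<in>UNIV. \<Gamma> e b d * H x $ a $ e)" for a b d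
  have \<Gamma>G: "christoffel G x c a b = \<Gamma> c a b + \<delta> c a * dv x b + \<delta> c b * dv x a - H x $ a $ b * dvu x c" for a b c
    by (simp add: christoffel_conf[OF x] \<Gamma>_def \<delta>_def)
  have \<Gamma>com: "\<Gamma> c a b = \<Gamma> c b a" for a b c
    unfolding \<Gamma>_def by (rule H.christoffel_commute[OF x])
  have prod: "(\<Sum>e\<in>UNIV. christoffel G x c a e * christoffel G x e b d) =
      (\<Sum>e\<in>UNIV. \<Gamma> c a e * \<Gamma> e b d) + \<delta> c a * (\<Sum>e\<in>UNIV. \<Gamma> e b d * dv x e) + dv x a * \<Gamma> c b d - dvu x c * L a b d
      + dv x d * (\<Gamma> c a b + \<delta> c a * dv x b + \<delta> c b * dv x a - H x $ a $ b * dvu x c)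
      + dv x b * (\<Gamma> c a d + \<delta> c a * dv x d + \<delta> c d * dv x a - H x $ a $ d * dvu x c)
      - H x $ b $ d * ((\<Sum>e\<in>UNIV. \<Gamma> c a e * dvu x e) + \<delta> c a * sqnorm x)" for a b
  proof -
    have "(\<Sum>e\<in>UNIV. christoffel G x c a e * christoffel G x e b d) =
      (\<Sum>e\<in>UNIV. \<Gamma> e b d * christoffel G x c a e) + dv x d * christoffel G x c a b + dv x b * christoffel G x c a d
       - H x $ b $ d * (\<Sum>e\<in>UNIV. dvu x e * christoffel G x c a e)"
      using christoffel_conf_sum[OF x, of b d "christoffel G x c a"] by (simp add: mult.commute \<Gamma>_def)
    also have "(\<Sum>e\<in>UNIV. \<Gamma> e b d * christoffel G x c a e) =
        (\<Sum>e\<in>UNIV. \<Gamma> c a e * \<Gamma> e b d + \<delta> c a * (\<Gamma> e b d * dv x e) + dv x a * (\<delta> c e * \<Gamma> e b d) - dvu x c * (\<Gamma> e b d * H x $ a $ e))"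
      unfolding \<Gamma>G by (intro sum.cong refl) (simp add: algebra_simps)
    also have "\<dots> = (\<Sum>e\<in>UNIV. \<Gamma> c a e * \<Gamma> e b d) + \<delta> c a * (\<Sum>e\<in>UNIV. \<Gamma> e b d * dv x e) + dv x a * \<Gamma> c b d - dvu x c * L a b d"
      unfolding L_def \<delta>_def by (simp only: sum.distrib sum_subtractf sum_distrib_left[symmetric] sum_delta_mult)
    also have "(\<Sum>e\<in>UNIV. dvu x e * christoffel G x c a e) =
        (\<Sum>e\<in>UNIV. \<Gamma> c a e * dvu x e + \<delta> c a * (dvu x e * dv x e) + dv x a * (\<delta> c e * dvu x e) - dvu x c * (H x $ a $ e * dvu x e))"
      unfolding \<Gamma>G by (intro sum.cong refl) (simp add: algebra_simps)
    also have "\<dots> = (\<Sum>e\<in>UNIV. \<Gamma> c a e * dvu x e) + \<delta> c a * sqnorm x"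
      unfolding \<delta>_def by (simp only: sum.distrib sum_subtractf sum_distrib_left[symmetric] sum_delta_mult H_dvu[OF x] sqnorm_def)
        (simp add: mult.commute)
    finally show ?thesis unfolding \<Gamma>G .
  qed
  have dH: "partial a (\<lambda>y. H y $ b $ c) x = L c a b + L b a c" for a b c
    by (simp add: H.partial_G[OF x] L_def \<Gamma>_def mult.commute)
  have ddv: "partial a (\<lambda>y. dv y b) x = hess x a b + (\<Sum>e\<in>UNIV. \<Gamma> e a b * dv x e)" for a b
    by (simp add: hess_def cov1_def \<Gamma>_def)
  have ddvu: "partial a (\<lambda>y. dvu y c) x = raise H x (hess x a) c - (\<Sum>e\<in>UNIV. \<Gamma> c a e * dvu x e)" for a c
    using cov_dvu[OF x, of a c] by (simp add: \<Gamma>_def)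
  have LL: "L a b d = L a d b" for a b d
    unfolding L_def by (simp add: \<Gamma>com[of _ b])
  show ?thesis
    unfolding G.riemann_eq[OF x] H.riemann_eq[OF x] prod partial_christoffel_conf[OF x] \<Gamma>_def[symmetric] \<delta>_def[symmetric]
      Su_def schouten_shift_def dH ddv ddvu
    using LL[of d a b] \<Gamma>com[of c a b] hess_commute[OF x, of a b] H.G_commute[OF x, of a b]
    by (simp add: algebra_simps \<Gamma>com[of _ b a])
qed

lemma riemann_low_conf:
  assumes x: "x \<in> S"
  shows "riemann_low G x a b c d = exp (2 * v x) * (riemann_low H x a b c d + kulkarni H x (schouten_shift x) a b c d)"
proof -
  have Su: "(\<Sum>e\<in>UNIV. H x $ c $ e * (- raise H x (hess x a) e + dv x a * dvu x e - sqnorm x / 2 * (if e = a then 1 else 0)))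
     = schouten_shift x a c" for a
  proof -
    have "(\<Sum>e\<in>UNIV. H x $ c $ e * (- raise H x (hess x a) e + dv x a * dvu x e - sqnorm x / 2 * (if e = a then 1 else 0)))
      = (\<Sum>e\<in>UNIV. - (H x $ c $ e * raise H x (hess x a) e) + dv x a * (H x $ c $ e * dvu x e) - sqnorm x / 2 * (H x $ c $ e * (if e = a then 1 else 0)))"
      by (intro sum.cong refl) (simp add: algebra_simps)
    then show ?thesis
      by (simp only: sum.distrib sum_subtractf sum_negf sum_distrib_left[symmetric] sum_delta_mult H_dvu[OF x] H.G_raise[OF x]
        schouten_shift_def H.G_commute[OF x, of c a])
  qed
  have "riemann_low G x a b c d = exp (2 * v x) * (\<Sum>e\<in>UNIV. H x $ c $ e * riemann H x a b e d
     + schouten_shift x b d * (H x $ c $ e * (if e = a then 1 else 0)) - schouten_shift x a d * (H x $ c $ e * (if e = b then 1 else 0))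
     + H x $ b $ d * (H x $ c $ e * (- raise H x (hess x a) e + dv x a * dvu x e - sqnorm x / 2 * (if e = a then 1 else 0)))
     - H x $ a $ d * (H x $ c $ e * (- raise H x (hess x b) e + dv x b * dvu x e - sqnorm x / 2 * (if e = b then 1 else 0))))"
    unfolding riemann_low_def riemann_conf[OF x] G_eq[OF x] sum_distrib_left
    by (intro sum.cong refl) (simp add: algebra_simps)
  then show ?thesis
    by (simp only: sum.distrib sum_subtractf sum_distrib_left[symmetric] sum_delta_mult Su)
       (simp add: riemann_low_def kulkarni_def H.G_commute[OF x, of d] algebra_simps)
qed

lemma ricci_conf:
  assumes x: "x \<in> S"
  shows "ricci G x b d = ricci H x b d + (real CARD('n) - 2) * schouten_shift x b d
    + contract H x (schouten_shift x) * H x $ b $ d"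
proof -
  have "ricci G x b d = exp (- 2 * v x) * (exp (2 * v x) *
      contract H x (\<lambda>a c. riemann_low H x a b c d + kulkarni H x (schouten_shift x) a b c d))"
    unfolding G.contract_riemann_low[OF x, symmetric] contract_conf[OF x] riemann_low_conf[OF x] contract_mult
    by (rule mult.left_commute)
  also have "\<dots> = contract H x (\<lambda>a c. riemann_low H x a b c d + kulkarni H x (schouten_shift x) a b c d)"
    by (simp add: mult.assoc[symmetric] exp_add[symmetric])
  finally show ?thesis
    by (simp add: contract_add H.contract_riemann_low[OF x] H.contract_kulkarni[OF x] H.G_commute[OF x, of d b])
qed

lemma scal_conf:
  assumes x: "x \<in> S"
  shows "exp (2 * v x) * scal G x = scal H x + 2 * (real CARD('n) - 1) * contract H x (schouten_shift x)"
proof -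
  have e: "exp (2 * v x) * exp (- 2 * v x) = 1" by (simp add: exp_add[symmetric])
  have "ricci G x = (\<lambda>b d. ricci H x b d + (real CARD('n) - 2) * schouten_shift x b d
    + contract H x (schouten_shift x) * H x $ b $ d)"
    by (intro ext) (rule ricci_conf[OF x])
  then have "contract H x (ricci G x) = scal H x + 2 * (real CARD('n) - 1) * contract H x (schouten_shift x)"
    using H.contract_ricci[of x]
    by (simp add: contract_add contract_mult H.contract_G_G[OF x]) (simp add: algebra_simps)
  with e show ?thesis
    unfolding G.contract_ricci[symmetric] contract_conf[OF x, of "ricci G x"] mult.assoc[symmetric] by simp
qed

lemma schouten_conf:
  assumes n: "CARD('n) \<ge> 3" and x: "x \<in> S"
  shows "schouten G x a b = schouten H x a b + schouten_shift x a b"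
proof -
  define r s where "r = real CARD('n)" and "s = contract H x (schouten_shift x)"
  have r: "r - 1 \<noteq> 0" "r - 2 \<noteq> 0" using n unfolding r_def by linarith+
  have "scal G x / (2 * (r - 1)) * G x $ a $ b = (scal H x + 2 * (r - 1) * s) / (2 * (r - 1)) * H x $ a $ b"
    unfolding scal_conf[OF x, folded r_def s_def, symmetric] G_eq[OF x] by simp
  also have "\<dots> = scal H x / (2 * (r - 1)) * H x $ a $ b + s * H x $ a $ b"
    using r by (simp add: field_simps)
  finally have "ricci G x a b - scal G x / (2 * (r - 1)) * G x $ a $ b
      = (ricci H x a b - scal H x / (2 * (r - 1)) * H x $ a $ b) + (r - 2) * schouten_shift x a b"
    unfolding ricci_conf[OF x] r_def[symmetric] s_def[symmetric] by simp
  with r show ?thesis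
    unfolding schouten_def r_def[symmetric] by (simp only: distrib_left) simp
qed

text \<open>By \<open>riemann_low_conf\<close> and \<open>schouten_conf\<close> the change of the Riemann tensor is absorbed entirely by
  the Schouten tensor.\<close>

lemma weyl_conf:
  assumes n: "CARD('n) \<ge> 3" and x: "x \<in> S"
  shows "weyl G x a b c d = exp (2 * v x) * weyl H x a b c d"
  by (simp add: G.weyl_eq H.weyl_eq kulkarni_def riemann_low_conf[OF x] schouten_conf[OF n x] G_eq[OF x] algebra_simps)

end

section \<open>Conformal change of the Cotton and Bach tensors\<close>

lemma contract_double_raise:
  "(\<Sum>d\<in>UNIV. \<Sum>c\<in>UNIV. schouten_up G x d c * T d c)
    = contract G x (\<lambda>d e. contract G x (\<lambda>c f. schouten G x e f * T d c))"
proof -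
  have "(\<Sum>c\<in>UNIV. schouten_up G x d c * T d c) = (\<Sum>e\<in>UNIV. ginv G x d e * contract G x (\<lambda>c f. schouten G x e f * T d c))" for d
    unfolding schouten_up_def contract_def sum_distrib_left sum_distrib_right
    by (rule trans[OF sum.swap]) (simp add: mult_ac)
  then show ?thesis by (simp add: contract_def[of G x "\<lambda>d e. contract G x _"] contract_def[of G x "\<lambda>d e. contract G x (\<lambda>c f. schouten G x e f * T d c)"])
qed

lemma bach_eq: "bach G x a b = contract G x (\<lambda>c e. cov3 G (cotton G) x e a c b)
   + contract G x (\<lambda>d e. contract G x (\<lambda>c f. schouten G x e f * weyl G x d a c b))"
  unfolding bach_def contract_double_raise[symmetric] contract_def[of G x "\<lambda>c e. cov3 G (cotton G) x e a c b"] ..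

context conformal_metrics begin

lemma partial_sqnorm:
  assumes x: "x \<in> S"
  shows "partial a sqnorm x = 2 * (\<Sum>d\<in>UNIV. dvu x d * hess x a d)"
proof -
  have "sqnorm y = contract H y (\<lambda>a b. dv y a * dv y b)" if "y \<in> S" for y
    unfolding H.contract_product_left[OF that] by (simp add: sqnorm_def dvu_def)
  then have "partial a sqnorm x = partial a (\<lambda>y. contract H y (\<lambda>a b. dv y a * dv y b)) x"
    by (rule partial_cong_open[OF H.open_S x])
  also have "\<dots> = contract H x (cov2 H (\<lambda>y a b. dv y a * dv y b) x a)"
    by (rule H.partial_contract[OF x]) (simp add: differentiable_mult differentiable_dv x)
  also have "cov2 H (\<lambda>y a b. dv y a * dv y b) x a = (\<lambda>b c. hess x a b * dv x c + dv x b * hess x a c)"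
    by (intro ext) (simp add: cov2_def hess_def cov1_def partial_mult differentiable_dv x algebra_simps sum_distrib_left)
  also have "contract H x \<dots> = 2 * (\<Sum>d\<in>UNIV. dvu x d * hess x a d)"
    using contract_product[of H x "hess x a" "dv x"] H.contract_product_left[OF x, of "dv x" "hess x a"]
    by (simp add: contract_add dvu_def mult.commute)
  finally show ?thesis .
qed

text \<open>In the expanded second derivative, the terms with derivatives of \<open>dv\<close> are symmetric in \<open>b\<close> and \<open>c\<close>; the
  others are those of \<open>riemann_eq\<close>.\<close>

lemma hess_ricci_identity:
  assumes x: "x \<in> S"
  shows "cov2 H hess x b c a - cov2 H hess x c b a = - (\<Sum>d\<in>UNIV. riemann H x b c d a * dv x d)"
proof -
  define \<Gamma> where "\<Gamma> = christoffel H x"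
  have dd: "partial a (\<lambda>y. dv y b) differentiable (at x)" for a b
    using smooth_on_differentiable[OF smooth_on_partial[OF smooth_dv(1)] x] .
  have 1: "cov2 H hess x b c a = partial b (partial c (\<lambda>y. dv y a)) x
     - (\<Sum>e\<in>UNIV. partial b (\<lambda>y. christoffel H y e c a) x * dv x e)
     - (\<Sum>e\<in>UNIV. \<Gamma> e c a * partial b (\<lambda>y. dv y e) x)
     - (\<Sum>e\<in>UNIV. \<Gamma> e b c * hess x e a)
     - (\<Sum>e\<in>UNIV. \<Gamma> e b a * partial c (\<lambda>y. dv y e) x)
     + (\<Sum>d\<in>UNIV. (\<Sum>e\<in>UNIV. \<Gamma> d c e * \<Gamma> e b a) * dv x d)" for b c
  proof -
    have "(\<Sum>e\<in>UNIV. \<Gamma> e b a * hess x c e) = (\<Sum>e\<in>UNIV. \<Gamma> e b a * partial c (\<lambda>y. dv y e) x)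
      - (\<Sum>e\<in>UNIV. \<Gamma> e b a * (\<Sum>d\<in>UNIV. \<Gamma> d c e * dv x d))"
      by (simp add: hess_def cov1_def \<Gamma>_def algebra_simps sum_subtractf)
    also have "(\<Sum>e\<in>UNIV. \<Gamma> e b a * (\<Sum>d\<in>UNIV. \<Gamma> d c e * dv x d)) = (\<Sum>d\<in>UNIV. (\<Sum>e\<in>UNIV. \<Gamma> d c e * \<Gamma> e b a) * dv x d)"
      unfolding sum_distrib_left sum_distrib_right by (rule trans[OF sum.swap]) (simp add: mult_ac)
    finally have 2: "(\<Sum>e\<in>UNIV. \<Gamma> e b a * hess x c e) = (\<Sum>e\<in>UNIV. \<Gamma> e b a * partial c (\<lambda>y. dv y e) x)
      - (\<Sum>d\<in>UNIV. (\<Sum>e\<in>UNIV. \<Gamma> d c e * \<Gamma> e b a) * dv x d)" .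
    have "partial b (\<lambda>y. hess y c a) x = partial b (partial c (\<lambda>y. dv y a)) x
     - (\<Sum>e\<in>UNIV. partial b (\<lambda>y. christoffel H y e c a) x * dv x e + \<Gamma> e c a * partial b (\<lambda>y. dv y e) x)"
      unfolding hess_def cov1_def \<Gamma>_def
      by (simp add: partial_diff partial_sum partial_mult dd differentiable_dv H.differentiable_christoffel x differentiable_mult differentiable_sum)
    with 2 show ?thesis
      by (simp add: cov2_def \<Gamma>_def[symmetric] sum.distrib)
  qed
  show ?thesis
    unfolding 1 H.riemann_eq[OF x] \<Gamma>_def[symmetric]
    using partial_commute[OF H.open_S x smooth_dv(1)[of a], of b c] H.christoffel_commute[OF x, folded \<Gamma>_def, of _ b c]
    by (simp add: algebra_simps sum.distrib sum_subtractf)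
qed

text \<open>The metric is covariantly constant, so only \<open>\<nabla>\<^sub>a v\<^sub>b\<close>, \<open>v\<^sub>a v\<^sub>b\<close> and the function \<open>v\<^sub>c v\<^sup>c\<close> are differentiated.\<close>

lemma cov2_schouten_shift:
  assumes x: "x \<in> S"
  shows "cov2 H schouten_shift x e a b = - cov2 H hess x e a b + hess x e a * dv x b + dv x a * hess x e b
    - (\<Sum>d\<in>UNIV. dvu x d * hess x e d) * H x $ a $ b"
proof -
  have "cov2 H schouten_shift x e a b = - cov2 H hess x e a b + cov2 H (\<lambda>y a b. dv y a * dv y b) x e a b
      - cov2 H (\<lambda>y a b. (sqnorm y / 2) * H y $ a $ b) x e a b"
    unfolding cov2_def schouten_shift_def
    by (simp add: partial_add partial_diff partial_minus differentiable_dv x H.differentiable_G differentiable_mult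
        differentiable_divide differentiable_add differentiable_diff differentiable_minus algebra_simps sum.distrib sum_subtractf)
  moreover have "cov2 H (\<lambda>y a b. dv y a * dv y b) x e a b = hess x e a * dv x b + dv x a * hess x e b"
    by (simp add: cov2_def hess_def cov1_def partial_mult differentiable_dv x algebra_simps sum_distrib_left)
  moreover have "cov2 H (\<lambda>y a b. (sqnorm y / 2) * H y $ a $ b) x e a b = (\<Sum>d\<in>UNIV. dvu x d * hess x e d) * H x $ a $ b"
    by (subst H.cov2_scale_G) (simp_all add: x differentiable_dv differentiable_divide partial_divide_const partial_sqnorm)
  ultimately show ?thesis by simp
qed

lemma schouten_shift_commute: "x \<in> S \<Longrightarrow> schouten_shift x a b = schouten_shift x b a"
  by (simp add: schouten_shift_def hess_commute[of x a b] H.G_commute[of x a b] mult.commute)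

lemma dvu_lower_sum: "x \<in> S \<Longrightarrow> (\<Sum>d\<in>UNIV. riemann H x b c d a * dv x d) = (\<Sum>d\<in>UNIV. riemann_low H x b c d a * dvu x d)"
proof -
  assume x: "x \<in> S"
  show ?thesis
    unfolding H_dvu[OF x, symmetric] riemann_low_def sum_distrib_left sum_distrib_right
    by (rule trans[OF sum.swap]) (intro sum.cong refl, simp add: H.G_commute[OF x] mult_ac)
qed

text \<open>Antisymmetrizing the third derivatives of \<open>v\<close> in the derivative of \<open>schouten_shift\<close> produces
  the Riemann tensor applied to \<open>v\<^sup>d\<close>. The change of connection applied to the Schouten tensor of \<open>H\<close>
  supplies the Schouten terms that turn it into the Weyl tensor. What remains is the change of
  connection applied to \<open>schouten_shift\<close>, and it cancels the products of first and second
  derivatives of \<open>v\<close>.\<close>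

theorem cotton_conf:
  assumes n: "CARD('n) \<ge> 3" and x: "x \<in> S"
  shows "cotton G x a b c = cotton H x a b c + (\<Sum>d\<in>UNIV. weyl H x c b a d * dvu x d)"
proof -
  define P where "P = schouten H x"
  define Pv where "Pv a = (\<Sum>d\<in>UNIV. P a d * dvu x d)" for a
  define Hv where "Hv a = (\<Sum>d\<in>UNIV. dvu x d * hess x a d)" for a
  define Rv where "Rv = (\<Sum>d\<in>UNIV. riemann_low H x b c d a * dvu x d)"
  have P: "P a b = P b a" for a b unfolding P_def by (rule H.schouten_commute[OF x])
  have 1: "cov2 G (schouten G) x b c a = cov2 H (schouten H) x b c a + cov2 H schouten_shift x b c a
      - 2 * dv x b * (P c a + schouten_shift x c a) - dv x c * (P b a + schouten_shift x b a) - dv x a * (P c b + schouten_shift x c b)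
      + H x $ b $ c * (\<Sum>e\<in>UNIV. dvu x e * (P e a + schouten_shift x e a))
      + H x $ b $ a * (\<Sum>e\<in>UNIV. dvu x e * (P c e + schouten_shift x c e))" for b c
  proof -
    have "cov2 G (schouten G) x b c a = cov2 G (\<lambda>y a b. 1 * schouten H y a b + schouten_shift y a b) x b c a"
      by (rule G.cov2_cong[OF _ x]) (simp add: schouten_conf[OF n])
    also have "\<dots> = cov2 G (schouten H) x b c a + cov2 G schouten_shift x b c a"
      by (subst G.cov2_lincomb) (simp_all add: H.differentiable_curvature differentiable_dv x)
    finally show ?thesis
      unfolding cov2_conf[OF x] P_def by (simp add: algebra_simps sum.distrib)
  qed
  have 2: "(\<Sum>e\<in>UNIV. dvu x e * (P c e + schouten_shift x c e)) = Pv c - Hv c + sqnorm x / 2 * dv x c" for c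
  proof -
    have "(\<Sum>e\<in>UNIV. dvu x e * (P c e + schouten_shift x c e)) =
      (\<Sum>e\<in>UNIV. P c e * dvu x e - dvu x e * hess x c e + dv x c * (dvu x e * dv x e) - sqnorm x / 2 * (H x $ c $ e * dvu x e))"
      by (intro sum.cong refl) (simp add: schouten_shift_def algebra_simps)
    then show ?thesis
      by (simp only: sum.distrib sum_subtractf sum_distrib_left[symmetric] Pv_def Hv_def H_dvu[OF x] sqnorm_def[symmetric])
        (simp add: field_simps)
  qed
  have 3: "(\<Sum>d\<in>UNIV. weyl H x c b a d * dvu x d) = Rv - H x $ a $ c * Pv b + H x $ a $ b * Pv c - dv x b * P c a + dv x c * P b a"
  proof -
    have "(\<Sum>d\<in>UNIV. weyl H x c b a d * dvu x d) = (\<Sum>d\<in>UNIV. riemann_low H x b c d a * dvu x d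
       - H x $ a $ c * (P b d * dvu x d) + H x $ a $ b * (P c d * dvu x d)
       - P c a * (H x $ b $ d * dvu x d) + P b a * (H x $ c $ d * dvu x d))"
      using H.riemann_low_skew12[of x c b a] H.riemann_low_skew34[OF x, of b c a]
      by (intro sum.cong refl) (simp add: H.weyl_eq kulkarni_def P_def H.G_commute[OF x] algebra_simps)
    then show ?thesis
      by (simp only: sum.distrib sum_subtractf sum_distrib_left[symmetric] Pv_def H_dvu[OF x] Rv_def) (simp add: mult.commute)
  qed
  have 4: "cov2 H hess x b c a = cov2 H hess x c b a - Rv"
    using hess_ricci_identity[OF x, of b c a] unfolding dvu_lower_sum[OF x] Rv_def by simp
  show ?thesis
    unfolding G.cotton_eq H.cotton_eq 1 2 3 cov2_schouten_shift[OF x] Hv_def[symmetric] 4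
    using P[of b c] schouten_shift_commute[OF x, of b c] H.G_commute[OF x, of b c] hess_commute[OF x, of b c] H.G_commute[OF x, of a]
    by (simp add: schouten_shift_def algebra_simps)
qed


text \<open>The coefficient \<open>n - 4\<close> collects the dimension, from the trace of the metric, \<open>- 3\<close> from the
  conformal weights of the three indices, and \<open>- 1\<close> from exchanging the derivative index with the
  contracted one.\<close>

lemma divergence_conf:
  assumes x: "x \<in> S" and tr: "\<And>b. contract H x (\<lambda>c e. T x e c b) = 0" and skew: "\<And>a b c. T x a b c = - T x a c b"
  shows "contract H x (\<lambda>c e. cov3 G T x e a c b) = contract H x (\<lambda>c e. cov3 H T x e a c b)
    + (real CARD('n) - 4) * (\<Sum>c\<in>UNIV. dvu x c * T x a c b)
    + (\<Sum>c\<in>UNIV. dvu x c * T x c a b) + (\<Sum>c\<in>UNIV. dvu x c * T x a b c)"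
proof -
  have d1: "contract H x (\<lambda>c e. dv x e * T c) = (\<Sum>c\<in>UNIV. dvu x c * T c)" for T
    using contract_product[of H x T "dv x"] by (simp add: dvu_def mult.commute)
  have d2: "contract H x (\<lambda>c e. dv x c * T e) = (\<Sum>c\<in>UNIV. dvu x c * T c)" for T
    using H.contract_product_left[OF x, of "dv x" T] by (simp add: dvu_def mult.commute)
  have "contract H x (\<lambda>c e. T x a c e) = contract H x (\<lambda>c e. T x a e c)"
    using H.contract_transpose[OF x, of "\<lambda>c e. T x a e c"] by simp
  also have "\<dots> = - contract H x (\<lambda>c e. T x a c e)"
    by (subst skew) (simp only: contract_uminus)
  finally have tr2: "contract H x (\<lambda>c e. T x a c e) = 0" by simp
  have "contract H x (\<lambda>c e. cov3 G T x e a c b) =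
      contract H x (\<lambda>c e. cov3 H T x e a c b) - 3 * contract H x (\<lambda>c e. dv x e * T x a c b)
      - dv x a * contract H x (\<lambda>c e. T x e c b) - contract H x (\<lambda>c e. dv x c * T x a e b)
      - dv x b * contract H x (\<lambda>c e. T x a c e)
      + contract H x (\<lambda>c e. H x $ e $ a * (\<Sum>d\<in>UNIV. dvu x d * T x d c b))
      + contract H x (\<lambda>c e. H x $ e $ c) * (\<Sum>d\<in>UNIV. dvu x d * T x a d b)
      + contract H x (\<lambda>c e. H x $ e $ b * (\<Sum>d\<in>UNIV. dvu x d * T x a c d))"
    unfolding cov3_conf[OF x]
    by (simp only: contract_add contract_diff contract_mult[symmetric] contract_mult_right[symmetric] mult.assoc)
  then show ?thesis
    by (simp only: tr tr2 H.contract_G[OF x] H.contract_G_G[OF x] d1 d2) (simp add: algebra_simps)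
qed

lemma cov3_sum_weyl:
  assumes x: "x \<in> S"
  shows "cov3 H (\<lambda>y a c b. \<Sum>d\<in>UNIV. weyl H y b c a d * dvu y d) x e a c b
    = (\<Sum>d\<in>UNIV. cov4 H (weyl H) x e b c a d * dvu x d) + (\<Sum>d\<in>UNIV. weyl H x b c a d * raise H x (hess x e) d)"
proof -
  have 1: "(\<Sum>d\<in>UNIV. weyl H x b c a d * (\<Sum>f\<in>UNIV. christoffel H x d e f * dvu x f))
     = (\<Sum>d\<in>UNIV. (\<Sum>f\<in>UNIV. christoffel H x f e d * weyl H x b c a f) * dvu x d)"
    unfolding sum_distrib_left sum_distrib_right by (rule trans[OF sum.swap]) (simp add: mult_ac)
  have 2: "(\<Sum>f\<in>UNIV. christoffel H x f e i * (\<Sum>d\<in>UNIV. W f d * dvu x d))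
     = (\<Sum>d\<in>UNIV. (\<Sum>f\<in>UNIV. christoffel H x f e i * W f d) * dvu x d)" for i W
    unfolding sum_distrib_left sum_distrib_right by (rule trans[OF sum.swap]) (simp add: mult_ac)
  have 3: "partial e (\<lambda>y. \<Sum>d\<in>UNIV. weyl H y b c a d * dvu y d) x
     = (\<Sum>d\<in>UNIV. partial e (\<lambda>y. weyl H y b c a d) x * dvu x d) + (\<Sum>d\<in>UNIV. weyl H x b c a d * partial e (\<lambda>y. dvu y d) x)"
    by (simp add: partial_sum partial_mult H.differentiable_curvature differentiable_dv x differentiable_mult sum.distrib)
  show ?thesis
    unfolding cov3_def cov4_def cov_dvu[OF x, symmetric] 2 3 distrib_left sum.distrib 1
    by (simp add: algebra_simps sum.distrib sum_subtractf)
qed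

text \<open>The Cotton tensor of \<open>G\<close> is that of \<open>H\<close> plus \<open>E\<^sub>a\<^sub>c\<^sub>b = C\<^sub>b\<^sub>c\<^sub>a\<^sub>d v\<^sup>d\<close>. The divergence of \<open>E\<close> consists of a
  multiple of the Cotton tensor, by \<open>div_weyl\<close>, and of the Weyl tensor contracted with \<open>\<nabla>\<^sub>c v\<^sub>d\<close>. The latter
  is cancelled by the corresponding part of \<open>schouten_shift\<close> in the term with the Schouten tensor,
  where the part with the metric drops out because the Weyl tensor is trace-free. The cyclic
  identity of the Cotton tensor brings the remaining terms into the stated form, with \<open>(n - 3) - 1\<close>
  as the coefficient of \<open>A'\<^sub>b\<^sub>c\<^sub>a\<close>.\<close>

theorem bach_conf:
  assumes n: "CARD('n) \<ge> 3" and x: "x \<in> S"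
  shows "bach G x a b = exp (- 2 * v x) * (bach H x a b + (real CARD('n) - 4) *
    ((\<Sum>c\<in>UNIV. dvu x c * (cotton H x a c b + cotton H x b c a))
     + (\<Sum>c\<in>UNIV. \<Sum>d\<in>UNIV. weyl H x a c b d * dvu x c * dvu x d)))"
proof -
  define E where "E y a c b = (\<Sum>d\<in>UNIV. weyl H y b c a d * dvu y d)" for y a c b
  define C where "C = weyl H x"
  define u where "u = dvu x"
  define \<Phi> where "\<Phi> a b = (\<Sum>c\<in>UNIV. \<Sum>d\<in>UNIV. C a c b d * u c * u d)" for a b
  define A where "A = cotton H x"
  have pair: "C a b c d = C c d a b" and skew: "C a b c d = - C b a c d" and skew': "C a b c d = - C a b d c" for a b c d
    unfolding C_def using H.weyl_pair[OF x] H.weyl_skew12 H.weyl_skew34[OF x] by blast+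
  \<comment> \<open>Moves the index \<open>c\<close> between the two index positions in which \<open>bach\<close> and \<open>E\<close> have it.\<close>
  have flip: "C d a c b = C b c a d" for a b c d
    using pair[of d a c b] skew[of c b d a] skew'[of b c d a] by simp
  have \<Phi>_swap: "\<Phi> a b = \<Phi> b a"
    unfolding \<Phi>_def by (rule trans[OF sum.swap]) (intro sum.cong refl, subst pair, simp add: mult_ac)
  have cottonG: "cotton G y a b c = cotton H y a b c + E y a b c" if "y \<in> S" for y a b c
    using cotton_conf[OF n that] by (simp add: E_def)
  have dE: "(\<lambda>y. E y a b c) differentiable (at x)" for a b c
    unfolding E_def by (intro differentiable_sum ballI differentiable_mult H.differentiable_curvature(6)[OF x] differentiable_dv(3)[OF x]) simp
  have u_E1: "(\<Sum>c\<in>UNIV. u c * E x a c b) = \<Phi> a b"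
    unfolding \<Phi>_swap unfolding E_def C_def[symmetric] u_def[symmetric] \<Phi>_def sum_distrib_left by (simp add: mult_ac)
  have u_E2: "(\<Sum>d\<in>UNIV. u d * E x a b d) = - \<Phi> a b"
    unfolding \<Phi>_swap unfolding E_def C_def[symmetric] u_def[symmetric] \<Phi>_def sum_distrib_left
    by (subst skew) (simp add: mult_ac sum_negf)
  have u_E3: "(\<Sum>d\<in>UNIV. u d * E x d a b) = 0"
  proof -
    have "(\<Sum>d\<in>UNIV. u d * E x d a b) = (\<Sum>d\<in>UNIV. \<Sum>f\<in>UNIV. C b a d f * (u d * u f))"
      unfolding E_def C_def[symmetric] u_def[symmetric] sum_distrib_left by (simp add: mult_ac)
    moreover have "\<dots> = (\<Sum>d\<in>UNIV. \<Sum>f\<in>UNIV. - (C b a d f * (u d * u f)))"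
      by (rule trans[OF sum.swap], subst skew') (simp add: mult_ac)
    ultimately show ?thesis unfolding sum_negf by linarith
  qed
  have tr0: "contract H x (\<lambda>c e. cotton G x e c b) = 0" for b
  proof -
    have "contract H x (\<lambda>c e. cotton G x e c b) = contract H x (\<lambda>e c. cotton G x e c b)"
      using H.contract_transpose[OF x, of "\<lambda>e c. cotton G x e c b"] .
    then show ?thesis
      using G.cotton_trace[OF n x, of b] unfolding contract_conf[OF x] by simp
  qed
  have div_sum: "contract H x (\<lambda>c e. cov3 H (cotton G) x e a c b)
     = contract H x (\<lambda>c e. cov3 H (cotton H) x e a c b) + contract H x (\<lambda>c e. cov3 H E x e a c b)"
  proof -
    have "cov3 H (cotton G) x e a c b = cov3 H (cotton H) x e a c b + cov3 H E x e a c b" for e c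
    proof -
      have "cov3 H (cotton G) x e a c b = cov3 H (\<lambda>y a b c. cotton H y a b c + E y a b c) x e a c b"
        by (rule H.cov3_cong[OF cottonG x])
      then show ?thesis
        by (simp add: cov3_def partial_add dE H.differentiable_curvature x algebra_simps sum.distrib)
    qed
    then show ?thesis by (simp add: contract_add)
  qed
  have div_E: "contract H x (\<lambda>c e. cov3 H E x e a c b)
     = (real CARD('n) - 3) * (\<Sum>d\<in>UNIV. u d * A b d a)
      + contract H x (\<lambda>c e. contract H x (\<lambda>d f. C b c a d * hess x e f))"
  proof -
    have "cov4 H (weyl H) x e b c a d = cov4 H (weyl H) x e d a c b" for e c d
    proof -
      have "cov4 H (weyl H) x e b c a d = cov4 H (\<lambda>y a b c d. weyl H y d c b a) x e b c a d"
      proof (rule H.cov4_cong[OF _ x])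
        show "weyl H y a b c d = weyl H y d c b a" if "y \<in> S" for y a b c d
          using H.weyl_pair[OF that, of a b c d] H.weyl_skew12[of y c d a b] H.weyl_skew34[OF that, of d c a b] by simp
      qed
      also have "\<dots> = cov4 H (weyl H) x e d a c b"
        by (rule H.cov4_permute_indices(2))
      finally show ?thesis .
    qed
    moreover have "contract H x (\<lambda>c e. cov4 H (weyl H) x e d a c b) = (real CARD('n) - 3) * A b d a" for d
      using H.div_weyl[OF n x, of d a b] H.contract_transpose[OF x, of "\<lambda>f c. cov4 H (weyl H) x f d a c b"]
      by (simp add: A_def)
    ultimately have 1: "contract H x (\<lambda>c e. \<Sum>d\<in>UNIV. cov4 H (weyl H) x e b c a d * dvu x d)
       = (real CARD('n) - 3) * (\<Sum>d\<in>UNIV. u d * A b d a)"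
      by (simp add: contract_sum contract_mult_right u_def sum_distrib_left) (simp add: mult_ac)
    have 2: "contract H x (\<lambda>c e. \<Sum>d\<in>UNIV. weyl H x b c a d * raise H x (hess x e) d)
       = contract H x (\<lambda>c e. contract H x (\<lambda>d f. C b c a d * hess x e f))"
      by (simp only: contract_product C_def)
    show ?thesis
      unfolding E_def cov3_sum_weyl[OF x] contract_add 1 2 ..
  qed
  have hess_swap: "contract H x (\<lambda>d e. contract H x (\<lambda>c f. hess x e f * C d a c b))
     = contract H x (\<lambda>c e. contract H x (\<lambda>d f. C b c a d * hess x e f))"
  proof -
    have "hess x e f * C d a c b = C b c a d * hess x f e" for c d e f
      using flip[of d a c b] hess_commute[OF x, of e f] by simp
    then show ?thesis
      unfolding contract_contract[of H x "\<lambda>d e c f. hess x e f * C d a c b"] by simp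
  qed
  have dvdv: "contract H x (\<lambda>d e. contract H x (\<lambda>c f. (dv x e * dv x f) * C d a c b)) = \<Phi> a b"
  proof -
    have "contract H x (\<lambda>c f. (dv x e * dv x f) * C d a c b) = dv x e * (\<Sum>c\<in>UNIV. C d a c b * u c)" for d e
      using contract_mult[of H x "dv x e" "\<lambda>c f. C d a c b * dv x f"]
        contract_product[of H x "\<lambda>c. C d a c b" "dv x"]
      by (simp add: u_def dvu_def mult_ac)
    then have "contract H x (\<lambda>d e. contract H x (\<lambda>c f. (dv x e * dv x f) * C d a c b))
      = (\<Sum>d\<in>UNIV. (\<Sum>c\<in>UNIV. C d a c b * u c) * u d)"
      using contract_product[of H x "\<lambda>d. (\<Sum>c\<in>UNIV. C d a c b * u c)" "dv x"]
      by (simp add: u_def dvu_def mult.commute)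
    also have "\<dots> = \<Phi> b a"
      unfolding \<Phi>_def sum_distrib_right
      by (rule trans[OF sum.swap]) (intro sum.cong refl, subst flip, rule refl)
    finally show ?thesis by (simp add: \<Phi>_swap)
  qed
  have metric: "contract H x (\<lambda>d e. contract H x (\<lambda>c f. H x $ e $ f * C d a c b)) = 0"
    unfolding H.contract_G[OF x] C_def by (rule H.weyl_trace[OF n x])
  have PC: "contract G x (\<lambda>d e. contract G x (\<lambda>c f. schouten G x e f * weyl G x d a c b))
     = exp (- 2 * v x) * (contract H x (\<lambda>d e. contract H x (\<lambda>c f. schouten H x e f * C d a c b))
        - contract H x (\<lambda>c e. contract H x (\<lambda>d f. C b c a d * hess x e f)) + \<Phi> a b)"
  proof -
    \<comment> \<open>Naming the product keeps \<open>contract_mult\<close> from splitting it over the two contractions.\<close>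
    define dd where "dd e f = dv x e * dv x f" for e f
    have pt: "(schouten H x e f + schouten_shift x e f) * (exp (2 * v x) * C d a c b) =
        exp (2 * v x) * (schouten H x e f * C d a c b - hess x e f * C d a c b + dd e f * C d a c b
          - sqnorm x / 2 * (H x $ e $ f * C d a c b))" for d e f c
      by (simp add: schouten_shift_def dd_def algebra_simps)
    have "contract G x (\<lambda>d e. contract G x (\<lambda>c f. schouten G x e f * weyl G x d a c b))
      = exp (- 2 * v x) * (exp (- 2 * v x) *
         contract H x (\<lambda>d e. contract H x (\<lambda>c f. (schouten H x e f + schouten_shift x e f) * (exp (2 * v x) * C d a c b))))"
      by (simp only: contract_conf[OF x] weyl_conf[OF n x] schouten_conf[OF n x] C_def[symmetric] contract_mult)
    also have "\<dots> = (exp (- 2 * v x) * (exp (- 2 * v x) * exp (2 * v x))) *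
       (contract H x (\<lambda>d e. contract H x (\<lambda>c f. schouten H x e f * C d a c b))
        - contract H x (\<lambda>d e. contract H x (\<lambda>c f. hess x e f * C d a c b))
        + contract H x (\<lambda>d e. contract H x (\<lambda>c f. dd e f * C d a c b))
        - sqnorm x / 2 * contract H x (\<lambda>d e. contract H x (\<lambda>c f. H x $ e $ f * C d a c b)))"
      by (simp only: pt contract_mult contract_add contract_diff mult.assoc)
    also have "exp (- 2 * v x) * exp (2 * v x) = 1" by (simp add: exp_add[symmetric])
    finally show ?thesis
      unfolding hess_swap metric dd_def dvdv by simp
  qed
  have "contract G x (\<lambda>c e. cov3 G (cotton G) x e a c b) = exp (- 2 * v x) *
     (contract H x (\<lambda>c e. cov3 H (cotton G) x e a c b) + (real CARD('n) - 4) * (\<Sum>c\<in>UNIV. u c * cotton G x a c b)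
    + (\<Sum>c\<in>UNIV. u c * cotton G x c a b) + (\<Sum>c\<in>UNIV. u c * cotton G x a b c))"
    unfolding contract_conf[OF x] u_def by (subst divergence_conf[where T = "cotton G", OF x tr0 G.cotton_skew]) (rule refl)
  also have "\<dots> = exp (- 2 * v x) *
     (contract H x (\<lambda>c e. cov3 H (cotton H) x e a c b)
      + (real CARD('n) - 3) * (\<Sum>d\<in>UNIV. u d * A b d a)
      + contract H x (\<lambda>c e. contract H x (\<lambda>d f. C b c a d * hess x e f))
      + (real CARD('n) - 4) * ((\<Sum>c\<in>UNIV. u c * A a c b) + \<Phi> a b)
      + (\<Sum>c\<in>UNIV. u c * (A c a b + A a b c)) - \<Phi> a b)"
    unfolding div_sum div_E cottonG[OF x] distrib_left sum.distrib A_def[symmetric] u_E1 u_E2 u_E3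
    by (simp add: distrib_left sum.distrib algebra_simps)
  also have "(\<Sum>c\<in>UNIV. u c * (A c a b + A a b c)) = - (\<Sum>c\<in>UNIV. u c * A b c a)"
  proof -
    have "A c a b + A a b c = - A b c a" for c
      using H.cotton_cyclic[OF x, of c a b] by (simp add: A_def)
    then show ?thesis by (simp add: sum_negf)
  qed
  finally show ?thesis
    unfolding bach_eq PC A_def[symmetric] C_def[symmetric] u_def[symmetric] \<Phi>_def[symmetric]
    by (simp add: distrib_left sum.distrib) (simp add: algebra_simps)
qed

end

section \<open>Pure radiation metrics with parallel rays\<close>

text \<open>The functions \<open>\<phi>\<close> and \<open>f\<^sub>a\<close> of a pure radiation metric are given only through products with components
  of \<open>K\<close>. Dividing by a component that is nonzero near the point shows that they are
  differentiable.\<close>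

lemma differentiable_cofactor:
  fixes p q r :: "real^'n::finite \<Rightarrow> real"
  assumes S: "open S" "x \<in> S" and p: "p differentiable (at x)" and q: "smooth_on S q" and "q x \<noteq> 0"
    and eq: "\<And>y. y \<in> S \<Longrightarrow> p y = r y * q y"
  shows "r differentiable (at x)"
proof -
  define U where "U = S \<inter> q -` (- {0})"
  have "continuous_on S q" using q unfolding smooth_on_def by (metis Ck_on.simps(1))
  then have U: "open U" "x \<in> U"
    unfolding U_def using S \<open>q x \<noteq> 0\<close> by (auto intro: continuous_open_preimage)
  have "(\<lambda>y. p y / q y) differentiable (at x)"
    using p smooth_on_differentiable[OF q S(2)] \<open>q x \<noteq> 0\<close> by (rule differentiable_divide)
  then obtain D where "((\<lambda>y. p y / q y) has_derivative D) (at x)"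
    unfolding differentiable_def by blast
  then have "(r has_derivative D) (at x)"
    by (rule has_derivative_transform_within_open[OF _ U]) (auto simp: U_def eq)
  then show ?thesis unfolding differentiable_def by blast
qed

locale pure_radiation_chart = metric_chart S G
  for S :: "(real^'n::finite) set" and G :: "'n metric_comps" +
  fixes K :: "real^'n \<Rightarrow> real^'n" and \<phi> :: "real^'n \<Rightarrow> real" and f :: "real^'n \<Rightarrow> 'n \<Rightarrow> real"
  assumes dim: "CARD('n) \<ge> 3"
    and smooth_K: "\<And>k. smooth_on S (\<lambda>y. K y $ k)"
    and K_nonzero: "\<And>x. x \<in> S \<Longrightarrow> K x \<noteq> 0"
    and K_null: "\<And>x. x \<in> S \<Longrightarrow> (\<Sum>a\<in>UNIV. lower G x (K x) a * K x $ a) = 0"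
    and ricci_K: "\<And>x a b. x \<in> S \<Longrightarrow> ricci G x a b = \<phi> x * lower G x (K x) a * lower G x (K x) b"
    and cov_K: "\<And>x a b. x \<in> S \<Longrightarrow> cov_vec G K x a b = f x a * K x $ b"
begin

definition k :: "real^'n \<Rightarrow> 'n \<Rightarrow> real" where "k x = lower G x (K x)"
definition \<psi> :: "real^'n \<Rightarrow> real" where "\<psi> x = \<phi> x / (real CARD('n) - 2)"

lemma smooth_k: "smooth_on S (\<lambda>y. k y a)"
  unfolding k_def lower_def by (intro smooth_rules smooth_G smooth_K)

lemma differentiable_K:
  assumes "x \<in> S" shows "(\<lambda>y. K y $ a) differentiable (at x)" "(\<lambda>y. k y a) differentiable (at x)"
  using smooth_on_differentiable[OF smooth_K assms] smooth_on_differentiable[OF smooth_k assms] .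

lemma raise_k: "x \<in> S \<Longrightarrow> raise G x (k x) a = K x $ a"
  using ginv_unique[of x "\<lambda>c. K x $ c" "k x" a] by (simp add: raise_def k_def lower_def)

lemma k_nonzero:
  assumes "x \<in> S"
  obtains a where "k x a \<noteq> 0"
proof -
  have "\<exists>a. k x a \<noteq> 0"
  proof (rule ccontr)
    assume "\<not> ?thesis"
    then have "raise G x (k x) a = 0" for a by (simp add: raise_def)
    then have "K x = 0" by (simp add: raise_k[OF assms] vec_eq_iff)
    with K_nonzero[OF assms] show False by simp
  qed
  with that show thesis by blast
qed

lemma k_K: "x \<in> S \<Longrightarrow> (\<Sum>a\<in>UNIV. k x a * K x $ a) = 0"
  using K_null by (simp add: k_def)

lemma partial_k:
  assumes x: "x \<in> S"
  shows "partial a (\<lambda>y. k y b) x = f x a * k x b + (\<Sum>e\<in>UNIV. \<Gamma> x e a b * k x e)"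
  using cov1_lower[OF x differentiable_K(1)[OF x], of a b]
  by (simp add: cov1_def cov_K[OF x] k_def lower_def sum_distrib_left mult_ac)

lemma differentiable_f:
  assumes x: "x \<in> S"
  shows "(\<lambda>y. f y a) differentiable (at x)"
proof -
  obtain b where b: "K x $ b \<noteq> 0" using K_nonzero[OF x] by (auto simp: vec_eq_iff)
  have "smooth_on S (\<lambda>y. cov_vec G K y a b)"
    unfolding cov_vec_def by (intro smooth_rules smooth_K smooth_christoffel)
  then show ?thesis
    using differentiable_cofactor[OF open_S x _ smooth_K b, of "\<lambda>y. cov_vec G K y a b" "\<lambda>y. f y a"]
      smooth_on_differentiable[OF _ x] cov_K by blast
qed

text \<open>\<open>F\<close> is the exterior derivative of the one-form \<open>f\<close>: in \<open>\<nabla>\<^sub>a (f\<^sub>b K\<^sup>c)\<close> the term \<open>f\<^sub>b f\<^sub>a K\<^sup>c\<close> is symmetric.\<close>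

lemma riemann_K:
  assumes x: "x \<in> S"
  obtains F where "\<And>c. (\<Sum>d\<in>UNIV. riemann G x a b c d * K x $ d) = F * K x $ c"
proof -
  define B where "B a b = partial a (\<lambda>y. f y b) x - (\<Sum>e\<in>UNIV. \<Gamma> x e a b * f x e) + f x b * f x a" for a b
  have 1: "cov_cov_vec G K x a b c = B a b * K x $ c" for a b c
  proof -
    have "partial a (\<lambda>y. cov_vec G K y b c) x = partial a (\<lambda>y. f y b * K y $ c) x"
      by (rule partial_cong_open[OF open_S x cov_K])
    also have "\<dots> = partial a (\<lambda>y. f y b) x * K x $ c + f x b * partial a (\<lambda>y. K y $ c) x"
      by (simp add: partial_mult differentiable_f differentiable_K x)
    also have "partial a (\<lambda>y. K y $ c) x = f x a * K x $ c - (\<Sum>e\<in>UNIV. \<Gamma> x c a e * K x $ e)"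
      using cov_K[OF x, of a c] by (simp add: cov_vec_def)
    finally show ?thesis
      by (simp add: B_def cov_cov_vec_def cov_mixed_def cov_K[OF x] algebra_simps sum_distrib_left)
  qed
  have "(\<Sum>d\<in>UNIV. riemann G x a b c d * K x $ d) = (B a b - B b a) * K x $ c" for c
    using ricci_identity[OF open_S x smooth_G transpose_G invertible_G smooth_K, of a b c]
    by (simp add: 1 left_diff_distrib)
  then show thesis by (rule that)
qed

text \<open>The scalar curvature is \<open>\<phi> K\<^sub>a K\<^sup>a = 0\<close>.\<close>

lemma schouten_K:
  assumes x: "x \<in> S"
  shows "schouten G x a b = \<psi> x * k x a * k x b"
proof -
  have "contract G x (ricci G x) = contract G x (\<lambda>a b. \<phi> x * (k x a * k x b))"
    by (simp add: contract_def ricci_K[OF x] k_def mult_ac)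
  then have "scal G x = 0"
    by (simp only: contract_ricci contract_mult contract_product raise_k[OF x] k_K[OF x])
  then show ?thesis
    by (simp add: schouten_def ricci_K[OF x] k_def \<psi>_def)
qed

text \<open>The Riemann part is \<open>- F\<^sub>a\<^sub>b K\<^sub>d X\<^sup>d\<close>, and every term of the Schouten part contains \<open>P\<^sub>a\<^sub>d X\<^sup>d\<close> or \<open>P\<^sub>a\<^sub>e K\<^sup>e\<close>.\<close>

lemma weyl_K:
  assumes x: "x \<in> S" and X: "(\<Sum>d\<in>UNIV. k x d * X $ d) = 0"
  shows "(\<Sum>e\<in>UNIV. \<Sum>d\<in>UNIV. weyl G x a b e d * K x $ e * X $ d) = 0"
proof -
  obtain F where F: "\<And>c. (\<Sum>d\<in>UNIV. riemann G x a b c d * K x $ d) = F * K x $ c"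
    using riemann_K[OF x] by blast
  have "(\<Sum>e\<in>UNIV. riemann_low G x a b d e * K x $ e) = F * k x d" for d
  proof -
    have "(\<Sum>e\<in>UNIV. riemann_low G x a b d e * K x $ e) = (\<Sum>c\<in>UNIV. G x $ d $ c * (\<Sum>e\<in>UNIV. riemann G x a b c e * K x $ e))"
      unfolding riemann_low_def sum_distrib_left sum_distrib_right
      by (rule trans[OF sum.swap]) (simp add: mult_ac)
    also have "\<dots> = F * k x d"
      unfolding F k_def lower_def sum_distrib_left by (simp add: mult_ac)
    finally show ?thesis .
  qed
  then have "(\<Sum>d\<in>UNIV. (\<Sum>e\<in>UNIV. - riemann_low G x a b d e * K x $ e) * X $ d) = - F * (\<Sum>d\<in>UNIV. k x d * X $ d)"
    by (simp add: sum_negf sum_distrib_left mult_ac)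
  then have R: "(\<Sum>e\<in>UNIV. \<Sum>d\<in>UNIV. riemann_low G x a b e d * K x $ e * X $ d) = 0"
    unfolding X sum_distrib_right riemann_low_skew34[OF x, of a b _ _, symmetric]
    by (subst sum.swap) simp
  have PX: "(\<Sum>d\<in>UNIV. schouten G x b d * X $ d) = 0" for b
    using X by (simp add: schouten_K[OF x] mult.assoc sum_distrib_left[symmetric])
  have PK: "(\<Sum>d\<in>UNIV. schouten G x b d * K x $ d) = 0" for b
    using k_K[OF x] by (simp add: schouten_K[OF x] mult.assoc sum_distrib_left[symmetric])
  have "(\<Sum>e\<in>UNIV. \<Sum>d\<in>UNIV. kulkarni G x (schouten G x) a b e d * K x $ e * X $ d)
     = (\<Sum>e\<in>UNIV. G x $ e $ a * K x $ e) * (\<Sum>d\<in>UNIV. schouten G x b d * X $ d)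
      - (\<Sum>e\<in>UNIV. G x $ e $ b * K x $ e) * (\<Sum>d\<in>UNIV. schouten G x a d * X $ d)
      + (\<Sum>e\<in>UNIV. schouten G x a e * K x $ e) * (\<Sum>d\<in>UNIV. G x $ d $ b * X $ d)
      - (\<Sum>e\<in>UNIV. schouten G x b e * K x $ e) * (\<Sum>d\<in>UNIV. G x $ d $ a * X $ d)"
    unfolding kulkarni_def sum_product by (simp add: algebra_simps sum.distrib sum_subtractf)
  with R PX PK show ?thesis
    by (simp add: weyl_eq left_diff_distrib sum_subtractf)
qed

text \<open>Since \<open>K\<close> is recurrent, \<open>\<nabla>\<^sub>b (\<psi> K\<^sub>c K\<^sub>a) = q\<^sub>b K\<^sub>c K\<^sub>a\<close> with \<open>q\<^sub>b = \<nabla>\<^sub>b \<psi> + 2 \<psi> f\<^sub>b\<close>.\<close>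

lemma cotton_K:
  obtains q where "\<And>y a b c. y \<in> S \<Longrightarrow> cotton G y a b c = (q y b * k y c - q y c * k y b) * k y a"
proof
  fix x a b c assume x: "x \<in> S"
  obtain i where i: "k x i \<noteq> 0" using k_nonzero[OF x] .
  have d\<psi>: "\<psi> differentiable (at x)"
  proof (rule differentiable_cofactor[OF open_S x])
    show "(\<lambda>y. schouten G y i i) differentiable (at x)" by (rule differentiable_curvature[OF x])
    show "smooth_on S (\<lambda>y. k y i * k y i)" by (intro smooth_rules smooth_k)
  qed (use i schouten_K in \<open>auto simp: mult.assoc\<close>)
  have "cov2 G (schouten G) x b c a = (partial b \<psi> x + 2 * \<psi> x * f x b) * k x c * k x a" for b c
  proof -
    have "cov2 G (schouten G) x b c a = cov2 G (\<lambda>y a b. \<psi> y * k y a * k y b) x b c a"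
      by (rule cov2_cong[OF schouten_K x])
    also have "\<dots> = (partial b \<psi> x + 2 * \<psi> x * f x b) * k x c * k x a"
      by (simp add: cov2_def partial_mult differentiable_mult d\<psi> differentiable_K x partial_k[OF x] algebra_simps sum_distrib_left)
    finally show ?thesis .
  qed
  then show "cotton G x a b c = ((\<lambda>x b. partial b \<psi> x + 2 * \<psi> x * f x b) x b * k x c
      - (\<lambda>x b. partial b \<psi> x + 2 * \<psi> x * f x b) x c * k x b) * k x a"
    by (simp add: cotton_eq algebra_simps)
qed

lemma cotton_orthogonal:
  assumes x: "x \<in> S" and X: "(\<Sum>d\<in>UNIV. k x d * X $ d) = 0"
  shows "(\<Sum>a\<in>UNIV. cotton G x a b c * X $ a) = 0"
proof -
  obtain q where "\<And>y a b c. y \<in> S \<Longrightarrow> cotton G y a b c = (q y b * k y c - q y c * k y b) * k y a"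
    using cotton_K by blast
  then show ?thesis using X by (simp add: x mult.assoc sum_distrib_left[symmetric])
qed

text \<open>Writing the Cotton tensor as \<open>K\<^sub>a z\<^sub>b\<^sub>c\<close>, its derivative is \<open>K\<^sub>a (f\<^sub>e z\<^sub>b\<^sub>c + \<nabla>\<^sub>e z\<^sub>b\<^sub>c)\<close>. The other term of the Bach
  tensor is \<open>\<psi> K\<^sup>d K\<^sup>c C\<^sub>d\<^sub>a\<^sub>c\<^sub>b\<close>, to which \<open>weyl_K\<close> applies after the two index pairs are exchanged.\<close>

lemma bach_orthogonal:
  assumes x: "x \<in> S" and X: "(\<Sum>d\<in>UNIV. k x d * X $ d) = 0"
  shows "(\<Sum>a\<in>UNIV. bach G x a b * X $ a) = 0"
proof -
  obtain q where q: "\<And>y a b c. y \<in> S \<Longrightarrow> cotton G y a b c = (q y b * k y c - q y c * k y b) * k y a"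
    using cotton_K by blast
  define z where "z y b c = q y b * k y c - q y c * k y b" for y b c
  have A: "cotton G y a b c = k y a * z y b c" if "y \<in> S" for y a b c
    using q[OF that] by (simp add: z_def)
  obtain i where i: "k x i \<noteq> 0" using k_nonzero[OF x] .
  have dz: "(\<lambda>y. z y b c) differentiable (at x)" for b c
    by (rule differentiable_cofactor[OF open_S x differentiable_curvature(7)[OF x, of i b c] smooth_k i]) (simp add: A)
  define Z where "Z e c b = f x e * z x c b + partial e (\<lambda>y. z y c b) x - (\<Sum>d\<in>UNIV. \<Gamma> x d e c * z x d b)
     - (\<Sum>d\<in>UNIV. \<Gamma> x d e b * z x c d)" for e c b
  have DA: "cov3 G (cotton G) x e a c b = Z e c b * k x a" for e a c
  proof -
    have "cov3 G (cotton G) x e a c b = cov3 G (\<lambda>y a c b. k y a * z y c b) x e a c b"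
      by (rule cov3_cong[OF A x])
    also have "\<dots> = Z e c b * k x a"
      by (simp add: cov3_def Z_def partial_mult dz differentiable_K x partial_k[OF x] algebra_simps sum_distrib_left)
    finally show ?thesis .
  qed
  have 1: "(\<Sum>a\<in>UNIV. contract G x (\<lambda>c e. cov3 G (cotton G) x e a c b) * X $ a) = 0"
    using X by (simp add: DA contract_mult_right mult.assoc sum_distrib_left[symmetric])
  have 2: "contract G x (\<lambda>d e. contract G x (\<lambda>c f. schouten G x e f * weyl G x d a c b))
     = \<psi> x * (\<Sum>c\<in>UNIV. (\<Sum>d\<in>UNIV. weyl G x c b d a * K x $ d) * K x $ c)" for a
  proof -
    have "contract G x (\<lambda>c f. schouten G x e f * weyl G x d a c b) = \<psi> x * ((\<Sum>c\<in>UNIV. weyl G x d a c b * K x $ c) * k x e)" for d e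
      using contract_mult[of G x "\<psi> x * k x e" "\<lambda>c f. weyl G x d a c b * k x f"]
        contract_product[of G x "\<lambda>c. weyl G x d a c b" "k x"]
      by (simp add: schouten_K[OF x] raise_k[OF x] mult_ac)
    then have "contract G x (\<lambda>d e. contract G x (\<lambda>c f. schouten G x e f * weyl G x d a c b))
       = \<psi> x * (\<Sum>d\<in>UNIV. (\<Sum>c\<in>UNIV. weyl G x d a c b * K x $ c) * K x $ d)"
      by (simp only: contract_mult contract_product raise_k[OF x])
    also have "(\<Sum>d\<in>UNIV. (\<Sum>c\<in>UNIV. weyl G x d a c b * K x $ c) * K x $ d)
        = (\<Sum>c\<in>UNIV. (\<Sum>d\<in>UNIV. weyl G x c b d a * K x $ d) * K x $ c)"
      unfolding sum_distrib_right
      by (rule trans[OF sum.swap]) (intro sum.cong refl, subst weyl_pair[OF x], simp add: mult_ac)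
    finally show ?thesis .
  qed
  have "(\<Sum>a\<in>UNIV. (\<Sum>c\<in>UNIV. (\<Sum>d\<in>UNIV. weyl G x c b d a * K x $ d) * K x $ c) * X $ a)
    = (\<Sum>c\<in>UNIV. (\<Sum>d\<in>UNIV. \<Sum>a\<in>UNIV. weyl G x c b d a * K x $ d * X $ a) * K x $ c)"
    unfolding sum_distrib_right
    by (subst sum_swap_outer_inner, subst (2) sum.swap) (simp add: mult_ac)
  also have "\<dots> = 0" by (simp add: weyl_K[OF x X])
  finally have "(\<Sum>a\<in>UNIV. contract G x (\<lambda>d e. contract G x (\<lambda>c f. schouten G x e f * weyl G x d a c b)) * X $ a) = 0"
    by (simp add: 2 mult.assoc sum_distrib_left[symmetric])
  with 1 show ?thesis
    by (simp add: bach_eq distrib_right sum.distrib)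
qed

end

section \<open>Metrics conformal to a pure radiation metric\<close>

locale conformal_to_pure_radiation =
  conformal_metrics S H G v + H: pure_radiation_chart S H K \<phi> f
  for S :: "(real^'n::finite) set" and H G :: "'n metric_comps" and v K \<phi> f
begin

lemma orthogonal_conf:
  assumes x: "x \<in> S" and X: "(\<Sum>d\<in>UNIV. lower G x (K x) d * X $ d) = 0"
  shows "(\<Sum>d\<in>UNIV. H.k x d * X $ d) = 0"
proof -
  have "lower G x (K x) d = exp (2 * v x) * H.k x d" for d
    by (simp add: lower_def H.k_def G_eq[OF x] sum_distrib_left mult_ac)
  then have "(\<Sum>d\<in>UNIV. lower G x (K x) d * X $ d) = exp (2 * v x) * (\<Sum>d\<in>UNIV. H.k x d * X $ d)"
    by (simp add: sum_distrib_left mult.assoc)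
  with X show ?thesis by simp
qed

lemma grad_conf:
  assumes x: "x \<in> S"
  shows "grad G (\<lambda>y. - v y) x a = - exp (- 2 * v x) * dvu x a"
  by (simp add: grad_def ginv_conf[OF x] partial_minus[OF differentiable_dv(1)[OF x]] dvu_def raise_def dv_def
      sum_distrib_left sum_negf mult_ac)

lemma weyl_orthogonal:
  assumes x: "x \<in> S" and X: "(\<Sum>d\<in>UNIV. lower G x (K x) d * X $ d) = 0"
  shows "(\<Sum>e\<in>UNIV. \<Sum>d\<in>UNIV. weyl G x a b e d * K x $ e * X $ d) = 0"
proof -
  have "(\<Sum>e\<in>UNIV. \<Sum>d\<in>UNIV. weyl G x a b e d * K x $ e * X $ d)
    = exp (2 * v x) * (\<Sum>e\<in>UNIV. \<Sum>d\<in>UNIV. weyl H x a b e d * K x $ e * X $ d)"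
    by (simp add: weyl_conf[OF H.dim x] sum_distrib_left mult.assoc)
  then show ?thesis
    using H.weyl_K[OF x orthogonal_conf[OF x X]] by simp
qed

lemma weyl_grad:
  assumes x: "x \<in> S"
  shows "(\<Sum>d\<in>UNIV. weyl G x e b a d * grad G (\<lambda>y. - v y) x d) = - (\<Sum>d\<in>UNIV. weyl H x e b a d * dvu x d)"
proof -
  have "exp (2 * v x) * exp (- 2 * v x) = 1" by (simp add: exp_add[symmetric])
  then have "weyl G x e b a d * grad G (\<lambda>y. - v y) x d = - (weyl H x e b a d * dvu x d)" for d
    by (simp add: weyl_conf[OF H.dim x] grad_conf[OF x] mult_ac)
  then show ?thesis by (simp add: sum_negf)
qed

lemma cotton_weyl_orthogonal:
  assumes x: "x \<in> S" and X: "(\<Sum>d\<in>UNIV. lower G x (K x) d * X $ d) = 0"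
  shows "(\<Sum>a\<in>UNIV. (cotton G x a b e + (\<Sum>d\<in>UNIV. weyl G x e b a d * grad G (\<lambda>y. - v y) x d)) * X $ a) = 0"
  using H.cotton_orthogonal[OF x orthogonal_conf[OF x X]]
  by (simp add: cotton_conf[OF H.dim x] weyl_grad[OF x])

text \<open>By \<open>bach_conf\<close>, subtracting the Weyl term leaves the Bach tensor and the two Cotton terms of \<open>H\<close>.
  The orthogonality of \<open>X\<close> kills the first two of these and that of \<open>Y\<close> the last.\<close>

lemma bach_weyl_orthogonal:
  assumes x: "x \<in> S" and X: "(\<Sum>d\<in>UNIV. lower G x (K x) d * X $ d) = 0"
    and Y: "(\<Sum>d\<in>UNIV. lower G x (K x) d * Y $ d) = 0"
  shows "(\<Sum>a\<in>UNIV. \<Sum>b\<in>UNIV. (bach G x a b - (real CARD('n) - 4) *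
      (\<Sum>e\<in>UNIV. \<Sum>d\<in>UNIV. weyl G x a e b d * grad G (\<lambda>y. - v y) x e * grad G (\<lambda>y. - v y) x d)) * X $ a * Y $ b) = 0"
proof -
  note X' = orthogonal_conf[OF x X] and Y' = orthogonal_conf[OF x Y]
  have e: "exp (2 * v x) * exp (- 2 * v x) = 1" by (simp add: exp_add[symmetric])
  define r where "r = exp (- 2 * v x)"
  have "weyl G x a e b d * grad G (\<lambda>y. - v y) x e * grad G (\<lambda>y. - v y) x d
      = (exp (2 * v x) * r) * (r * (weyl H x a e b d * dvu x e * dvu x d))" for a b d e
    by (simp add: weyl_conf[OF H.dim x] grad_conf[OF x] r_def mult_ac)
  then have W: "(\<Sum>e\<in>UNIV. \<Sum>d\<in>UNIV. weyl G x a e b d * grad G (\<lambda>y. - v y) x e * grad G (\<lambda>y. - v y) x d)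
      = r * (\<Sum>e\<in>UNIV. \<Sum>d\<in>UNIV. weyl H x a e b d * dvu x e * dvu x d)" for a b
    unfolding r_def e by (simp add: sum_distrib_left)
  have D: "bach G x a b - (real CARD('n) - 4) *
      (\<Sum>e\<in>UNIV. \<Sum>d\<in>UNIV. weyl G x a e b d * grad G (\<lambda>y. - v y) x e * grad G (\<lambda>y. - v y) x d)
     = r * (bach H x a b + (real CARD('n) - 4) * ((\<Sum>c\<in>UNIV. dvu x c * cotton H x a c b) + (\<Sum>c\<in>UNIV. dvu x c * cotton H x b c a)))" for a b
    unfolding W bach_conf[OF H.dim x] r_def[symmetric] by (simp add: distrib_left sum.distrib)
  have 1: "(\<Sum>a\<in>UNIV. \<Sum>b\<in>UNIV. bach H x a b * X $ a * Y $ b) = 0"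
    by (subst sum.swap) (simp add: sum_distrib_right[symmetric] H.bach_orthogonal[OF x X'])
  have 2: "(\<Sum>a\<in>UNIV. (\<Sum>c\<in>UNIV. dvu x c * cotton H x a c b) * X $ a) = 0" if "(\<Sum>d\<in>UNIV. H.k x d * X $ d) = 0" for X :: "real^'n" and b
  proof -
    have "(\<Sum>a\<in>UNIV. (\<Sum>c\<in>UNIV. dvu x c * cotton H x a c b) * X $ a)
       = (\<Sum>c\<in>UNIV. dvu x c * (\<Sum>a\<in>UNIV. cotton H x a c b * X $ a))"
      unfolding sum_distrib_left sum_distrib_right by (rule trans[OF sum.swap]) (simp add: mult_ac)
    then show ?thesis by (simp add: H.cotton_orthogonal[OF x that])
  qed
  have 3: "(\<Sum>a\<in>UNIV. \<Sum>b\<in>UNIV. (\<Sum>c\<in>UNIV. dvu x c * cotton H x a c b) * X $ a * Y $ b) = 0"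
    by (subst sum.swap) (simp add: sum_distrib_right[symmetric] 2[OF X'])
  have 4: "(\<Sum>a\<in>UNIV. \<Sum>b\<in>UNIV. (\<Sum>c\<in>UNIV. dvu x c * cotton H x b c a) * X $ a * Y $ b) = 0"
    using 2[OF Y'] by (simp add: mult.assoc mult.left_commute[of _ "X $ _"] sum_distrib_left[symmetric])
  have "(\<Sum>a\<in>UNIV. \<Sum>b\<in>UNIV. (r * (bach H x a b + (real CARD('n) - 4) * ((\<Sum>c\<in>UNIV. dvu x c * cotton H x a c b) + (\<Sum>c\<in>UNIV. dvu x c * cotton H x b c a)))) * X $ a * Y $ b)
    = r * ((\<Sum>a\<in>UNIV. \<Sum>b\<in>UNIV. bach H x a b * X $ a * Y $ b)
      + (real CARD('n) - 4) * ((\<Sum>a\<in>UNIV. \<Sum>b\<in>UNIV. (\<Sum>c\<in>UNIV. dvu x c * cotton H x a c b) * X $ a * Y $ b)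
       + (\<Sum>a\<in>UNIV. \<Sum>b\<in>UNIV. (\<Sum>c\<in>UNIV. dvu x c * cotton H x b c a) * X $ a * Y $ b)))"
    unfolding distrib_left distrib_right sum.distrib sum_distrib_left[symmetric] mult.assoc ..
  then show ?thesis
    unfolding D 1 3 4 by simp
qed

end

section \<open>The conformal factor as a global function\<close>

lemma chart_inv_eq:
  assumes "smooth_manifold M A" "c \<in> A" "q \<in> fst c"
  shows "chart_inv c (snd c q) = q"
proof -
  have hom: "homeomorphic_map (subtopology M (fst c)) (top_of_set (chart_image c)) (snd c)" and "openin M (fst c)"
    using assms unfolding smooth_manifold_def by blast+
  then have "topspace (subtopology M (fst c)) = fst c"
    using openin_subset by (auto simp: topspace_subtopology)
  with homeomorphic_imp_injective_map[OF hom] have "inj_on (snd c) (fst c)"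
    by simp
  then show ?thesis
    unfolding chart_inv_def using assms(3) by (rule inv_into_f_f)
qed

lemma open_chart_image:
  assumes M: "smooth_manifold M A" and c: "c \<in> A" and V: "openin M V"
  shows "open (snd c ` (fst c \<inter> V))"
proof -
  have hom: "homeomorphic_map (subtopology M (fst c)) (top_of_set (chart_image c)) (snd c)"
    and op: "open (chart_image c)"
    using M c unfolding smooth_manifold_def by blast+
  have "openin (subtopology M (fst c)) (fst c \<inter> V)"
    using V by (auto simp: openin_subtopology)
  then have "openin (top_of_set (chart_image c)) (snd c ` (fst c \<inter> V))"
    using homeomorphic_imp_open_map[OF hom] unfolding open_map_def by blast
  then show ?thesis
    using op openin_open_trans by blast
qed

text \<open>Wherever two local conformal factors are both defined they agree, because an invertible matrix
  has a nonzero entry. So the value at \<open>p\<close> of any factor defined near \<open>p\<close> gives a function that coincides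
  locally with smooth ones.\<close>

lemma conformal_factor_global:
  assumes M: "smooth_manifold M A" and g: "pseudo_riemannian_metric A g" and conf: "conformal M A g h"
  obtains \<Upsilon> where "smooth_function_on A (topspace M) \<Upsilon>"
    "\<And>c x i j. c \<in> A \<Longrightarrow> x \<in> chart_image c \<Longrightarrow> h c x $ i $ j = exp (2 * \<Upsilon> (chart_inv c x)) * g c x $ i $ j"
proof -
  define P where "P V p u \<longleftrightarrow> openin M V \<and> p \<in> V \<and> smooth_function_on A V u \<and>
        (\<forall>c\<in>A. \<forall>x\<in>snd c ` (fst c \<inter> V). \<forall>i j. h c x $ i $ j = exp (2 * u (chart_inv c x)) * g c x $ i $ j)" for V p u
  have "\<forall>p\<in>topspace M. \<exists>V u. P V p u"
    using conf unfolding conformal_def P_def by blast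
  then obtain V u where Vu: "\<And>p. p \<in> topspace M \<Longrightarrow> P (V p) p (u p)"
    by metis
  have cov: "\<exists>c\<in>A. q \<in> fst c" if "q \<in> topspace M" for q
    using M that unfolding smooth_manifold_def by blast
  have sub: "fst c \<subseteq> topspace M" if "c \<in> A" for c
    using M that unfolding smooth_manifold_def by blast
  have unique: "u q q = u p q" if p: "p \<in> topspace M" and q: "q \<in> topspace M" "q \<in> V p" for p q
  proof -
    obtain c where c: "c \<in> A" "q \<in> fst c" using cov[OF q(1)] by blast
    define x where "x = snd c q"
    have x: "x \<in> snd c ` (fst c \<inter> V p)" "x \<in> snd c ` (fst c \<inter> V q)" "x \<in> chart_image c" "chart_inv c x = q"
      using c q Vu[OF q(1)] chart_inv_eq[OF M c] by (auto simp: x_def P_def chart_image_def)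
    have "invertible (g c x)"
      using g c(1) x(3) unfolding pseudo_riemannian_metric_def by blast
    then have "g c x \<noteq> 0"
      by (metis det_0 invertible_det_nz zero_neq_one mat_0)
    then obtain i j where ij: "g c x $ i $ j \<noteq> 0"
      by (auto simp: vec_eq_iff)
    have "exp (2 * u p q) * g c x $ i $ j = exp (2 * u q q) * g c x $ i $ j"
      using Vu[OF p] Vu[OF q(1)] c(1) x unfolding P_def by metis
    with ij show ?thesis by simp
  qed
  define \<Upsilon> where "\<Upsilon> p = u p p" for p
  show thesis
  proof (rule that)
    show "smooth_function_on A (topspace M) \<Upsilon>"
      unfolding smooth_function_on_def
    proof (intro ballI smooth_on_locally)
      fix c x assume c: "c \<in> A" and "x \<in> snd c ` (fst c \<inter> topspace M)"
      then obtain q where q: "q \<in> fst c" "q \<in> topspace M" "x = snd c q" by blast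
      define U where "U = snd c ` (fst c \<inter> V q)"
      have V: "openin M (V q)" "q \<in> V q" "smooth_on U (u q \<circ> chart_inv c)"
        using Vu[OF q(2)] c unfolding P_def U_def smooth_function_on_def by blast+
      have U: "open U"
        unfolding U_def by (rule open_chart_image[OF M c V(1)])
      have "(\<Upsilon> \<circ> chart_inv c) y = (u q \<circ> chart_inv c) y" if "y \<in> U" for y
        using that unique[OF q(2)] sub[OF c] chart_inv_eq[OF M c] by (auto simp: U_def \<Upsilon>_def)
      then have "smooth_on U (\<Upsilon> \<circ> chart_inv c)"
        using smooth_on_cong[OF U] V(3) by blast
      moreover have "x \<in> U" using q V(2) by (simp add: U_def)
      ultimately show "\<exists>U. open U \<and> x \<in> U \<and> smooth_on U (\<Upsilon> \<circ> chart_inv c)"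
        using U by blast
    qed
  next
    fix c x i j assume c: "c \<in> A" and "x \<in> chart_image c"
    then obtain q where q: "q \<in> fst c" "x = snd c q" unfolding chart_image_def by blast
    then have "q \<in> topspace M" using sub[OF c] by blast
    from Vu[OF this] q c chart_inv_eq[OF M c q(1)]
    show "h c x $ i $ j = exp (2 * \<Upsilon> (chart_inv c x)) * g c x $ i $ j"
      unfolding P_def \<Upsilon>_def by auto
  qed
qed

theorem theorem1:
  fixes M :: "'m topology" and A :: "('m, 'n::finite) chart set"
    and g g' :: "('m, 'n) metric_field" and K :: "('m, 'n) vec_field"
  assumes "CARD('n) \<ge> 3"
    and "smooth_manifold M A"
    and "pseudo_riemannian_metric A g"
    and "pure_radiation_parallel_rays A g' K"
    and "conformal M A g g'"
  shows "(\<forall>c\<in>A. \<forall>x\<in>chart_image c. \<forall>X::real^'n.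
            (\<Sum>d\<in>UNIV. lower (g c) x (K c x) d * X $ d) = 0 \<longrightarrow>
            (\<forall>a b. (\<Sum>e\<in>UNIV. \<Sum>d\<in>UNIV. weyl (g c) x a b e d * K c x $ e * X $ d) = 0)) \<and>
         (\<exists>\<Upsilon>::'m \<Rightarrow> real. smooth_function_on A (topspace M) \<Upsilon> \<and>
            (\<forall>c\<in>A. \<forall>x\<in>chart_image c. \<forall>X::real^'n.
               (\<Sum>d\<in>UNIV. lower (g c) x (K c x) d * X $ d) = 0 \<longrightarrow>
               (\<forall>b e. (\<Sum>a\<in>UNIV.
                   (cotton (g c) x a b e
                    + (\<Sum>d\<in>UNIV. weyl (g c) x e b a d * grad (g c) (\<Upsilon> \<circ> chart_inv c) x d))
                   * X $ a) = 0)) \<and>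
            (\<forall>c\<in>A. \<forall>x\<in>chart_image c. \<forall>X Y::real^'n.
               (\<Sum>d\<in>UNIV. lower (g c) x (K c x) d * X $ d) = 0 \<longrightarrow>
               (\<Sum>d\<in>UNIV. lower (g c) x (K c x) d * Y $ d) = 0 \<longrightarrow>
               (\<Sum>a\<in>UNIV. \<Sum>b\<in>UNIV.
                   (bach (g c) x a b
                    - (real CARD('n) - 4) *
                      (\<Sum>e\<in>UNIV. \<Sum>d\<in>UNIV. weyl (g c) x a e b d
                         * grad (g c) (\<Upsilon> \<circ> chart_inv c) x e
                         * grad (g c) (\<Upsilon> \<circ> chart_inv c) x d))
                   * X $ a * Y $ b) = 0))"
proof -
  obtain \<Upsilon> where \<Upsilon>: "smooth_function_on A (topspace M) \<Upsilon>"
    and conf: "\<And>c x i j. c \<in> A \<Longrightarrow> x \<in> chart_image c \<Longrightarrow> g' c x $ i $ j = exp (2 * \<Upsilon> (chart_inv c x)) * g c x $ i $ j"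
    by (rule conformal_factor_global[OF assms(2,3,5)], rule that)
  note radiation = assms(4)[unfolded pure_radiation_parallel_rays_def]
  from radiation[THEN conjunct2, THEN conjunct2, THEN conjunct2, THEN conjunct1]
  obtain \<phi> where ric: "\<forall>c\<in>A. \<forall>x\<in>chart_image c. \<forall>a b. ricci (g' c) x a b =
      \<phi> (chart_inv c x) * lower (g' c) x (K c x) a * lower (g' c) x (K c x) b" ..
  from radiation[THEN conjunct2, THEN conjunct2, THEN conjunct2, THEN conjunct2]
  obtain f where cov: "covector_field A f \<and> (\<forall>c\<in>A. \<forall>x\<in>chart_image c. \<forall>a b.
      cov_vec (g' c) (K c) x a b = f c x $ a * K c x $ b)" ..
  have loc: "conformal_to_pure_radiation (chart_image c) (g' c) (g c) (\<lambda>y. - (\<Upsilon> \<circ> chart_inv c) y) (K c)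
      (\<lambda>x. \<phi> (chart_inv c x)) (\<lambda>x a. f c x $ a)" if c: "c \<in> A" for c
  proof -
    have metric: "metric_chart (chart_image c) (h c)" if h: "pseudo_riemannian_metric A h" for h :: "('m, 'n) metric_field"
    proof
      show "open (chart_image c)"
        using assms(2) c by (simp add: smooth_manifold_def)
      show "smooth_on (chart_image c) (\<lambda>y. h c y $ i $ j)" for i j
        using h c by (simp add: pseudo_riemannian_metric_def)
      show "transpose (h c y) = h c y" "invertible (h c y)" if "y \<in> chart_image c" for y
        using h c that by (simp_all add: pseudo_riemannian_metric_def)
    qed
    have img: "snd c ` (fst c \<inter> topspace M) = chart_image c"
      using assms(2) c unfolding smooth_manifold_def chart_image_def by (metis Int_absorb2 openin_subset)
    then have sm: "smooth_on (chart_image c) (\<Upsilon> \<circ> chart_inv c)"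
      using \<Upsilon> c unfolding smooth_function_on_def by metis
    have op: "open (chart_image c)"
      using assms(2) c unfolding smooth_manifold_def by blast
    have rad: "pseudo_riemannian_metric A g'" "smooth_vector_field A K"
      "\<And>x. x \<in> chart_image c \<Longrightarrow> K c x \<noteq> 0 \<and> (\<Sum>a\<in>UNIV. lower (g' c) x (K c x) a * K c x $ a) = 0"
      using assms(4) c unfolding pure_radiation_parallel_rays_def by blast+
    interpret H: metric_chart "chart_image c" "g' c" by (rule metric[OF rad(1)])
    interpret G: metric_chart "chart_image c" "g c" by (rule metric[OF assms(3)])
    show ?thesis
    proof unfold_locales
      show "smooth_on (chart_image c) (\<lambda>y. - (\<Upsilon> \<circ> chart_inv c) y)"
        by (rule smooth_on_minus[OF op sm])
      show "g c x $ i $ j = exp (2 * - (\<Upsilon> \<circ> chart_inv c) x) * g' c x $ i $ j" if "x \<in> chart_image c" for x i j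
        by (simp add: conf[OF c that] mult.assoc[symmetric] exp_add[symmetric])
      show "smooth_on (chart_image c) (\<lambda>y. K c y $ k)" for k
        using rad(2) c unfolding smooth_vector_field_def by blast
    qed (use assms(1) rad(3) ric[rule_format, OF c] cov[THEN conjunct2, rule_format, OF c] in auto)
  qed
  have neg: "(\<lambda>y. - (- (\<Upsilon> \<circ> chart_inv c) y)) = \<Upsilon> \<circ> chart_inv c" for c
    by auto
  show ?thesis
    by (intro conjI exI[of _ \<Upsilon>] ballI allI impI \<Upsilon>
        conformal_to_pure_radiation.weyl_orthogonal[OF loc]
        conformal_to_pure_radiation.cotton_weyl_orthogonal[OF loc, unfolded neg]
        conformal_to_pure_radiation.bach_weyl_orthogonal[OF loc, unfolded neg])
qed

end
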